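(* Let $M$ be a compact bordered Riemann surface, let $\theta$ be a nowhere vanishing holomorphic $1$-form on $M$, let $n\in\mathbb{N}$, and let $f\colon M\to\mathbb{C}^n_*=\mathbb{C}^n\setminus\{0\}$ be a map of class $\mathscr{A}(M)$. Then the following hold. (i) For any $r\in\mathbb{Z}_+$ and any group homomorphism $\mathfrak{q}\colon H_1(M;\mathbb{Z})\to\mathrm{span}(f(M))\subset\mathbb{C}^n$, the space of all functions $h\in\mathscr{A}^r(M,\mathbb{C}_* )$ satisfying $\int_\gamma hf\theta=\mathfrak{q}(\gamma)$ for every closed curve $\gamma\subset M$ is a complex Banach manifold with the natural $\mathscr{C}^r(M)$-topology. (ii) For any $r\in\mathbb{Z}_+$ and any group homomorphism $\mathfrak{q}\colon H_1(M;\mathbb{Z})\to\mathrm{span}(f(M))\subset\mathbb{C}^n$, the space of all functions $h\in\mathscr{A}^r(M,\mathbb{C}_* )$ satisfying $\int_\gamma\Re(hf\theta)=\Re(\mathfrak{q}(\gamma))$ for every closed curve $\gamma\subset M$ is a real analytic Banach manifold with the natural $\mathscr{C}^r(M)$-topology.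
   Context: A compact bordered Riemann surface is a compact Riemann surface $M$ with nonempty boundary $bM\subset M$ consisting of finitely many pairwise disjoint smooth Jordan curves; it may be viewed as a smoothly bounded compact domain in an open Riemann surface, and a holomorphic $1$-form on $M$ is the restriction of a holomorphic $1$-form on an open neighborhood of $M$ there. $\mathbb{Z}_+=\{0,1,2,\dots\}$, $\mathbb{C}_*=\mathbb{C}\setminus\{0\}$. For $r\in\mathbb{Z}_+$, $\mathscr{A}^r(M)$ is the space of $\mathscr{C}^r$ functions $M\to\mathbb{C}$ which are holomorphic in the interior $\mathring M=M\setminus bM$; $\mathscr{A}^r(M,Z)$ is the analogous space of maps to a complex manifold $Z$; $\mathscr{A}=\mathscr{A}^0$, and a map is of class $\mathscr{A}(M)$ if it is continuous on $M$ and holomorphic on $\mathring M$. $\mathrm{span}$ denotes the $\mathbb{C}$-linear span. *)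

theory Defs
  imports "HOL-Complex_Analysis.Complex_Analysis" "HOL-Homology.Homology"
    "HOL-Library.Function_Algebras"
begin

section \<open>Compact bordered Riemann surfaces\<close>

type_synonym 'a chart = "'a set \<times> ('a \<Rightarrow> complex)"

definition riemann_surface :: "'a topology \<Rightarrow> 'a chart set \<Rightarrow> bool" where
  "riemann_surface X \<A> \<longleftrightarrow>
     Hausdorff_space X \<and> connected_space X \<and> (\<Union>(U, \<phi>)\<in>\<A>. U) = topspace X \<and>
     (\<forall>(U, \<phi>)\<in>\<A>. openin X U \<and> open (\<phi> ` U) \<and>
        homeomorphic_map (subtopology X U) (top_of_set (\<phi> ` U)) \<phi>) \<and>
     (\<forall>(U, \<phi>)\<in>\<A>. \<forall>(V, \<psi>)\<in>\<A>. (\<psi> \<circ> inv_into U \<phi>) holomorphic_on \<phi> ` (U \<inter> V))"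

definition open_riemann_surface :: "'a topology \<Rightarrow> 'a chart set \<Rightarrow> bool" where
  "open_riemann_surface X \<A> \<longleftrightarrow> riemann_surface X \<A> \<and> \<not> compact_space X"

text \<open>A smooth Jordan curve is the image of a smooth 1-periodic immersion that is injective on a
  period; \<open>D k\<close> is the \<open>k\<close>-th derivative of the curve read in a chart.\<close>

definition smooth_jordan_curve :: "'a topology \<Rightarrow> 'a chart set \<Rightarrow> 'a set \<Rightarrow> bool" where
  "smooth_jordan_curve X \<A> J \<longleftrightarrow>
     (\<exists>c :: real \<Rightarrow> 'a. continuous_map euclideanreal X c \<and> (\<forall>t. c (t + 1) = c t) \<and>
        inj_on c {0..<1} \<and> range c = J \<and>
        (\<forall>(U, \<phi>)\<in>\<A>. \<exists>D :: nat \<Rightarrow> real \<Rightarrow> complex. \<forall>t. c t \<in> U \<longrightarrow>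
            D 0 t = \<phi> (c t) \<and> D 1 t \<noteq> 0 \<and>
            (\<forall>k. (D k has_vector_derivative D (Suc k) t) (at t))))"

text \<open>A compact bordered Riemann surface \<open>M\<close>, viewed as a smoothly bounded compact domain in an
  open Riemann surface \<open>X\<close>. Since \<open>M\<close> is the closure of its interior, it lies locally on one side
  of each of its boundary curves.\<close>

definition compact_bordered_riemann_surface ::
    "'a topology \<Rightarrow> 'a chart set \<Rightarrow> 'a set \<Rightarrow> bool" where
  "compact_bordered_riemann_surface X \<A> M \<longleftrightarrow>
     open_riemann_surface X \<A> \<and> compactin X M \<and> connectedin X M \<and>
     X closure_of (X interior_of M) = M \<and>
     X frontier_of M \<noteq> {} \<and>
     (\<exists>\<J>. finite \<J> \<and> disjoint \<J> \<and> (\<forall>J\<in>\<J>. smooth_jordan_curve X \<A> J) \<and>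
          \<Union>\<J> = X frontier_of M)"


section \<open>Holomorphic 1-forms\<close>

text \<open>A 1-form is given by its coefficient functions: \<open>\<theta> (U, \<phi>) d\<phi>\<close> is its expression in the
  chart \<open>(U, \<phi>)\<close>. A form is holomorphic on \<open>M\<close> if it is so on an open neighbourhood of \<open>M\<close>.\<close>

type_synonym 'a form = "'a chart \<Rightarrow> 'a \<Rightarrow> complex"

definition holomorphic_form_on ::
    "'a topology \<Rightarrow> 'a chart set \<Rightarrow> 'a set \<Rightarrow> 'a form \<Rightarrow> bool" where
  "holomorphic_form_on X \<A> M \<theta> \<longleftrightarrow>
     (\<exists>W. openin X W \<and> M \<subseteq> W \<and>
        (\<forall>(U, \<phi>)\<in>\<A>. (\<theta> (U, \<phi>) \<circ> inv_into U \<phi>) holomorphic_on \<phi> ` (U \<inter> W)) \<and>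
        (\<forall>(U, \<phi>)\<in>\<A>. \<forall>(V, \<psi>)\<in>\<A>. \<forall>x\<in>U \<inter> V \<inter> W.
            \<theta> (U, \<phi>) x = \<theta> (V, \<psi>) x * deriv (\<psi> \<circ> inv_into U \<phi>) (\<phi> x)))"

definition nowhere_vanishing_form_on :: "'a chart set \<Rightarrow> 'a set \<Rightarrow> 'a form \<Rightarrow> bool" where
  "nowhere_vanishing_form_on \<A> M \<theta> \<longleftrightarrow> (\<forall>(U, \<phi>)\<in>\<A>. \<forall>x\<in>U \<inter> M. \<theta> (U, \<phi>) x \<noteq> 0)"


section \<open>Function spaces\<close>

definition holomorphic_interior ::
    "'a topology \<Rightarrow> 'a chart set \<Rightarrow> 'a set \<Rightarrow> ('a \<Rightarrow> complex) \<Rightarrow> bool" where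
  "holomorphic_interior X \<A> M h \<longleftrightarrow>
     (\<forall>(U, \<phi>)\<in>\<A>. (h \<circ> inv_into U \<phi>) holomorphic_on \<phi> ` (U \<inter> X interior_of M))"

definition class_A ::
    "'a topology \<Rightarrow> 'a chart set \<Rightarrow> 'a set \<Rightarrow> ('a \<Rightarrow> complex ^ 'n) \<Rightarrow> bool" where
  "class_A X \<A> M f \<longleftrightarrow>
     continuous_map (subtopology X M) euclidean f \<and>
     (\<forall>i. holomorphic_interior X \<A> M (\<lambda>x. f x $ i))"

text \<open>\<open>D i j\<close> is the partial derivative of \<open>g\<close> of order \<open>i\<close> in \<open>Re z\<close> and \<open>j\<close> in \<open>Im z\<close>. As usual
  on a domain with smooth boundary, \<open>g\<close> is of class \<open>C^r\<close> on \<open>S\<close> if it is so in the interior and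
  all its partial derivatives up to order \<open>r\<close> extend continuously to \<open>S\<close>; the extensions \<open>D i j\<close>
  are unique on \<open>S\<close> if \<open>S\<close> is contained in the closure of its interior.\<close>

definition Cr_jet ::
    "nat \<Rightarrow> complex set \<Rightarrow> (complex \<Rightarrow> complex) \<Rightarrow> (nat \<Rightarrow> nat \<Rightarrow> complex \<Rightarrow> complex) \<Rightarrow> bool" where
  "Cr_jet r S g D \<longleftrightarrow>
     (\<forall>z\<in>S. D 0 0 z = g z) \<and>
     (\<forall>i j. i + j \<le> r \<longrightarrow> continuous_on S (D i j)) \<and>
     (\<forall>i j. i + j < r \<longrightarrow> (\<forall>z\<in>interior S.
        (D i j has_derivative (\<lambda>w. Re w *\<^sub>R D (Suc i) j z + Im w *\<^sub>R D i (Suc j) z)) (at z)))"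

text \<open>Functions on \<open>M\<close> are represented by functions vanishing outside \<open>M\<close>.\<close>

definition Cr_space :: "'a chart set \<Rightarrow> 'a set \<Rightarrow> nat \<Rightarrow> ('a \<Rightarrow> complex) set" where
  "Cr_space \<A> M r =
     {h. (\<forall>x. x \<notin> M \<longrightarrow> h x = 0) \<and>
         (\<forall>(U, \<phi>)\<in>\<A>. \<exists>D. Cr_jet r (\<phi> ` (U \<inter> M)) (h \<circ> inv_into U \<phi>) D)}"

definition Ar_space :: "'a topology \<Rightarrow> 'a chart set \<Rightarrow> 'a set \<Rightarrow> nat \<Rightarrow> ('a \<Rightarrow> complex) set" where
  "Ar_space X \<A> M r = {h \<in> Cr_space \<A> M r. holomorphic_interior X \<A> M h}"

definition Ar_space_nonzero ::
    "'a topology \<Rightarrow> 'a chart set \<Rightarrow> 'a set \<Rightarrow> nat \<Rightarrow> ('a \<Rightarrow> complex) set" where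
  "Ar_space_nonzero X \<A> M r = {h \<in> Ar_space X \<A> M r. \<forall>x\<in>M. h x \<noteq> 0}"

text \<open>The \<open>C^r(M)\<close>-topology: uniform convergence of all partial derivatives up to order \<open>r\<close> on
  compact subsets of coordinate patches of \<open>M\<close>.\<close>

definition Cr_nbhd ::
    "'a chart set \<Rightarrow> 'a set \<Rightarrow> nat \<Rightarrow> ('a \<Rightarrow> complex) \<Rightarrow> 'a chart \<Rightarrow> 'a set \<Rightarrow> real \<Rightarrow>
       ('a \<Rightarrow> complex) set" where
  "Cr_nbhd \<A> M r g = (\<lambda>(U, \<phi>) K \<epsilon>.
     {h \<in> Cr_space \<A> M r. \<exists>D. Cr_jet r (\<phi> ` (U \<inter> M)) ((\<lambda>x. h x - g x) \<circ> inv_into U \<phi>) D \<and>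
        (\<forall>i j. i + j \<le> r \<longrightarrow> (\<forall>x\<in>K. norm (D i j (\<phi> x)) < \<epsilon>))})"

definition Cr_topology ::
    "'a topology \<Rightarrow> 'a chart set \<Rightarrow> 'a set \<Rightarrow> nat \<Rightarrow> ('a \<Rightarrow> complex) topology" where
  "Cr_topology X \<A> M r = topology_generated_by
     {Cr_nbhd \<A> M r g c K \<epsilon> | g c K \<epsilon>.
        g \<in> Cr_space \<A> M r \<and> c \<in> \<A> \<and> compactin X K \<and> K \<subseteq> fst c \<inter> M \<and> \<epsilon> > 0}"


section \<open>Periods\<close>

definition closed_curve :: "'a topology \<Rightarrow> 'a chart set \<Rightarrow> 'a set \<Rightarrow> (real \<Rightarrow> 'a) \<Rightarrow> bool" where
  "closed_curve X \<A> M \<gamma> \<longleftrightarrow>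
     pathin (subtopology X M) \<gamma> \<and> \<gamma> 0 = \<gamma> 1 \<and>
     (\<forall>(U, \<phi>)\<in>\<A>. \<forall>a b. 0 \<le> a \<and> a \<le> b \<and> b \<le> 1 \<and> \<gamma> ` {a..b} \<subseteq> U \<longrightarrow>
        (\<phi> \<circ> \<gamma>) piecewise_C1_differentiable_on {a..b})"

text \<open>The class of a closed curve, regarded as a singular 1-cycle, in the first homology group.\<close>

definition curve_class ::
    "'a topology \<Rightarrow> 'a set \<Rightarrow> (real \<Rightarrow> 'a) \<Rightarrow> 'a chain set" where
  "curve_class X M \<gamma> = homologous_rel_set 1 (subtopology X M) {}
     (frag_of (\<lambda>p \<in> standard_simplex 1. \<gamma> (p 1)))"

text \<open>\<open>\<gamma>\<^sup>*\<theta> = form_along \<A> \<theta> \<gamma> t dt\<close>; by the transformation rule of \<open>\<theta>\<close> the value does not depend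
  on the chart chosen around \<open>\<gamma> t\<close>.\<close>

definition form_along :: "'a chart set \<Rightarrow> 'a form \<Rightarrow> (real \<Rightarrow> 'a) \<Rightarrow> real \<Rightarrow> complex" where
  "form_along \<A> \<theta> \<gamma> t =
     (let c = (SOME c. c \<in> \<A> \<and> \<gamma> t \<in> fst c)
      in \<theta> c (\<gamma> t) * vector_derivative (snd c \<circ> \<gamma>) (at t))"

definition Re_vec :: "complex ^ 'n \<Rightarrow> real ^ 'n" where
  "Re_vec v = (\<chi> i. Re (v $ i))"

definition has_period ::
    "'a chart set \<Rightarrow> 'a form \<Rightarrow> ('a \<Rightarrow> complex ^ 'n) \<Rightarrow> (real \<Rightarrow> 'a) \<Rightarrow> complex ^ 'n \<Rightarrow> bool" where
  "has_period \<A> \<theta> u \<gamma> p \<longleftrightarrow>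
     ((\<lambda>t. form_along \<A> \<theta> \<gamma> t *s u (\<gamma> t)) has_integral p) {0..1}"

definition has_real_period ::
    "'a chart set \<Rightarrow> 'a form \<Rightarrow> ('a \<Rightarrow> complex ^ 'n) \<Rightarrow> (real \<Rightarrow> 'a) \<Rightarrow> real ^ 'n \<Rightarrow> bool" where
  "has_real_period \<A> \<theta> u \<gamma> p \<longleftrightarrow>
     ((\<lambda>t. Re_vec (form_along \<A> \<theta> \<gamma> t *s u (\<gamma> t))) has_integral p) {0..1}"

definition additive_group :: "'v::ab_group_add set \<Rightarrow> 'v monoid" where
  "additive_group V = \<lparr>carrier = V, mult = (+), one = 0\<rparr>"


section \<open>Banach manifolds\<close>

text \<open>The model spaces are not types: a Banach space over \<open>'k\<close> is a linear subspace \<open>V\<close> of an ambient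
  vector space (with scalar multiplication \<open>smul\<close> and no topology of its own) together with a
  complete norm \<open>N\<close> on \<open>V\<close>. The values of \<open>N\<close> outside \<open>V\<close> are irrelevant.\<close>

definition norm_dist :: "'v::ab_group_add set \<Rightarrow> ('v \<Rightarrow> real) \<Rightarrow> 'v \<Rightarrow> 'v \<Rightarrow> real" where
  "norm_dist V N v w = (if v \<in> V \<and> w \<in> V then N (v - w) else 0)"

definition norm_topology :: "'v::ab_group_add set \<Rightarrow> ('v \<Rightarrow> real) \<Rightarrow> 'v topology" where
  "norm_topology V N = Metric_space.mtopology V (norm_dist V N)"

definition banach_space_on ::
    "('k::real_normed_field \<Rightarrow> 'v::ab_group_add \<Rightarrow> 'v) \<Rightarrow> 'v set \<Rightarrow> ('v \<Rightarrow> real) \<Rightarrow> bool" where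
  "banach_space_on smul V N \<longleftrightarrow>
     vector_space smul \<and> module.subspace smul V \<and>
     (\<forall>v\<in>V. 0 \<le> N v \<and> (N v = 0 \<longleftrightarrow> v = 0)) \<and>
     (\<forall>v\<in>V. \<forall>w\<in>V. N (v + w) \<le> N v + N w) \<and>
     (\<forall>a. \<forall>v\<in>V. N (smul a v) = norm a * N v) \<and>
     Metric_space.mcomplete V (norm_dist V N)"

definition bounded_linear_between ::
    "('k::real_normed_field \<Rightarrow> 'v::ab_group_add \<Rightarrow> 'v) \<Rightarrow> 'v set \<Rightarrow> ('v \<Rightarrow> real) \<Rightarrow>
       'v set \<Rightarrow> ('v \<Rightarrow> real) \<Rightarrow> ('v \<Rightarrow> 'v) \<Rightarrow> bool" where
  "bounded_linear_between smul V N W P L \<longleftrightarrow>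
     L ` V \<subseteq> W \<and>
     (\<forall>u\<in>V. \<forall>v\<in>V. L (u + v) = L u + L v) \<and>
     (\<forall>a. \<forall>v\<in>V. L (smul a v) = smul a (L v)) \<and>
     (\<exists>B. \<forall>v\<in>V. P (L v) \<le> B * N v)"

text \<open>Holomorphic means Frechet differentiable over the complex numbers at every point of the open
  set \<open>\<Omega> \<subseteq> V\<close>.\<close>

definition holomorphic_between ::
    "(complex \<Rightarrow> 'v::ab_group_add \<Rightarrow> 'v) \<Rightarrow> 'v set \<Rightarrow> ('v \<Rightarrow> real) \<Rightarrow>
       'v set \<Rightarrow> ('v \<Rightarrow> real) \<Rightarrow> 'v set \<Rightarrow> ('v \<Rightarrow> 'v) \<Rightarrow> bool" where
  "holomorphic_between smul V N W P \<Omega> g \<longleftrightarrow>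
     g ` \<Omega> \<subseteq> W \<and>
     (\<forall>x\<in>\<Omega>. \<exists>L. bounded_linear_between smul V N W P L \<and>
        (\<forall>\<epsilon>>0. \<exists>\<delta>>0. \<forall>v\<in>V. N v < \<delta> \<longrightarrow>
           x + v \<in> \<Omega> \<and> P (g (x + v) - g x - L v) \<le> \<epsilon> * N v))"

text \<open>\<open>A vs\<close>, for lists \<open>vs\<close> of length \<open>k\<close>, is a bounded \<open>k\<close>-linear map of norm at most \<open>C k\<close>.\<close>

definition bounded_multilinear_between ::
    "(real \<Rightarrow> 'v::ab_group_add \<Rightarrow> 'v) \<Rightarrow> 'v set \<Rightarrow> ('v \<Rightarrow> real) \<Rightarrow>
       'v set \<Rightarrow> ('v \<Rightarrow> real) \<Rightarrow> (nat \<Rightarrow> real) \<Rightarrow> ('v list \<Rightarrow> 'v) \<Rightarrow> bool" where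
  "bounded_multilinear_between smul V N W P C A \<longleftrightarrow>
     (\<forall>vs. set vs \<subseteq> V \<longrightarrow>
        A vs \<in> W \<and> P (A vs) \<le> C (length vs) * prod_list (map N vs) \<and>
        (\<forall>i<length vs. \<forall>u\<in>V. \<forall>v\<in>V. A (vs[i := u + v]) = A (vs[i := u]) + A (vs[i := v])) \<and>
        (\<forall>i<length vs. \<forall>a. \<forall>v\<in>V. A (vs[i := smul a v]) = smul a (A (vs[i := v]))))"

text \<open>Real analytic means locally the sum of a convergent power series of bounded homogeneous
  polynomials \<open>v \<mapsto> A (v, \<dots>, v)\<close>.\<close>

definition real_analytic_between ::
    "(real \<Rightarrow> 'v::ab_group_add \<Rightarrow> 'v) \<Rightarrow> 'v set \<Rightarrow> ('v \<Rightarrow> real) \<Rightarrow>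
       'v set \<Rightarrow> ('v \<Rightarrow> real) \<Rightarrow> 'v set \<Rightarrow> ('v \<Rightarrow> 'v) \<Rightarrow> bool" where
  "real_analytic_between smul V N W P \<Omega> g \<longleftrightarrow>
     g ` \<Omega> \<subseteq> W \<and>
     (\<forall>x\<in>\<Omega>. \<exists>\<rho>>0. \<exists>C A. (\<forall>k. 0 \<le> C k) \<and> summable (\<lambda>k. C k * \<rho> ^ k) \<and>
        bounded_multilinear_between smul V N W P C A \<and>
        (\<forall>v\<in>V. N v < \<rho> \<longrightarrow> x + v \<in> \<Omega> \<and>
           (\<lambda>m. P (g (x + v) - (\<Sum>k<m. A (replicate k v)))) \<longlonglongrightarrow> 0))"

text \<open>An atlas on the space \<open>Y\<close>: a set of charts \<open>(U, \<phi>, V, N)\<close>, each a homeomorphism of an open set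
  \<open>U\<close> onto an open subset of its own Banach space \<open>(V, N)\<close>, with transition maps in the class
  \<open>regular V N W P \<Omega>\<close> of maps from \<open>\<Omega> \<subseteq> V\<close> to \<open>W\<close>.\<close>

definition banach_atlas ::
    "('k::real_normed_field \<Rightarrow> 'v::ab_group_add \<Rightarrow> 'v) \<Rightarrow>
     ('v set \<Rightarrow> ('v \<Rightarrow> real) \<Rightarrow> 'v set \<Rightarrow> ('v \<Rightarrow> real) \<Rightarrow> 'v set \<Rightarrow> ('v \<Rightarrow> 'v) \<Rightarrow> bool) \<Rightarrow>
     'b topology \<Rightarrow> ('b set \<times> ('b \<Rightarrow> 'v) \<times> 'v set \<times> ('v \<Rightarrow> real)) set \<Rightarrow> bool" where
  "banach_atlas smul regular Y \<B> \<longleftrightarrow>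
     (\<Union>(U, \<phi>, V, N)\<in>\<B>. U) = topspace Y \<and>
     (\<forall>(U, \<phi>, V, N)\<in>\<B>. banach_space_on smul V N \<and> openin Y U \<and>
        openin (norm_topology V N) (\<phi> ` U) \<and>
        homeomorphic_map (subtopology Y U) (subtopology (norm_topology V N) (\<phi> ` U)) \<phi>) \<and>
     (\<forall>(U, \<phi>, V, N)\<in>\<B>. \<forall>(U', \<psi>, W, P)\<in>\<B>.
        regular V N W P (\<phi> ` (U \<inter> U')) (\<psi> \<circ> inv_into U \<phi>))"

definition complex_banach_manifold ::
    "(complex \<Rightarrow> 'v::ab_group_add \<Rightarrow> 'v) \<Rightarrow> 'b topology \<Rightarrow> bool" where
  "complex_banach_manifold smul Y \<longleftrightarrow>
     Hausdorff_space Y \<and> (\<exists>\<B>. banach_atlas smul (holomorphic_between smul) Y \<B>)"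

definition real_analytic_banach_manifold ::
    "(real \<Rightarrow> 'v::ab_group_add \<Rightarrow> 'v) \<Rightarrow> 'b topology \<Rightarrow> bool" where
  "real_analytic_banach_manifold smul Y \<longleftrightarrow>
     Hausdorff_space Y \<and> (\<exists>\<B>. banach_atlas smul (real_analytic_between smul) Y \<B>)"

text \<open>Complex-valued functions as a complex and as a real vector space.\<close>

definition fun_scaleC :: "complex \<Rightarrow> ('a \<Rightarrow> complex) \<Rightarrow> 'a \<Rightarrow> complex" where
  "fun_scaleC c h = (\<lambda>x. c * h x)"

definition fun_scaleR :: "real \<Rightarrow> ('a \<Rightarrow> complex) \<Rightarrow> 'a \<Rightarrow> complex" where
  "fun_scaleR c h = (\<lambda>x. c *\<^sub>R h x)"

end

theory Submission
  imports Defs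
begin

text \<open>The periods of \<open>h f \<theta>\<close> depend linearly on \<open>h\<close>. If \<open>h\<^sub>0\<close> is one solution, the solutions are therefore
  exactly the zero-free functions in the affine space \<open>h\<^sub>0 + W\<close>, where \<open>W\<close> consists of the functions of
  class \<open>\<A>\<^sup>r\<close> all of whose periods (or real parts of periods) vanish. Once \<open>\<A>\<^sup>r(M)\<close> is known to be a
  Banach space in the \<open>C\<^sup>r\<close>-topology, the zero-free functions form an open set because \<open>M\<close> is compact, and
  once \<open>W\<close> is known to be closed, \<open>h \<mapsto> h - h\<^sub>0\<close> is a single global chart with values in the Banach space
  \<open>W\<close> (\<open>affine_banach_atlas\<close>). The space \<open>W\<close> is complex for complex periods and real for real periods. If
  there is no solution, the atlas is empty.

  The Banach space. The derivation \<open>h \<mapsto> dh / \<theta>\<close> makes sense because \<open>\<theta>\<close> has no zeros, and it does not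
  depend on charts. The norm of \<open>h\<close> is the supremum over \<open>M\<close> of the moduli of \<open>h\<close> and of its first \<open>r\<close> iterated
  derivatives in this sense, continued to the boundary (\<open>jet_norm\<close>). In a chart, these iterates and the ordinary complex derivatives are related by a
  triangular matrix of holomorphic functions (\<open>jet_coeff\<close>). This shows that the norm induces the
  \<open>C\<^sup>r\<close>-topology (\<open>Cr_topology_Ar\<close>), without any change of coordinates in higher derivatives. Completeness
  is the theorem of Weierstrass on uniform limits (\<open>limit_in_Ar\<close>).

  Closedness of \<open>W\<close>. A closed curve is continuous and continuously differentiable off a finite set, but its
  derivative may be unbounded, so the integral over it need not converge absolutely and need not
  obviously be continuous in \<open>h\<close>. However, if all periods of \<open>h f \<theta>\<close> vanish, then the integral over an
  initial piece of a closed curve is, up to sign, the integral over any curve that leads back to the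
  starting point. That curve can be taken from a family of uniformly bounded speed (\<open>uniformly_joined\<close>),
  and so all partial integrals are bounded by a constant times the maximum of \<open>\<bar>h\<bar>\<close>
  (\<open>partial_integral_bound\<close>). For a uniformly convergent sequence in \<open>W\<close> the partial integrals then converge
  uniformly. Their limit is continuous and is a primitive of the limit integrand off a finite set, so the
  fundamental theorem of calculus shows that the limit lies in \<open>W\<close> (\<open>zero_periods_limit\<close>).

  Curves of bounded speed. This is where the smoothness of the boundary enters: near a boundary point, \<open>M\<close>
  is one side of the graph of a Lipschitz function (\<open>frontier_is_graph\<close>, \<open>M_in_rectangle_is_side\<close>), and any
  two points there are joined by three segments. Connectedness and compactness of \<open>M\<close> do the rest.\<close>

section \<open>Jets of holomorphic functions in the plane\<close>

text \<open>If \<open>g\<^sub>j\<^sub>+\<^sub>1 = g\<^sub>j' / s\<close>, then the functions \<open>d\<^sub>k = (\<Sum>j\<le>k. jet_coeff s t k j * g\<^sub>j)\<close> satisfy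
  \<open>d\<^sub>k\<^sub>+\<^sub>1 = d\<^sub>k' / t\<close>; the recursion is what the product rule dictates.\<close>

primrec jet_coeff :: "(complex \<Rightarrow> complex) \<Rightarrow> (complex \<Rightarrow> complex) \<Rightarrow> nat \<Rightarrow> nat \<Rightarrow> complex \<Rightarrow> complex" where
  "jet_coeff s t 0 = (\<lambda>j z. if j = 0 then 1 else 0)"
| "jet_coeff s t (Suc k) = (\<lambda>j z. (deriv (jet_coeff s t k j) z +
      (if j = 0 then 0 else s z * jet_coeff s t k (j - 1) z)) / t z)"

lemma jet_coeff_holomorphic:
  assumes "open G" "s holomorphic_on G" "t holomorphic_on G" "\<forall>z\<in>G. t z \<noteq> 0"
  shows "jet_coeff s t k j holomorphic_on G"
proof (induction k arbitrary: j)
  case 0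
  then show ?case by simp
next
  case (Suc k)
  show ?case
    using assms Suc
    by (cases "j = 0") (auto intro!: holomorphic_intros holomorphic_deriv)
qed

lemma jet_coeff_eq_0: "k < j \<Longrightarrow> jet_coeff s t k j = (\<lambda>z. 0)"
proof (induction k arbitrary: j)
  case (Suc k)
  then have *: "jet_coeff s t k j = (\<lambda>z. 0)" "jet_coeff s t k (j - Suc 0) = (\<lambda>z. 0)" by simp_all
  show ?case using Suc.prems by (simp add: *)
qed auto

text \<open>This is the only comparison of two derivations. It is used with \<open>t = 1\<close> to pass from derivatives with
  respect to the 1-form to complex derivatives in a chart, and with \<open>s = 1\<close> to pass back.\<close>

lemma jet_coeff_has_field_derivative:
  assumes G: "open G" "s holomorphic_on G" "t holomorphic_on G" "\<forall>z\<in>G. t z \<noteq> 0"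
    and z: "z \<in> G" and g: "\<forall>j\<le>k. (g j has_field_derivative s z * g (Suc j) z) (at z)"
  shows "((\<lambda>z. \<Sum>j\<le>k. jet_coeff s t k j z * g j z) has_field_derivative
            t z * (\<Sum>j\<le>Suc k. jet_coeff s t (Suc k) j z * g j z)) (at z)"
proof -
  let ?b = "\<lambda>j. jet_coeff s t k j"
  have b: "(?b j has_field_derivative deriv (?b j) z) (at z)" for j
    using jet_coeff_holomorphic[OF G] G(1) z holomorphic_derivI by blast
  have "((\<lambda>z. \<Sum>j\<le>k. ?b j z * g j z) has_field_derivative
          (\<Sum>j\<le>k. deriv (?b j) z * g j z + s z * g (Suc j) z * ?b j z)) (at z)"
    using g by (auto intro!: DERIV_sum DERIV_mult b)
  moreover have "t z * (\<Sum>j\<le>Suc k. jet_coeff s t (Suc k) j z * g j z)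
      = (\<Sum>j\<le>Suc k. deriv (?b j) z * g j z + (if j = 0 then 0 else s z * ?b (j - 1) z) * g j z)"
    unfolding sum_distrib_left
    by (intro sum.cong refl) (use G(4) z in \<open>simp add: field_simps\<close>)
  moreover have "(\<Sum>j\<le>Suc k. deriv (?b j) z * g j z) = (\<Sum>j\<le>k. deriv (?b j) z * g j z)"
    by (simp add: jet_coeff_eq_0)
  moreover have "(\<Sum>j\<le>Suc k. (if j = 0 then 0 else s z * ?b (j - 1) z) * g j z)
      = (\<Sum>j\<le>k. s z * g (Suc j) z * ?b j z)"
    by (subst sum.atMost_Suc_shift) (simp add: mult_ac)
  ultimately show ?thesis by (simp only: sum.distrib)
qed

text \<open>By the Cauchy-Riemann equations, differentiation in \<open>Im z\<close> is \<open>\<i>\<close> times differentiation in \<open>Re z\<close>.\<close>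

lemma Cr_jet_of_derivatives:
  assumes "\<forall>k\<le>r. continuous_on S (d k)"
    and "\<forall>k<r. \<forall>z\<in>interior S. (d k has_field_derivative d (Suc k) z) (at z)"
    and "\<forall>z\<in>S. d 0 z = g z"
  shows "Cr_jet r S g (\<lambda>i j z. \<i> ^ j * d (i + j) z)"
  unfolding Cr_jet_def
proof (intro conjI allI impI ballI)
  fix i j z assume "i + j < r" "z \<in> interior S"
  then have "(d (i + j) has_derivative (\<lambda>w. d (Suc (i + j)) z * w)) (at z)"
    using assms(2) by (simp add: has_field_derivative_def)
  then have "((\<lambda>z. \<i> ^ j * d (i + j) z) has_derivative (\<lambda>w. \<i> ^ j * (d (Suc (i + j)) z * w))) (at z)"
    by (rule has_derivative_mult_right)
  moreover have "\<i> ^ j * (d (Suc (i + j)) z * w) =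
      Re w *\<^sub>R (\<i> ^ j * d (Suc i + j) z) + Im w *\<^sub>R (\<i> ^ Suc j * d (i + Suc j) z)" for w
  proof -
    have "\<i> ^ j * (d (Suc (i + j)) z * w) = \<i> ^ j * d (Suc (i + j)) z * (of_real (Re w) + \<i> * of_real (Im w))"
      using complex_eq[of w] by (simp add: mult.assoc)
    also have "\<dots> = Re w *\<^sub>R (\<i> ^ j * d (Suc i + j) z) + Im w *\<^sub>R (\<i> ^ Suc j * d (i + Suc j) z)"
      by (simp add: scaleR_conv_of_real algebra_simps)
    finally show ?thesis .
  qed
  ultimately show "((\<lambda>z. \<i> ^ j * d (i + j) z) has_derivative
     (\<lambda>w. Re w *\<^sub>R (\<i> ^ j * d (Suc i + j) z) + Im w *\<^sub>R (\<i> ^ Suc j * d (i + Suc j) z))) (at z)"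
    by simp
qed (use assms in \<open>auto intro!: continuous_intros\<close>)

text \<open>The complex derivative is the derivative in the real direction, so the entries \<open>D k 0\<close> of a jet are the
  complex derivatives, and each of them is again holomorphic.\<close>

lemma Cr_jet_derivatives:
  assumes D: "Cr_jet r S g D" and g: "g holomorphic_on interior S" and "k \<le> r"
  shows "D k 0 holomorphic_on interior S \<and>
    (k < r \<longrightarrow> (\<forall>z\<in>interior S. (D k 0 has_field_derivative D (Suc k) 0 z) (at z)))"
proof -
  have *: "(D k 0 has_field_derivative D (Suc k) 0 z) (at z)"
    if h: "D k 0 holomorphic_on interior S" "k < r" "z \<in> interior S" for k z
  proof -
    from h obtain f' where f': "(D k 0 has_field_derivative f') (at z)"
      using holomorphic_derivI open_interior by blast
    moreover have "(D k 0 has_derivative (\<lambda>w. Re w *\<^sub>R D (Suc k) 0 z + Im w *\<^sub>R D k (Suc 0) z)) (at z)"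
      using D h unfolding Cr_jet_def by fastforce
    ultimately have "(\<lambda>w. Re w *\<^sub>R D (Suc k) 0 z + Im w *\<^sub>R D k (Suc 0) z) = (*) f'"
      unfolding has_field_derivative_def by (rule has_derivative_unique[rotated])
    from fun_cong[OF this, of 1] have "D (Suc k) 0 z = f'" by simp
    with f' show ?thesis by simp
  qed
  have "D k 0 holomorphic_on interior S" if "k \<le> r" for k
    using that
  proof (induction k)
    case 0
    have "D 0 0 z = g z" if "z \<in> interior S" for z
      using D that interior_subset unfolding Cr_jet_def by blast
    then show ?case using g holomorphic_cong by metis
  next
    case (Suc k)
    then have "deriv (D k 0) holomorphic_on interior S" by (auto intro: holomorphic_deriv)
    moreover have "deriv (D k 0) z = D (Suc k) 0 z" if "z \<in> interior S" for z
      using Suc that by (intro DERIV_imp_deriv *) auto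
    ultimately show ?case using holomorphic_cong by metis
  qed
  with * show ?thesis using assms(3) by blast
qed

lemma Cr_jet_add:
  assumes "Cr_jet r S g D" "Cr_jet r S g' D'"
  shows "Cr_jet r S (\<lambda>z. g z + g' z) (\<lambda>i j z. D i j z + D' i j z)"
  unfolding Cr_jet_def
proof (intro conjI allI impI ballI)
  fix i j z assume "i + j < r" "z \<in> interior S"
  then have "((\<lambda>z. D i j z + D' i j z) has_derivative
     (\<lambda>w. (Re w *\<^sub>R D (Suc i) j z + Im w *\<^sub>R D i (Suc j) z) + (Re w *\<^sub>R D' (Suc i) j z + Im w *\<^sub>R D' i (Suc j) z))) (at z)"
    using assms unfolding Cr_jet_def by (intro has_derivative_add) auto
  then show "((\<lambda>z. D i j z + D' i j z) has_derivative (\<lambda>w. Re w *\<^sub>R (D (Suc i) j z + D' (Suc i) j z) + Im w *\<^sub>R (D i (Suc j) z + D' i (Suc j) z))) (at z)"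
    by (simp add: algebra_simps)
qed (use assms in \<open>auto simp: Cr_jet_def intro!: continuous_intros\<close>)

section \<open>Norms on subspaces, and open parts of closed affine subspaces\<close>

text \<open>All of \<open>banach_space_on\<close> except completeness. Linear subspaces inherit it, and completeness is added at
  the end for the closed ones.\<close>

locale normed_on =
  fixes smul :: "'k::real_normed_field \<Rightarrow> 'v::ab_group_add \<Rightarrow> 'v" and V :: "'v set" and N :: "'v \<Rightarrow> real"
  assumes vs: "vector_space smul" and sub: "module.subspace smul V"
    and N_nonneg: "v \<in> V \<Longrightarrow> 0 \<le> N v" and N_eq_0: "v \<in> V \<Longrightarrow> N v = 0 \<longleftrightarrow> v = 0"
    and N_triangle: "v \<in> V \<Longrightarrow> w \<in> V \<Longrightarrow> N (v + w) \<le> N v + N w"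
    and N_scale: "v \<in> V \<Longrightarrow> N (smul a v) = norm a * N v"
begin

interpretation vector_space smul by (rule vs)

lemma in_V [simp]:
  "0 \<in> V" "v \<in> V \<Longrightarrow> w \<in> V \<Longrightarrow> v + w \<in> V" "v \<in> V \<Longrightarrow> w \<in> V \<Longrightarrow> v - w \<in> V"
  "v \<in> V \<Longrightarrow> smul a v \<in> V" "v \<in> V \<Longrightarrow> - v \<in> V"
  using sub by (auto simp: subspace_0 subspace_add subspace_diff subspace_scale subspace_neg)

lemma N_0 [simp]: "N 0 = 0"
  using N_eq_0[of 0] by auto

lemma N_minus: "v \<in> V \<Longrightarrow> N (- v) = N v"
  using N_scale[of v "-1"] by simp

lemma N_commute: "v \<in> V \<Longrightarrow> w \<in> V \<Longrightarrow> N (v - w) = N (w - v)"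
  using N_minus[of "w - v"] by simp

lemma N_diff_triangle: "u \<in> V \<Longrightarrow> v \<in> V \<Longrightarrow> w \<in> V \<Longrightarrow> N (u - w) \<le> N (u - v) + N (v - w)"
  using N_triangle[of "u - v" "v - w"] by simp

lemma Metric: "Metric_space V (norm_dist V N)"
proof
  fix x y z
  show "0 \<le> norm_dist V N x y" by (simp add: norm_dist_def N_nonneg)
  show "norm_dist V N x y = norm_dist V N y x" by (simp add: norm_dist_def N_commute)
  assume "x \<in> V" "y \<in> V"
  then show "norm_dist V N x y = 0 \<longleftrightarrow> x = y" by (simp add: norm_dist_def N_eq_0)
  assume "z \<in> V"
  with \<open>x \<in> V\<close> \<open>y \<in> V\<close> show "norm_dist V N x z \<le> norm_dist V N x y + norm_dist V N y z"
    by (simp add: norm_dist_def N_diff_triangle)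
qed

lemma openin_norm_topology:
  "openin (norm_topology V N) U \<longleftrightarrow> U \<subseteq> V \<and> (\<forall>u\<in>U. \<exists>\<epsilon>>0. \<forall>v\<in>V. N (v - u) < \<epsilon> \<longrightarrow> v \<in> U)"
proof -
  interpret Metric_space V "norm_dist V N" by (rule Metric)
  have "mball u \<epsilon> = {v\<in>V. N (v - u) < \<epsilon>}" if "u \<in> V" for u \<epsilon>
    using that by (auto simp: mball_def norm_dist_def N_commute)
  then have "mball u \<epsilon> \<subseteq> U \<longleftrightarrow> (\<forall>v\<in>V. N (v - u) < \<epsilon> \<longrightarrow> v \<in> U)" if "u \<in> V" for u \<epsilon>
    using that by auto
  then show ?thesis
    unfolding norm_topology_def openin_mtopology by (meson subsetD)
qed

lemma topspace_norm_topology [simp]: "topspace (norm_topology V N) = V"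
  unfolding norm_topology_def using Metric by (simp add: Metric_space.topspace_mtopology)

lemma Hausdorff_norm_topology: "Hausdorff_space (norm_topology V N)"
  unfolding norm_topology_def using Metric by (simp add: Metric_space.Hausdorff_space_mtopology)

lemma mcomplete_iff:
  "Metric_space.mcomplete V (norm_dist V N) \<longleftrightarrow>
     (\<forall>h. range h \<subseteq> V \<and> (\<forall>e>0. \<exists>n0. \<forall>m\<ge>n0. \<forall>n\<ge>n0. N (h m - h n) < e) \<longrightarrow>
        (\<exists>v\<in>V. (\<lambda>n. N (h n - v)) \<longlonglongrightarrow> 0))"
proof -
  interpret Metric_space V "norm_dist V N" by (rule Metric)
  have 1: "MCauchy h \<longleftrightarrow> range h \<subseteq> V \<and> (\<forall>e>0. \<exists>n0. \<forall>m\<ge>n0. \<forall>n\<ge>n0. N (h m - h n) < e)" for h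
    unfolding MCauchy_def norm_dist_def by (auto simp: image_subset_iff)
  have 2: "(\<exists>x. limitin mtopology h x sequentially) \<longleftrightarrow> (\<exists>v\<in>V. (\<lambda>n. N (h n - v)) \<longlonglongrightarrow> 0)"
    if "range h \<subseteq> V" for h
  proof -
    have "limitin mtopology h x sequentially \<longleftrightarrow> x \<in> V \<and> (\<lambda>n. N (h n - x)) \<longlonglongrightarrow> 0" for x
      using that
      by (auto simp: limitin_metric tendsto_iff norm_dist_def image_subset_iff N_nonneg eventually_sequentially)
    then show ?thesis by blast
  qed
  show ?thesis unfolding mcomplete_def 1 using 2 by blast
qed

lemma banach_iff: "banach_space_on smul V N \<longleftrightarrow> Metric_space.mcomplete V (norm_dist V N)"
  unfolding banach_space_on_def using vs sub N_nonneg N_eq_0 N_triangle N_scale by blast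

lemma translation_homeomorphic:
  assumes "a \<in> V"
  shows "homeomorphic_map (norm_topology V N) (norm_topology V N) (\<lambda>v. v - a)"
proof -
  have c: "continuous_map (norm_topology V N) (norm_topology V N) (\<lambda>v. v - b)" if b: "b \<in> V" for b
    unfolding continuous_map_def
  proof (intro conjI allI impI)
    show "(\<lambda>v. v - b) \<in> topspace (norm_topology V N) \<rightarrow> topspace (norm_topology V N)"
      using b by auto
    fix U assume U: "openin (norm_topology V N) U"
    show "openin (norm_topology V N) {x \<in> topspace (norm_topology V N). x - b \<in> U}"
      unfolding openin_norm_topology
    proof (intro conjI ballI)
      fix u assume "u \<in> {x \<in> topspace (norm_topology V N). x - b \<in> U}"
      then have u: "u \<in> V" "u - b \<in> U" by auto
      with U obtain \<epsilon> where "\<epsilon> > 0" "\<forall>v\<in>V. N (v - (u - b)) < \<epsilon> \<longrightarrow> v \<in> U"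
        unfolding openin_norm_topology by blast
      then show "\<exists>\<epsilon>>0. \<forall>v\<in>V. N (v - u) < \<epsilon> \<longrightarrow> v \<in> {x \<in> topspace (norm_topology V N). x - b \<in> U}"
        using b by (intro exI[of _ \<epsilon>]) auto
    qed auto
  qed
  have "homeomorphic_maps (norm_topology V N) (norm_topology V N) (\<lambda>v. v - a) (\<lambda>v. v + a)"
    unfolding homeomorphic_maps_def using c[of a] c[of "- a"] assms by auto
  then show ?thesis using homeomorphic_map_maps by blast
qed

lemma normed_on_subspace:
  assumes "module.subspace smul W" "W \<subseteq> V"
  shows "normed_on smul W N"
  using assms vs N_nonneg N_eq_0 N_triangle N_scale
  by unfold_locales (auto simp: normed_on_def subset_iff vector_space_def)

text \<open>An open set of the subspace is the trace of the union of the balls of the large space that have the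
  same centres and radii.\<close>

lemma norm_topology_subspace:
  assumes "module.subspace smul W" "W \<subseteq> V"
  shows "norm_topology W N = subtopology (norm_topology V N) W"
proof -
  interpret W: normed_on smul W N using assms by (rule normed_on_subspace)
  have "openin (norm_topology W N) U \<longleftrightarrow> openin (subtopology (norm_topology V N) W) U" for U
  proof
    assume U: "openin (norm_topology W N) U"
    define B where "B = {v\<in>V. \<exists>u\<in>U. \<exists>\<epsilon>. (\<forall>w\<in>W. N (w - u) < \<epsilon> \<longrightarrow> w \<in> U) \<and> N (v - u) < \<epsilon>}"
    have "openin (norm_topology V N) B"
      unfolding openin_norm_topology
    proof (intro conjI ballI)
      fix v assume "v \<in> B"
      then obtain u \<epsilon> where u: "v \<in> V" "u \<in> U" "\<forall>w\<in>W. N (w - u) < \<epsilon> \<longrightarrow> w \<in> U" "N (v - u) < \<epsilon>"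
        unfolding B_def by blast
      have "u \<in> V" using u(2) U assms unfolding W.openin_norm_topology by auto
      have "w \<in> B" if "w \<in> V" "N (w - v) < \<epsilon> - N (v - u)" for w
        using N_diff_triangle[of w v u] that u \<open>u \<in> V\<close> unfolding B_def
        by (smt (verit, best) mem_Collect_eq)
      then show "\<exists>e>0. \<forall>w\<in>V. N (w - v) < e \<longrightarrow> w \<in> B"
        using u(4) by (intro exI[of _ "\<epsilon> - N (v - u)"]) auto
    qed (auto simp: B_def)
    moreover have "U = B \<inter> W"
    proof -
      have UW: "U \<subseteq> W" using U unfolding W.openin_norm_topology by blast
      have "u \<in> B" if "u \<in> U" for u
      proof -
        have "\<exists>\<epsilon>>0. \<forall>w\<in>W. N (w - u) < \<epsilon> \<longrightarrow> w \<in> U"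
          using conjunct2[OF U[unfolded W.openin_norm_topology]] that by (rule bspec)
        then obtain \<epsilon> where "\<epsilon> > 0" "\<forall>w\<in>W. N (w - u) < \<epsilon> \<longrightarrow> w \<in> U" by (elim exE conjE)
        then have "\<exists>\<epsilon>. (\<forall>w\<in>W. N (w - u) < \<epsilon> \<longrightarrow> w \<in> U) \<and> N (u - u) < \<epsilon>"
          by (intro exI[of _ \<epsilon>]) simp
        with that have "\<exists>u'\<in>U. \<exists>\<epsilon>. (\<forall>w\<in>W. N (w - u') < \<epsilon> \<longrightarrow> w \<in> U) \<and> N (u - u') < \<epsilon>"
          by (rule bexI[rotated])
        moreover have "u \<in> V" using that UW assms(2) by blast
        ultimately show "u \<in> B" unfolding B_def by simp
      qed
      with UW have "U \<subseteq> B \<inter> W" by blast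
      moreover have "B \<inter> W \<subseteq> U" unfolding B_def by blast
      ultimately show ?thesis by blast
    qed
    ultimately show "openin (subtopology (norm_topology V N) W) U"
      unfolding openin_subtopology by blast
  next
    assume "openin (subtopology (norm_topology V N) W) U"
    then obtain B where B: "openin (norm_topology V N) B" "U = B \<inter> W"
      unfolding openin_subtopology by blast
    show "openin (norm_topology W N) U"
      unfolding W.openin_norm_topology
    proof (intro conjI ballI)
      fix u assume "u \<in> U"
      then have "\<exists>\<epsilon>>0. \<forall>v\<in>V. N (v - u) < \<epsilon> \<longrightarrow> v \<in> B"
        using B unfolding openin_norm_topology by (meson IntD1)
      then obtain \<epsilon> where "\<epsilon> > 0" "\<forall>v\<in>V. N (v - u) < \<epsilon> \<longrightarrow> v \<in> B" by (elim exE conjE)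
      then show "\<exists>\<epsilon>>0. \<forall>v\<in>W. N (v - u) < \<epsilon> \<longrightarrow> v \<in> U"
        using assms(2) B(2) by (intro exI[of _ \<epsilon>]) auto
    qed (use B in auto)
  qed
  then show ?thesis by (simp add: topology_eq)
qed

lemma banach_closed_subspace:
  assumes "banach_space_on smul V N" "module.subspace smul W" "W \<subseteq> V"
    and closed: "\<And>(h :: nat \<Rightarrow> 'v) v. range h \<subseteq> W \<Longrightarrow> v \<in> V \<Longrightarrow> (\<lambda>n. N (h n - v)) \<longlonglongrightarrow> 0 \<Longrightarrow> v \<in> W"
  shows "banach_space_on smul W N"
proof -
  interpret W: normed_on smul W N using assms by (intro normed_on_subspace)
  show ?thesis
    unfolding W.banach_iff W.mcomplete_iff
  proof (intro allI impI, elim conjE)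
    fix h :: "nat \<Rightarrow> 'v" assume h: "range h \<subseteq> W" "\<forall>e>0. \<exists>n0. \<forall>m\<ge>n0. \<forall>n\<ge>n0. N (h m - h n) < e"
    then obtain v where "v \<in> V" "(\<lambda>n. N (h n - v)) \<longlonglongrightarrow> 0"
      using assms(1,3) unfolding banach_iff mcomplete_iff by (meson subset_trans)
    with closed[OF h(1)] show "\<exists>v\<in>W. (\<lambda>n. N (h n - v)) \<longlonglongrightarrow> 0" by blast
  qed
qed

text \<open>A single chart, the translation by a point of the affine space, suffices. Its only transition map is
  an identity map, so all that matters about the class of regular maps is that it contains the identity
  maps of open sets.\<close>

lemma affine_banach_atlas:
  assumes T: "subtopology T V = norm_topology V N"
    and W: "banach_space_on smul W N" "W \<subseteq> V"
    and B: "openin (norm_topology V N) B" and h0: "h0 \<in> V"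
    and Y: "Y = {h\<in>B. h - h0 \<in> W}" and TV: "V \<subseteq> topspace T"
    and reg: "\<And>\<Omega> g. openin (norm_topology W N) \<Omega> \<Longrightarrow> \<forall>x\<in>\<Omega>. g x = x \<Longrightarrow> regular W N W N \<Omega> g"
  shows "Hausdorff_space (subtopology T Y)"
    and "banach_atlas smul regular (subtopology T Y) {(Y, \<lambda>h. h - h0, W, N)}"
proof -
  have sub: "module.subspace smul W" using W unfolding banach_space_on_def by blast
  have BV: "B \<subseteq> V" using B openin_subset by fastforce
  have YV: "Y \<subseteq> V" using BV Y by auto
  have TY: "subtopology T Y = subtopology (norm_topology V N) Y"
    using subtopology_subtopology[of T V Y] YV T by (simp add: inf.absorb2)
  show "Hausdorff_space (subtopology T Y)"
    unfolding TY using Hausdorff_norm_topology Hausdorff_space_subtopology by blast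
  let ?\<phi> = "\<lambda>h. h - h0"
  have \<phi>Y: "?\<phi> ` Y = ?\<phi> ` B \<inter> W" using Y by auto
  have "openin (norm_topology V N) (?\<phi> ` B)"
    using translation_homeomorphic[OF h0] B homeomorphic_map_openness_eq by blast
  then have open\<phi>: "openin (norm_topology W N) (?\<phi> ` Y)"
    unfolding norm_topology_subspace[OF sub W(2)] openin_subtopology using \<phi>Y by blast
  have "homeomorphic_map (subtopology (norm_topology V N) Y) (subtopology (norm_topology V N) (?\<phi> ` Y)) ?\<phi>"
    using YV h0 by (intro homeomorphic_map_subtopologies translation_homeomorphic) auto
  moreover have "subtopology (norm_topology W N) (?\<phi> ` Y) = subtopology (norm_topology V N) (?\<phi> ` Y)"
  proof -
    have "W \<inter> ?\<phi> ` Y = ?\<phi> ` Y" using \<phi>Y by auto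
    then show ?thesis
      unfolding norm_topology_subspace[OF sub W(2)] subtopology_subtopology by simp
  qed
  ultimately have hom: "homeomorphic_map (subtopology T Y) (subtopology (norm_topology W N) (?\<phi> ` Y)) ?\<phi>"
    by (simp add: TY)
  have inj: "inj_on ?\<phi> Y" by (auto simp: inj_on_def)
  have R: "regular W N W N (?\<phi> ` Y) (?\<phi> \<circ> inv_into Y ?\<phi>)"
    using open\<phi> by (intro reg) (auto simp: inv_into_f_f[OF inj])
  have top: "topspace (subtopology T Y) = Y" using YV TV by auto
  have "openin (subtopology T Y) Y" using openin_topspace[of "subtopology T Y"] unfolding top .
  moreover have "subtopology (subtopology T Y) Y = subtopology T Y"
    by (simp add: subtopology_subtopology)
  ultimately show "banach_atlas smul regular (subtopology T Y) {(Y, ?\<phi>, W, N)}"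
    unfolding banach_atlas_def top using hom open\<phi> W(1) R by simp
qed

end

lemma normed_on_if_banach: "banach_space_on smul V N \<Longrightarrow> normed_on smul V N"
  unfolding banach_space_on_def normed_on_def by blast

lemma holomorphic_between_ident:
  assumes "banach_space_on smul W N" "openin (norm_topology W N) \<Omega>" "\<forall>x\<in>\<Omega>. g x = x"
  shows "holomorphic_between smul W N W N \<Omega> g"
proof -
  interpret normed_on smul W N using assms(1) by (rule normed_on_if_banach)
  have \<Omega>: "\<Omega> \<subseteq> W" using assms(2) unfolding openin_norm_topology by blast
  have "bounded_linear_between smul W N W N (\<lambda>v. v)"
    unfolding bounded_linear_between_def by (auto intro!: exI[of _ 1])
  moreover have "\<exists>\<delta>>0. \<forall>v\<in>W. N v < \<delta> \<longrightarrow> x + v \<in> \<Omega> \<and> N (g (x + v) - g x - v) \<le> \<epsilon> * N v"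
    if x: "x \<in> \<Omega>" and "\<epsilon> > 0" for x \<epsilon>
  proof -
    obtain \<delta> where "\<delta> > 0" "\<forall>v\<in>W. N (v - x) < \<delta> \<longrightarrow> v \<in> \<Omega>"
      using assms(2) x unfolding openin_norm_topology by blast
    moreover have "x + v \<in> \<Omega> \<and> N (g (x + v) - g x - v) \<le> \<epsilon> * N v" if "v \<in> W" "N v < \<delta>" for v
    proof -
      have "x + v \<in> \<Omega>"
        using calculation(2) that x \<Omega> by (metis (no_types) add_diff_cancel_left' in_V(2) subsetD)
      then show ?thesis using assms(3) x that \<open>\<epsilon> > 0\<close> N_nonneg by simp
    qed
    ultimately show ?thesis by blast
  qed
  ultimately show ?thesis
    unfolding holomorphic_between_def using \<Omega> assms(3) by (auto intro!: exI[of _ "\<lambda>v. v"])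
qed

lemma real_analytic_between_ident:
  assumes "banach_space_on smul W N" "openin (norm_topology W N) \<Omega>" "\<forall>x\<in>\<Omega>. g x = x"
  shows "real_analytic_between smul W N W N \<Omega> g"
proof -
  interpret normed_on smul W N using assms(1) by (rule normed_on_if_banach)
  interpret VS: vector_space smul by (rule vs)
  have \<Omega>: "\<Omega> \<subseteq> W" using assms(2) unfolding openin_norm_topology by blast
  have "\<exists>\<rho>>0. \<exists>C A. (\<forall>k. 0 \<le> C k) \<and> summable (\<lambda>k. C k * \<rho> ^ k) \<and>
        bounded_multilinear_between smul W N W N C A \<and>
        (\<forall>v\<in>W. N v < \<rho> \<longrightarrow> x + v \<in> \<Omega> \<and>
           (\<lambda>m. N (g (x + v) - (\<Sum>k<m. A (replicate k v)))) \<longlonglongrightarrow> 0)" if x: "x \<in> \<Omega>" for x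
  proof -
    obtain \<rho> where \<rho>: "\<rho> > 0" "\<forall>v\<in>W. N (v - x) < \<rho> \<longrightarrow> v \<in> \<Omega>"
      using assms(2) x unfolding openin_norm_topology by blast
    have xW: "x \<in> W" using x \<Omega> by auto
    \<comment> \<open>The identity is its own Taylor polynomial \<open>x + v\<close> of degree 1.\<close>
    define C :: "nat \<Rightarrow> real" where "C = (\<lambda>k. if k = 0 then N x else if k = 1 then 1 else 0)"
    define A where "A = (\<lambda>vs. if vs = [] then x else if length vs = 1 then hd vs else 0)"
    have "summable (\<lambda>k. C k * \<rho> ^ k)"
      by (rule summable_finite[of "{0,1}"]) (auto simp: C_def)
    moreover have "\<forall>k. 0 \<le> C k" using xW N_nonneg by (auto simp: C_def)
    moreover have "bounded_multilinear_between smul W N W N C A"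
      unfolding bounded_multilinear_between_def
    proof (intro allI impI)
      fix vs :: "'a list" assume vsW: "set vs \<subseteq> W"
      consider "vs = []" | v where "vs = [v]" | "length vs \<ge> 2"
        by (cases vs rule: remdups_adj.cases) auto
      then show "A vs \<in> W \<and> N (A vs) \<le> C (length vs) * prod_list (map N vs) \<and>
        (\<forall>i<length vs. \<forall>u\<in>W. \<forall>v\<in>W. A (vs[i := u + v]) = A (vs[i := u]) + A (vs[i := v])) \<and>
        (\<forall>i<length vs. \<forall>a. \<forall>v\<in>W. A (vs[i := smul a v]) = smul a (A (vs[i := v])))"
      proof cases
        case 3
        then have "A vs = 0" "A (vs[i := u]) = 0" for i u
          by (auto simp: A_def)
        then show ?thesis using 3 by (auto simp: C_def VS.scale_zero_right)
      qed (use xW vsW in \<open>auto simp: A_def C_def\<close>)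
    qed
    moreover have "x + v \<in> \<Omega> \<and> (\<lambda>m. N (g (x + v) - (\<Sum>k<m. A (replicate k v)))) \<longlonglongrightarrow> 0"
      if v: "v \<in> W" "N v < \<rho>" for v
    proof
      show \<Omega>v: "x + v \<in> \<Omega>"
        using \<rho>(2) v xW by (metis (no_types) add_diff_cancel_left' in_V(2))
      have "(\<Sum>k<m. A (replicate k v)) = x + v" if "m \<ge> 2" for m
      proof -
        have "(\<Sum>k<m. A (replicate k v)) = (\<Sum>k\<in>{0,1}. A (replicate k v))"
          using that by (intro sum.mono_neutral_right) (auto simp: A_def)
        then show ?thesis by (simp add: A_def)
      qed
      then have "\<forall>\<^sub>F m in sequentially. N (g (x + v) - (\<Sum>k<m. A (replicate k v))) = 0"
        using \<Omega>v assms(3) by (auto simp: eventually_sequentially intro!: exI[of _ 2])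
      then show "(\<lambda>m. N (g (x + v) - (\<Sum>k<m. A (replicate k v)))) \<longlonglongrightarrow> 0"
        by (rule tendsto_eventually)
    qed
    ultimately show ?thesis using \<rho>(1) by blast
  qed
  then show ?thesis unfolding real_analytic_between_def using \<Omega> assms(3) by auto
qed

section \<open>Charts and the derivation defined by the 1-form\<close>

text \<open>Estimates and identities on a bordered surface are proved in the interior and carried over to the
  boundary in this way.\<close>

lemma norm_le_on_dense:
  fixes F :: "complex \<Rightarrow> complex"
  assumes "continuous_on S F" "T \<subseteq> S" "S \<subseteq> closure T" "\<And>z. z \<in> T \<Longrightarrow> norm (F z) \<le> B" "z \<in> S"
  shows "norm (F z) \<le> B"
proof -
  obtain s where s: "\<forall>n. s n \<in> T" "s \<longlonglongrightarrow> z"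
    using assms closure_sequential by blast
  then have "(\<lambda>n. F (s n)) \<longlonglongrightarrow> F z"
    using assms by (intro continuous_on_tendsto_compose[OF assms(1)] always_eventually) auto
  then have "(\<lambda>n. norm (F (s n))) \<longlonglongrightarrow> norm (F z)" by (rule tendsto_norm)
  then show ?thesis by (rule Lim_bounded[where M = 0]) (use s assms in auto)
qed

locale bordered_surface =
  fixes X :: "'a topology" and \<A> :: "'a chart set" and M :: "'a set" and \<theta> :: "'a form"
  assumes surface: "compact_bordered_riemann_surface X \<A> M"
    and form: "holomorphic_form_on X \<A> M \<theta>"
    and nonvanishing: "nowhere_vanishing_form_on \<A> M \<theta>"
begin

abbreviation "int_M \<equiv> X interior_of M"
abbreviation "frontier_M \<equiv> X frontier_of M"
abbreviation "Ar r \<equiv> Ar_space X \<A> M r"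
abbreviation "pullback \<equiv> form_along \<A> \<theta>"

lemma riemann: "riemann_surface X \<A>"
  using surface unfolding compact_bordered_riemann_surface_def open_riemann_surface_def by blast

lemma Hausdorff: "Hausdorff_space X"
  using riemann unfolding riemann_surface_def by blast

lemma compact_M: "compactin X M" and connected_M: "connectedin X M"
  and closure_int_M: "X closure_of int_M = M" and frontier_nonempty: "frontier_M \<noteq> {}"
  using surface unfolding compact_bordered_riemann_surface_def by blast+

lemma closed_M: "closedin X M"
  using compact_M Hausdorff by (rule compactin_imp_closedin[rotated])

lemma M_subset: "M \<subseteq> topspace X"
  using compact_M by (rule compactin_subset_topspace)

lemma int_M_subset: "int_M \<subseteq> M" by (rule interior_of_subset)

lemma M_nonempty: "M \<noteq> {}"
  using frontier_nonempty by auto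

lemma chart_covers:
  assumes "x \<in> topspace X"
  shows "\<exists>U \<phi>. (U, \<phi>) \<in> \<A> \<and> x \<in> U"
proof -
  have "(\<Union>(U, \<phi>)\<in>\<A>. U) = topspace X"
    using riemann unfolding riemann_surface_def by (elim conjE)
  then have "x \<in> (\<Union>(U, \<phi>)\<in>\<A>. U)" using assms by simp
  then obtain c where "c \<in> \<A>" "x \<in> (case c of (U, \<phi>) \<Rightarrow> U)" by (elim UN_E)
  then show ?thesis by (cases c) auto
qed

lemma chart_openin: "(U, \<phi>) \<in> \<A> \<Longrightarrow> openin X U"
  and chart_open_range: "(U, \<phi>) \<in> \<A> \<Longrightarrow> open (\<phi> ` U)"
  and chart_homeomorphic: "(U, \<phi>) \<in> \<A> \<Longrightarrow> homeomorphic_map (subtopology X U) (top_of_set (\<phi> ` U)) \<phi>"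
proof -
  assume c: "(U, \<phi>) \<in> \<A>"
  have "\<forall>(U, \<phi>)\<in>\<A>. openin X U \<and> open (\<phi> ` U) \<and>
        homeomorphic_map (subtopology X U) (top_of_set (\<phi> ` U)) \<phi>"
    using riemann unfolding riemann_surface_def by (elim conjE)
  from bspec[OF this c]
  show "openin X U" "open (\<phi> ` U)" "homeomorphic_map (subtopology X U) (top_of_set (\<phi> ` U)) \<phi>"
    by simp_all
qed

lemma transition_holomorphic:
  assumes "(U, \<phi>) \<in> \<A>" "(V, \<psi>) \<in> \<A>"
  shows "(\<psi> \<circ> inv_into U \<phi>) holomorphic_on \<phi> ` (U \<inter> V)"
proof -
  have "\<forall>(U, \<phi>)\<in>\<A>. \<forall>(V, \<psi>)\<in>\<A>. (\<psi> \<circ> inv_into U \<phi>) holomorphic_on \<phi> ` (U \<inter> V)"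
    using riemann unfolding riemann_surface_def by (elim conjE)
  from bspec[OF this assms(1)] show ?thesis using assms(2) by auto
qed

lemma chart_topspace: "(U, \<phi>) \<in> \<A> \<Longrightarrow> topspace (subtopology X U) = U"
  using chart_openin openin_subset by fastforce

lemma chart_inj: "(U, \<phi>) \<in> \<A> \<Longrightarrow> inj_on \<phi> U"
  using homeomorphic_imp_injective_map[OF chart_homeomorphic] chart_topspace by metis

lemma chart_inv [simp]: "(U, \<phi>) \<in> \<A> \<Longrightarrow> x \<in> U \<Longrightarrow> inv_into U \<phi> (\<phi> x) = x"
  using chart_inj inv_into_f_f by fast

lemma chart_open_image:
  assumes "(U, \<phi>) \<in> \<A>" "openin X P" "P \<subseteq> U"
  shows "open (\<phi> ` P)"
proof -
  have "openin (subtopology X U) P"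
    using assms by (simp add: openin_open_subtopology chart_openin)
  then have "openin (top_of_set (\<phi> ` U)) (\<phi> ` P)"
    using homeomorphic_map_openness_eq[OF chart_homeomorphic[OF assms(1)]] by blast
  then show ?thesis using openin_open_eq[OF chart_open_range[OF assms(1)]] by blast
qed

lemma chart_open_preimage:
  assumes "(U, \<phi>) \<in> \<A>" "open Q"
  shows "openin X {x\<in>U. \<phi> x \<in> Q}"
proof -
  have "continuous_map (subtopology X U) (top_of_set (\<phi> ` U)) \<phi>"
    using chart_homeomorphic[OF assms(1)] homeomorphic_imp_continuous_map by blast
  then have "continuous_map (subtopology X U) euclidean \<phi>"
    by (simp add: continuous_map_in_subtopology)
  from openin_continuous_map_preimage[OF this, of Q, unfolded chart_topspace[OF assms(1)]] assms(2)
  have "openin (subtopology X U) {x\<in>U. \<phi> x \<in> Q}" by simp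
  then show ?thesis using openin_open_subtopology[OF chart_openin[OF assms(1)]] by simp
qed

lemma chart_inv_continuous:
  assumes "(U, \<phi>) \<in> \<A>"
  shows "continuous_map (top_of_set (\<phi> ` U)) X (inv_into U \<phi>)"
  unfolding continuous_map_def
proof (intro conjI allI impI)
  show "inv_into U \<phi> \<in> topspace (top_of_set (\<phi> ` U)) \<rightarrow> topspace X"
    using assms openin_subset[OF chart_openin[OF assms]] by auto
  fix P assume P: "openin X P"
  have "{z \<in> topspace (top_of_set (\<phi> ` U)). inv_into U \<phi> z \<in> P} = \<phi> ` (U \<inter> P)"
    using assms by auto
  moreover have "open (\<phi> ` (U \<inter> P))"
    using assms P chart_openin by (intro chart_open_image[OF assms]) auto
  ultimately show "openin (top_of_set (\<phi> ` U)) {z \<in> topspace (top_of_set (\<phi> ` U)). inv_into U \<phi> z \<in> P}"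
    using openin_open_eq[OF chart_open_range[OF assms]] by auto
qed

lemma chart_interior:
  assumes "(U, \<phi>) \<in> \<A>"
  shows "interior (\<phi> ` (U \<inter> M)) = \<phi> ` (U \<inter> int_M)"
proof (rule interior_unique)
  show "open (\<phi> ` (U \<inter> int_M))"
    using chart_openin[OF assms] by (intro chart_open_image[OF assms]) auto
  fix Q assume Q: "Q \<subseteq> \<phi> ` (U \<inter> M)" "open Q"
  have "{x\<in>U. \<phi> x \<in> Q} \<subseteq> M"
    using Q chart_inj[OF assms] by (auto simp: inj_on_def)
  then have "{x\<in>U. \<phi> x \<in> Q} \<subseteq> int_M"
    using chart_open_preimage[OF assms Q(2)] interior_of_maximal by metis
  then show "Q \<subseteq> \<phi> ` (U \<inter> int_M)" using Q by blast
qed (intro image_mono Int_mono order_refl int_M_subset)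

lemma chart_dense:
  assumes "(U, \<phi>) \<in> \<A>" "openin X P" "P \<subseteq> U"
  shows "\<phi> ` (P \<inter> M) \<subseteq> closure (\<phi> ` (P \<inter> int_M))"
proof
  fix z assume "z \<in> \<phi> ` (P \<inter> M)"
  then obtain x where x: "x \<in> P" "x \<in> M" "z = \<phi> x" by blast
  show "z \<in> closure (\<phi> ` (P \<inter> int_M))"
    unfolding closure_iff_nhds_not_empty
  proof (intro allI impI)
    fix Q Q' assume Q: "Q' \<subseteq> Q" "open Q'" "z \<in> Q'"
    let ?P = "P \<inter> {x\<in>U. \<phi> x \<in> Q'}"
    have 1: "openin X ?P"
      using assms(2) chart_open_preimage[OF assms(1) Q(2)] by (rule openin_Int)
    have 2: "x \<in> ?P" using x Q assms by auto
    have "x \<in> X closure_of (int_M)" using x closure_int_M by simp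
    from this[unfolded in_closure_of, THEN conjunct2, rule_format, OF conjI[OF 2 1]]
    obtain y where "y \<in> int_M" "y \<in> ?P" by (elim exE conjE)
    then show "\<phi> ` (P \<inter> int_M) \<inter> Q \<noteq> {}" using Q by blast
  qed
qed

lemma transition_has_field_derivative:
  assumes "(U, \<phi>) \<in> \<A>" "(V, \<psi>) \<in> \<A>" "x \<in> U" "x \<in> V"
  shows "((\<psi> \<circ> inv_into U \<phi>) has_field_derivative deriv (\<psi> \<circ> inv_into U \<phi>) (\<phi> x)) (at (\<phi> x))"
proof -
  have "open (\<phi> ` (U \<inter> V))"
    using assms chart_openin by (intro chart_open_image[OF assms(1)]) auto
  then show ?thesis
    using transition_holomorphic[OF assms(1,2)] assms(3,4) by (intro holomorphic_derivI) auto
qed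

text \<open>Some neighbourhood of \<open>M\<close> on which the form is holomorphic.\<close>

definition form_domain :: "'a set" where
  "form_domain = (SOME W. openin X W \<and> M \<subseteq> W \<and>
        (\<forall>(U, \<phi>)\<in>\<A>. (\<theta> (U, \<phi>) \<circ> inv_into U \<phi>) holomorphic_on \<phi> ` (U \<inter> W)) \<and>
        (\<forall>(U, \<phi>)\<in>\<A>. \<forall>(V, \<psi>)\<in>\<A>. \<forall>x\<in>U \<inter> V \<inter> W.
            \<theta> (U, \<phi>) x = \<theta> (V, \<psi>) x * deriv (\<psi> \<circ> inv_into U \<phi>) (\<phi> x)))"

lemma form_domain:
  "openin X form_domain \<and> M \<subseteq> form_domain \<and>
        (\<forall>(U, \<phi>)\<in>\<A>. (\<theta> (U, \<phi>) \<circ> inv_into U \<phi>) holomorphic_on \<phi> ` (U \<inter> form_domain)) \<and>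
        (\<forall>(U, \<phi>)\<in>\<A>. \<forall>(V, \<psi>)\<in>\<A>. \<forall>x\<in>U \<inter> V \<inter> form_domain.
            \<theta> (U, \<phi>) x = \<theta> (V, \<psi>) x * deriv (\<psi> \<circ> inv_into U \<phi>) (\<phi> x))"
  unfolding form_domain_def by (rule someI_ex[OF form[unfolded holomorphic_form_on_def]])

lemma form_domain_openin: "openin X form_domain"
  and M_subset_form_domain: "M \<subseteq> form_domain"
  by (rule form_domain[THEN conjunct1], rule form_domain[THEN conjunct2, THEN conjunct1])

lemma form_holomorphic:
  assumes "(U, \<phi>) \<in> \<A>"
  shows "(\<theta> (U, \<phi>) \<circ> inv_into U \<phi>) holomorphic_on \<phi> ` (U \<inter> form_domain)"
proof -
  have "\<forall>(U, \<phi>)\<in>\<A>. (\<theta> (U, \<phi>) \<circ> inv_into U \<phi>) holomorphic_on \<phi> ` (U \<inter> form_domain)"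
    using form_domain by (elim conjE)
  from bspec[OF this assms] show ?thesis by simp
qed

lemma form_transition:
  assumes "(U, \<phi>) \<in> \<A>" "(V, \<psi>) \<in> \<A>" "x \<in> U" "x \<in> V" "x \<in> form_domain"
  shows "\<theta> (U, \<phi>) x = \<theta> (V, \<psi>) x * deriv (\<psi> \<circ> inv_into U \<phi>) (\<phi> x)"
proof -
  have "\<forall>(U, \<phi>)\<in>\<A>. \<forall>(V, \<psi>)\<in>\<A>. \<forall>x\<in>U \<inter> V \<inter> form_domain.
            \<theta> (U, \<phi>) x = \<theta> (V, \<psi>) x * deriv (\<psi> \<circ> inv_into U \<phi>) (\<phi> x)"
    using form_domain by (elim conjE)
  from bspec[OF this assms(1)] show ?thesis using assms(2-) by auto
qed

lemma form_nonzero: "(U, \<phi>) \<in> \<A> \<Longrightarrow> x \<in> U \<Longrightarrow> x \<in> M \<Longrightarrow> \<theta> (U, \<phi>) x \<noteq> 0"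
  using nonvanishing unfolding nowhere_vanishing_form_on_def by auto

text \<open>The functions \<open>e k\<close> are the iterates of the derivation \<open>h \<mapsto> dh / \<theta>\<close> in the coordinate of a chart,
  continued to the boundary points in the chart.\<close>

definition local_jet :: "nat \<Rightarrow> ('a \<Rightarrow> complex) \<Rightarrow> 'a chart \<Rightarrow> (nat \<Rightarrow> complex \<Rightarrow> complex) \<Rightarrow> bool" where
  "local_jet r h = (\<lambda>(U, \<phi>) e.
     (\<forall>x\<in>U \<inter> M. e 0 (\<phi> x) = h x) \<and> (\<forall>k\<le>r. continuous_on (\<phi> ` (U \<inter> M)) (e k)) \<and>
     (\<forall>k<r. \<forall>x\<in>U \<inter> int_M. (e k has_field_derivative \<theta> (U, \<phi>) x * e (Suc k) (\<phi> x)) (at (\<phi> x))))"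

lemma local_jetD:
  assumes "local_jet r h (U, \<phi>) e"
  shows "x \<in> U \<Longrightarrow> x \<in> M \<Longrightarrow> e 0 (\<phi> x) = h x"
    and "k \<le> r \<Longrightarrow> continuous_on (\<phi> ` (U \<inter> M)) (e k)"
    and "k < r \<Longrightarrow> x \<in> U \<inter> int_M \<Longrightarrow>
      (e k has_field_derivative \<theta> (U, \<phi>) x * e (Suc k) (\<phi> x)) (at (\<phi> x))"
  using assms unfolding local_jet_def by auto

lemma local_jetI:
  assumes "\<And>x. x \<in> U \<Longrightarrow> x \<in> M \<Longrightarrow> e 0 (\<phi> x) = h x"
    and "\<And>k. k \<le> r \<Longrightarrow> continuous_on (\<phi> ` (U \<inter> M)) (e k)"
    and "\<And>k x. k < r \<Longrightarrow> x \<in> U \<inter> int_M \<Longrightarrow>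
      (e k has_field_derivative \<theta> (U, \<phi>) x * e (Suc k) (\<phi> x)) (at (\<phi> x))"
  shows "local_jet r h (U, \<phi>) e"
  using assms unfolding local_jet_def by auto

text \<open>In the interior, the factor \<open>deriv (\<psi> \<circ> inv_into U \<phi>)\<close> from the chain rule cancels against the one
  in the transformation rule of the form; boundary points follow by density. Applied to one and the same
  chart, the lemma says that local jets are unique.\<close>

lemma local_jet_compatible:
  assumes c: "(U, \<phi>) \<in> \<A>" "(V, \<psi>) \<in> \<A>"
    and e: "local_jet r h (U, \<phi>) e" and e': "local_jet r h (V, \<psi>) e'"
    and k: "k \<le> r" and x: "x \<in> U" "x \<in> V" "x \<in> M"
  shows "e k (\<phi> x) = e' k (\<psi> x)"
proof -
  let ?\<tau> = "\<psi> \<circ> inv_into U \<phi>"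
  have UV: "openin X (U \<inter> V)" using c chart_openin by blast
  have int: "e k (\<phi> x) = e' k (\<psi> x)" if "x \<in> U \<inter> V \<inter> int_M" for x
    using that k
  proof (induction k arbitrary: x)
    case 0
    then show ?case using e e' int_M_subset unfolding local_jet_def by fastforce
  next
    case (Suc k)
    then have x: "x \<in> U" "x \<in> V" "x \<in> int_M" "x \<in> M" "k < r" using int_M_subset by auto
    have "(e' k has_field_derivative \<theta> (V, \<psi>) x * e' (Suc k) (\<psi> x)) (at (?\<tau> (\<phi> x)))"
      using e' x c unfolding local_jet_def by auto
    then have "((e' k \<circ> ?\<tau>) has_field_derivative
        \<theta> (V, \<psi>) x * e' (Suc k) (\<psi> x) * deriv ?\<tau> (\<phi> x)) (at (\<phi> x))"
      by (rule DERIV_chain) (rule transition_has_field_derivative[OF c x(1,2)])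
    moreover have "\<theta> (V, \<psi>) x * e' (Suc k) (\<psi> x) * deriv ?\<tau> (\<phi> x) = \<theta> (U, \<phi>) x * e' (Suc k) (\<psi> x)"
      using form_transition[OF c] x M_subset_form_domain by (simp add: subset_iff)
    ultimately have "((e' k \<circ> ?\<tau>) has_field_derivative \<theta> (U, \<phi>) x * e' (Suc k) (\<psi> x)) (at (\<phi> x))"
      by simp
    then have "(e k has_field_derivative \<theta> (U, \<phi>) x * e' (Suc k) (\<psi> x)) (at (\<phi> x))"
    proof (rule has_field_derivative_transform_within_open)
      show "open (\<phi> ` (U \<inter> V \<inter> int_M))"
        using UV by (intro chart_open_image[OF c(1)]) auto
      show "\<phi> x \<in> \<phi> ` (U \<inter> V \<inter> int_M)" using x by blast
      show "(e' k \<circ> ?\<tau>) z = e k z" if "z \<in> \<phi> ` (U \<inter> V \<inter> int_M)" for z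
        using that Suc.IH Suc.prems c by auto
    qed
    moreover have "(e k has_field_derivative \<theta> (U, \<phi>) x * e (Suc k) (\<phi> x)) (at (\<phi> x))"
      using e x unfolding local_jet_def by auto
    ultimately have "\<theta> (U, \<phi>) x * e (Suc k) (\<phi> x) = \<theta> (U, \<phi>) x * e' (Suc k) (\<psi> x)"
      by (rule DERIV_unique[rotated])
    then show ?case using form_nonzero c x by auto
  qed
  have "norm (e k (\<phi> x) - e' k (?\<tau> (\<phi> x))) \<le> 0"
  proof (rule norm_le_on_dense[where F = "\<lambda>z. e k z - e' k (?\<tau> z)"])
    have 1: "continuous_on (\<phi> ` (U \<inter> V \<inter> M)) (e k)"
      using e k unfolding local_jet_def by (auto elim!: continuous_on_subset)
    have 2: "continuous_on (\<phi> ` (U \<inter> V \<inter> M)) ?\<tau>"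
      using holomorphic_on_imp_continuous_on[OF transition_holomorphic[OF c]]
      by (rule continuous_on_subset) blast
    have 3: "continuous_on (\<psi> ` (V \<inter> M)) (e' k)" using e' k unfolding local_jet_def by auto
    have "continuous_on (\<phi> ` (U \<inter> V \<inter> M)) (\<lambda>z. e' k (?\<tau> z))"
      by (rule continuous_on_compose2[OF 3 2]) (use c in auto)
    with 1 show "continuous_on (\<phi> ` (U \<inter> V \<inter> M)) (\<lambda>z. e k z - e' k (?\<tau> z))"
      by (rule continuous_on_diff)
    show "\<phi> ` (U \<inter> V \<inter> int_M) \<subseteq> \<phi> ` (U \<inter> V \<inter> M)" using int_M_subset by blast
    show "\<phi> ` (U \<inter> V \<inter> M) \<subseteq> closure (\<phi> ` (U \<inter> V \<inter> int_M))"
      using UV by (intro chart_dense[OF c(1)]) auto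
    show "norm (e k z - e' k (?\<tau> z)) \<le> 0" if "z \<in> \<phi> ` (U \<inter> V \<inter> int_M)" for z
      using that int c by auto
    show "\<phi> x \<in> \<phi> ` (U \<inter> V \<inter> M)" using x by blast
  qed
  then show ?thesis using c x by simp
qed

text \<open>The iterates of the derivation as functions on the surface. They vanish outside \<open>M\<close>, as the
  functions in \<open>Cr_space\<close> do, which makes them unique.\<close>

definition theta_jet :: "nat \<Rightarrow> ('a \<Rightarrow> complex) \<Rightarrow> (nat \<Rightarrow> 'a \<Rightarrow> complex) \<Rightarrow> bool" where
  "theta_jet r h g \<longleftrightarrow> g 0 = h \<and> (\<forall>k\<le>r. \<forall>x. x \<notin> M \<longrightarrow> g k x = 0) \<and>
     (\<forall>(U, \<phi>)\<in>\<A>. local_jet r h (U, \<phi>) (\<lambda>k. g k \<circ> inv_into U \<phi>))"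

lemma theta_jet_local: "theta_jet r h g \<Longrightarrow> (U, \<phi>) \<in> \<A> \<Longrightarrow> local_jet r h (U, \<phi>) (\<lambda>k. g k \<circ> inv_into U \<phi>)"
  unfolding theta_jet_def by fast

lemma theta_jet_unique:
  assumes g: "theta_jet r h g" and g': "theta_jet r h g'" and "k \<le> r"
  shows "g k = g' k"
proof
  fix x
  show "g k x = g' k x"
  proof (cases "x \<in> M")
    case True
    then obtain U \<phi> where c: "(U, \<phi>) \<in> \<A>" "x \<in> U" using chart_covers M_subset by blast
    then show ?thesis
      using local_jet_compatible[OF c(1) c(1) theta_jet_local[OF g c(1)] theta_jet_local[OF g' c(1)] assms(3) c(2) c(2) True]
      by simp
  next
    case False
    then show ?thesis using assms unfolding theta_jet_def by simp
  qed
qed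

lemma theta_jet_lincomb:
  assumes "theta_jet r h g" "theta_jet r h' g'"
  shows "theta_jet r (\<lambda>x. a * h x + b * h' x) (\<lambda>k x. a * g k x + b * g' k x)"
proof -
  have "local_jet r (\<lambda>x. a * h x + b * h' x) (U, \<phi>) (\<lambda>k. (\<lambda>x. a * g k x + b * g' k x) \<circ> inv_into U \<phi>)"
    if c: "(U, \<phi>) \<in> \<A>" for U \<phi>
  proof -
    note L = local_jetD[OF theta_jet_local[OF assms(1) c]] local_jetD[OF theta_jet_local[OF assms(2) c]]
    have eq: "(\<lambda>x. a * g k x + b * g' k x) \<circ> inv_into U \<phi> =
        (\<lambda>z. a * (g k \<circ> inv_into U \<phi>) z + b * (g' k \<circ> inv_into U \<phi>) z)" for k
      by (simp add: o_def)
    show ?thesis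
      unfolding eq
    proof (rule local_jetI)
      fix x assume "x \<in> U" "x \<in> M"
      then show "a * (g 0 \<circ> inv_into U \<phi>) (\<phi> x) + b * (g' 0 \<circ> inv_into U \<phi>) (\<phi> x) = a * h x + b * h' x"
        by (simp only: L(1,4))
    next
      fix k assume "k \<le> r"
      then show "continuous_on (\<phi> ` (U \<inter> M)) (\<lambda>z. a * (g k \<circ> inv_into U \<phi>) z + b * (g' k \<circ> inv_into U \<phi>) z)"
        by (intro continuous_on_add continuous_on_mult continuous_on_const L(2,5))
    next
      fix k x assume k: "k < r" "x \<in> U \<inter> int_M"
      have "((\<lambda>z. a * (g k \<circ> inv_into U \<phi>) z + b * (g' k \<circ> inv_into U \<phi>) z) has_field_derivative
         a * (\<theta> (U, \<phi>) x * (g (Suc k) \<circ> inv_into U \<phi>) (\<phi> x)) + b * (\<theta> (U, \<phi>) x * (g' (Suc k) \<circ> inv_into U \<phi>) (\<phi> x))) (at (\<phi> x))"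
        by (intro DERIV_add DERIV_cmult L(3,6) k)
      then show "((\<lambda>z. a * (g k \<circ> inv_into U \<phi>) z + b * (g' k \<circ> inv_into U \<phi>) z) has_field_derivative
         \<theta> (U, \<phi>) x * (a * (g (Suc k) \<circ> inv_into U \<phi>) (\<phi> x) + b * (g' (Suc k) \<circ> inv_into U \<phi>) (\<phi> x))) (at (\<phi> x))"
        by (simp add: algebra_simps)
    qed
  qed
  then show ?thesis using assms unfolding theta_jet_def by auto
qed

text \<open>An open set on which both the coefficient of the form and its reciprocal are holomorphic. It contains
  the chart image of \<open>M\<close>, so the functions \<open>jet_coeff\<close> are continuous up to the boundary of \<open>M\<close>.\<close>

definition coeff_domain :: "'a chart \<Rightarrow> complex set" where
  "coeff_domain = (\<lambda>(U, \<phi>). {z \<in> \<phi> ` (U \<inter> form_domain). (\<theta> (U, \<phi>) \<circ> inv_into U \<phi>) z \<noteq> 0})"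

lemma coeff_domain:
  assumes c: "(U, \<phi>) \<in> \<A>"
  shows "open (coeff_domain (U, \<phi>))" "\<phi> ` (U \<inter> M) \<subseteq> coeff_domain (U, \<phi>)"
    "(\<theta> (U, \<phi>) \<circ> inv_into U \<phi>) holomorphic_on coeff_domain (U, \<phi>)"
    "\<forall>z\<in>coeff_domain (U, \<phi>). (\<theta> (U, \<phi>) \<circ> inv_into U \<phi>) z \<noteq> 0"
proof -
  have "open (\<phi> ` (U \<inter> form_domain))"
    using chart_openin[OF c] form_domain_openin by (intro chart_open_image[OF c]) auto
  then have "open (\<phi> ` (U \<inter> form_domain) \<inter> (\<theta> (U, \<phi>) \<circ> inv_into U \<phi>) -` (- {0}))"
    by (rule continuous_open_preimage[OF holomorphic_on_imp_continuous_on[OF form_holomorphic[OF c]]]) auto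
  moreover have "coeff_domain (U, \<phi>) = \<phi> ` (U \<inter> form_domain) \<inter> (\<theta> (U, \<phi>) \<circ> inv_into U \<phi>) -` (- {0})"
    unfolding coeff_domain_def by auto
  ultimately show "open (coeff_domain (U, \<phi>))" by simp
  show "(\<theta> (U, \<phi>) \<circ> inv_into U \<phi>) holomorphic_on coeff_domain (U, \<phi>)"
    using form_holomorphic[OF c] by (rule holomorphic_on_subset) (auto simp: coeff_domain_def)
qed (use c M_subset_form_domain form_nonzero in \<open>auto simp: coeff_domain_def\<close>)

lemma Cr_jet_imp_local_jet:
  assumes c: "(U, \<phi>) \<in> \<A>" and h: "holomorphic_interior X \<A> M h"
    and D: "Cr_jet r (\<phi> ` (U \<inter> M)) (h \<circ> inv_into U \<phi>) D"
  shows "local_jet r h (U, \<phi>)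
    (\<lambda>k z. \<Sum>j\<le>k. jet_coeff (\<lambda>_. 1) (\<theta> (U, \<phi>) \<circ> inv_into U \<phi>) k j z * D j 0 z)"
proof -
  let ?t = "\<theta> (U, \<phi>) \<circ> inv_into U \<phi>"
  have "(h \<circ> inv_into U \<phi>) holomorphic_on \<phi> ` (U \<inter> int_M)"
    using h c unfolding holomorphic_interior_def by fast
  then have hol: "(h \<circ> inv_into U \<phi>) holomorphic_on interior (\<phi> ` (U \<inter> M))"
    using chart_interior[OF c] by simp
  note d = Cr_jet_derivatives[OF D hol]
  have "((\<lambda>z. \<Sum>j\<le>k. jet_coeff (\<lambda>_. 1) ?t k j z * D j 0 z) has_field_derivative
          ?t (\<phi> x) * (\<Sum>j\<le>Suc k. jet_coeff (\<lambda>_. 1) ?t (Suc k) j (\<phi> x) * D j 0 (\<phi> x))) (at (\<phi> x))"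
    if "k < r" and x: "x \<in> U \<inter> int_M" for k x
  proof (rule jet_coeff_has_field_derivative[OF coeff_domain(1)[OF c] _ coeff_domain(3,4)[OF c]])
    show "\<phi> x \<in> coeff_domain (U, \<phi>)" using coeff_domain(2)[OF c] x int_M_subset by blast
    show "\<forall>j\<le>k. (D j 0 has_field_derivative 1 * D (Suc j) 0 (\<phi> x)) (at (\<phi> x))"
      using d that chart_interior[OF c] by simp
  qed simp
  moreover have "continuous_on (\<phi> ` (U \<inter> M)) (\<lambda>z. \<Sum>j\<le>k. jet_coeff (\<lambda>_. 1) ?t k j z * D j 0 z)" if "k \<le> r" for k
  proof (intro continuous_on_sum continuous_on_mult)
    fix j assume "j \<in> {..k}"
    then show "continuous_on (\<phi> ` (U \<inter> M)) (D j 0)" using D that unfolding Cr_jet_def by simp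
    show "continuous_on (\<phi> ` (U \<inter> M)) (jet_coeff (\<lambda>_. 1) ?t k j)"
      using holomorphic_on_imp_continuous_on[OF jet_coeff_holomorphic[OF coeff_domain(1)[OF c] _ coeff_domain(3,4)[OF c]]]
        coeff_domain(2)[OF c] continuous_on_subset by (metis holomorphic_on_const)
  qed
  ultimately show ?thesis
    using D c unfolding local_jet_def Cr_jet_def by simp
qed

lemma local_jet_imp_Cr_jet:
  assumes c: "(U, \<phi>) \<in> \<A>" and e: "local_jet r h (U, \<phi>) e"
  shows "Cr_jet r (\<phi> ` (U \<inter> M)) (h \<circ> inv_into U \<phi>)
    (\<lambda>i j z. \<i> ^ j * (\<Sum>l\<le>i + j. jet_coeff (\<theta> (U, \<phi>) \<circ> inv_into U \<phi>) (\<lambda>_. 1) (i + j) l z * e l z))"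
proof (rule Cr_jet_of_derivatives)
  let ?t = "\<theta> (U, \<phi>) \<circ> inv_into U \<phi>"
  show "\<forall>k\<le>r. continuous_on (\<phi> ` (U \<inter> M)) (\<lambda>z. \<Sum>l\<le>k. jet_coeff ?t (\<lambda>_. 1) k l z * e l z)"
  proof (intro allI impI continuous_on_sum continuous_on_mult)
    fix k j assume "k \<le> r" "j \<in> {..k}"
    then show "continuous_on (\<phi> ` (U \<inter> M)) (e j)" using e unfolding local_jet_def by simp
    show "continuous_on (\<phi> ` (U \<inter> M)) (jet_coeff ?t (\<lambda>_. 1) k j)"
      using holomorphic_on_imp_continuous_on[OF jet_coeff_holomorphic[OF coeff_domain(1)[OF c] coeff_domain(3)[OF c]]]
        coeff_domain(2)[OF c] continuous_on_subset by (metis holomorphic_on_const zero_neq_one)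
  qed
  show "\<forall>k<r. \<forall>z\<in>interior (\<phi> ` (U \<inter> M)). ((\<lambda>z. \<Sum>l\<le>k. jet_coeff ?t (\<lambda>_. 1) k l z * e l z)
      has_field_derivative (\<Sum>l\<le>Suc k. jet_coeff ?t (\<lambda>_. 1) (Suc k) l z * e l z)) (at z)"
  proof (intro allI impI ballI)
    fix k z assume k: "k < r" and "z \<in> interior (\<phi> ` (U \<inter> M))"
    then obtain x where x: "z = \<phi> x" "x \<in> U \<inter> int_M" using chart_interior[OF c] by auto
    have "((\<lambda>z. \<Sum>l\<le>k. jet_coeff ?t (\<lambda>_. 1) k l z * e l z)
      has_field_derivative 1 * (\<Sum>l\<le>Suc k. jet_coeff ?t (\<lambda>_. 1) (Suc k) l z * e l z)) (at z)"
    proof (rule jet_coeff_has_field_derivative[OF coeff_domain(1)[OF c] coeff_domain(3)[OF c]])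
      show "z \<in> coeff_domain (U, \<phi>)" using coeff_domain(2)[OF c] x int_M_subset by blast
      show "\<forall>j\<le>k. (e j has_field_derivative ?t z * e (Suc j) z) (at z)"
        using e k x c unfolding local_jet_def by simp
    qed auto
    then show "((\<lambda>z. \<Sum>l\<le>k. jet_coeff ?t (\<lambda>_. 1) k l z * e l z)
      has_field_derivative (\<Sum>l\<le>Suc k. jet_coeff ?t (\<lambda>_. 1) (Suc k) l z * e l z)) (at z)" by simp
  qed
qed (use e c in \<open>auto simp: local_jet_def\<close>)

text \<open>Every chart provides a local jet; by compatibility they fit together, and the value at a point may be
  computed in any chart around it.\<close>

lemma Ar_imp_theta_jet:
  assumes h: "h \<in> Ar r"
  shows "\<exists>g. theta_jet r h g"
proof -
  have hol: "holomorphic_interior X \<A> M h" and zero: "\<And>x. x \<notin> M \<Longrightarrow> h x = 0"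
    and D: "\<forall>(U, \<phi>)\<in>\<A>. \<exists>D. Cr_jet r (\<phi> ` (U \<inter> M)) (h \<circ> inv_into U \<phi>) D"
    using h unfolding Ar_space_def Cr_space_def by blast+
  have "\<forall>c\<in>\<A>. \<exists>e. local_jet r h c e"
    using D Cr_jet_imp_local_jet[OF _ hol] by fast
  then obtain e where e: "\<And>c. c \<in> \<A> \<Longrightarrow> local_jet r h c (e c)" by metis
  define c where "c x = (SOME c. c \<in> \<A> \<and> x \<in> fst c)" for x
  define g where "g k x = (if x \<in> M then if k = 0 then h x else e (c x) k (snd (c x) x) else 0)" for k x
  have g: "g k x = e (U, \<phi>) k (\<phi> x)" if "(U, \<phi>) \<in> \<A>" "x \<in> U" "x \<in> M" "k \<le> r" for k x U \<phi>
  proof (cases "k = 0")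
    case True
    then show ?thesis using e[OF that(1)] that unfolding g_def local_jet_def by auto
  next
    case False
    have "\<exists>c. c \<in> \<A> \<and> x \<in> fst c" using that by force
    then have "c x \<in> \<A> \<and> x \<in> fst (c x)" unfolding c_def by (rule someI_ex)
    then obtain V \<psi> where V: "c x = (V, \<psi>)" "(V, \<psi>) \<in> \<A>" "x \<in> V" by (metis prod.collapse)
    show ?thesis
      using local_jet_compatible[OF that(1) V(2) e[OF that(1)] e[OF V(2)] that(4) that(2) V(3) that(3)]
        V False that unfolding g_def by simp
  qed
  have "local_jet r h (U, \<phi>) (\<lambda>k. g k \<circ> inv_into U \<phi>)" if U: "(U, \<phi>) \<in> \<A>" for U \<phi>
  proof -
    have eq: "(g k \<circ> inv_into U \<phi>) z = e (U, \<phi>) k z" if "k \<le> r" "z \<in> \<phi> ` (U \<inter> M)" for k z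
      using that g[OF U] U by auto
    have cont: "continuous_on (\<phi> ` (U \<inter> M)) (g k \<circ> inv_into U \<phi>)" if "k \<le> r" for k
    proof -
      have "continuous_on (\<phi> ` (U \<inter> M)) (e (U, \<phi>) k)" using e[OF U] that unfolding local_jet_def by simp
      then show ?thesis by (rule continuous_on_eq) (rule eq[OF that, symmetric])
    qed
    have deriv: "((g k \<circ> inv_into U \<phi>) has_field_derivative \<theta> (U, \<phi>) x * (g (Suc k) \<circ> inv_into U \<phi>) (\<phi> x)) (at (\<phi> x))"
      if k: "k < r" and x: "x \<in> U \<inter> int_M" for k x
    proof (rule has_field_derivative_transform_within_open)
      have xM: "\<phi> x \<in> \<phi> ` (U \<inter> M)" using x int_M_subset by blast
      show "(e (U, \<phi>) k has_field_derivative \<theta> (U, \<phi>) x * (g (Suc k) \<circ> inv_into U \<phi>) (\<phi> x)) (at (\<phi> x))"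
        using e[OF U] k x eq[OF _ xM, of "Suc k"] unfolding local_jet_def by simp
      show "open (\<phi> ` (U \<inter> int_M))" using chart_interior[OF U] open_interior by metis
      show "\<phi> x \<in> \<phi> ` (U \<inter> int_M)" using x by blast
      show "e (U, \<phi>) k z = (g k \<circ> inv_into U \<phi>) z" if "z \<in> \<phi> ` (U \<inter> int_M)" for z
        using eq[of k z] that k int_M_subset by auto
    qed
    have zero: "(g 0 \<circ> inv_into U \<phi>) (\<phi> x) = h x" if "x \<in> U" "x \<in> M" for x
      using that U by (simp add: g_def)
    show ?thesis by (rule local_jetI; (rule zero cont deriv; assumption))
  qed
  moreover have "g 0 = h" using zero by (auto simp: g_def)
  ultimately show ?thesis unfolding theta_jet_def by (intro exI[of _ g]) (auto simp: g_def)
qed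

lemma theta_jet_imp_Ar:
  assumes "theta_jet r h g" "holomorphic_interior X \<A> M h"
  shows "h \<in> Ar r"
proof -
  have "\<forall>(U, \<phi>)\<in>\<A>. \<exists>D. Cr_jet r (\<phi> ` (U \<inter> M)) (h \<circ> inv_into U \<phi>) D"
    using local_jet_imp_Cr_jet theta_jet_local[OF assms(1)] by fast
  then show ?thesis
    using assms unfolding Ar_space_def Cr_space_def theta_jet_def by fastforce
qed

end

section \<open>The Banach space of functions of class A and its topology\<close>

text \<open>Finitely many uniform strict inequalities leave common room.\<close>

lemma finite_uniform_gap:
  fixes F :: "'i \<Rightarrow> 'x \<Rightarrow> real"
  assumes "finite I" "\<And>i. i \<in> I \<Longrightarrow> \<exists>\<eta>>0. \<forall>x\<in>K. F i x + \<eta> \<le> \<epsilon>"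
  shows "\<exists>\<eta>>0. \<forall>i\<in>I. \<forall>x\<in>K. F i x + \<eta> \<le> \<epsilon>"
  using assms
proof (induction I rule: finite_induct)
  case empty
  then show ?case by (intro exI[of _ 1]) auto
next
  case (insert i I)
  obtain \<eta>1 where 1: "\<eta>1 > 0" "\<forall>i\<in>I. \<forall>x\<in>K. F i x + \<eta>1 \<le> \<epsilon>" using insert by auto
  obtain \<eta>2 where 2: "\<eta>2 > 0" "\<forall>x\<in>K. F i x + \<eta>2 \<le> \<epsilon>" using insert.prems[of i] by auto
  have "\<forall>j\<in>insert i I. \<forall>x\<in>K. F j x + min \<eta>1 \<eta>2 \<le> \<epsilon>"
    using 1(2) 2(2) by (auto simp: min_def) (smt (verit))+
  then show ?case using 1(1) 2(1) by (intro exI[of _ "min \<eta>1 \<eta>2"]) auto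
qed

context bordered_surface
begin

lemma continuous_map_if_chartwise:
  fixes u :: "'a \<Rightarrow> complex"
  assumes "\<And>U \<phi>. (U, \<phi>) \<in> \<A> \<Longrightarrow> continuous_on (\<phi> ` (U \<inter> M)) (u \<circ> inv_into U \<phi>)"
  shows "continuous_map (subtopology X M) euclidean u"
  unfolding continuous_map_def
proof (intro conjI allI impI)
  fix T :: "complex set" assume "openin euclidean T"
  then have T: "open T" by simp
  show "openin (subtopology X M) {x \<in> topspace (subtopology X M). u x \<in> T}"
  proof (subst openin_subopen, intro ballI)
    fix x assume "x \<in> {x \<in> topspace (subtopology X M). u x \<in> T}"
    then have x: "x \<in> M" "x \<in> topspace X" "u x \<in> T" by auto
    obtain U \<phi> where c: "(U, \<phi>) \<in> \<A>" "x \<in> U" using chart_covers[OF x(2)] by auto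
    have "\<exists>Q. open Q \<and> Q \<inter> \<phi> ` (U \<inter> M) = (u \<circ> inv_into U \<phi>) -` T \<inter> \<phi> ` (U \<inter> M)"
      using assms[OF c(1), unfolded continuous_on_open_invariant] T by simp
    then obtain Q where Q: "open Q" "Q \<inter> \<phi> ` (U \<inter> M) = (u \<circ> inv_into U \<phi>) -` T \<inter> \<phi> ` (U \<inter> M)"
      by (elim exE conjE)
    have Qiff: "\<phi> y \<in> Q \<longleftrightarrow> u y \<in> T" if "y \<in> U" "y \<in> M" for y
    proof -
      have "\<phi> y \<in> Q \<longleftrightarrow> \<phi> y \<in> Q \<inter> \<phi> ` (U \<inter> M)" using that by simp
      also have "\<dots> \<longleftrightarrow> u y \<in> T" unfolding Q(2) using that c(1) by simp
      finally show ?thesis .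
    qed
    show "\<exists>P. openin (subtopology X M) P \<and> x \<in> P \<and> P \<subseteq> {x \<in> topspace (subtopology X M). u x \<in> T}"
    proof (intro exI[of _ "{y\<in>U. \<phi> y \<in> Q} \<inter> M"] conjI)
      show "openin (subtopology X M) ({y\<in>U. \<phi> y \<in> Q} \<inter> M)"
        using chart_open_preimage[OF c(1) Q(1)] by (rule openin_subtopology_Int)
      show "x \<in> {y\<in>U. \<phi> y \<in> Q} \<inter> M" using x c Qiff by simp
      show "{y\<in>U. \<phi> y \<in> Q} \<inter> M \<subseteq> {x \<in> topspace (subtopology X M). u x \<in> T}"
        using Qiff M_subset by auto
    qed
  qed
qed auto

lemma theta_jet_continuous:
  "theta_jet r h g \<Longrightarrow> k \<le> r \<Longrightarrow> continuous_map (subtopology X M) euclidean (g k)"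
  by (rule continuous_map_if_chartwise) (rule local_jetD(2)[OF theta_jet_local])

lemma theta_jet_bounded:
  assumes "theta_jet r h g" "k \<le> r"
  shows "\<exists>B. \<forall>x\<in>M. norm (g k x) \<le> B"
proof -
  have "compactin (subtopology X M) M" using compact_M by (simp add: compactin_subtopology)
  then have "compactin euclidean (g k ` M)"
    using theta_jet_continuous[OF assms] by (rule image_compactin)
  then have "bounded (g k ` M)" by (simp add: compact_imp_bounded)
  then show ?thesis by (simp add: bounded_iff)
qed

definition jet :: "nat \<Rightarrow> ('a \<Rightarrow> complex) \<Rightarrow> nat \<Rightarrow> 'a \<Rightarrow> complex" where
  "jet r h = (SOME g. theta_jet r h g)"

lemma theta_jet_jet: "h \<in> Ar r \<Longrightarrow> theta_jet r h (jet r h)"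
  unfolding jet_def using Ar_imp_theta_jet by (rule someI_ex)

lemma jet_eqI: "theta_jet r h g \<Longrightarrow> k \<le> r \<Longrightarrow> jet r h k = g k"
proof -
  assume g: "theta_jet r h g" and k: "k \<le> r"
  have "theta_jet r h (jet r h)" unfolding jet_def by (rule someI[of "theta_jet r h", OF g])
  from theta_jet_unique[OF this g k] show ?thesis .
qed

lemma jet_0: "h \<in> Ar r \<Longrightarrow> jet r h 0 = h"
  using theta_jet_jet unfolding theta_jet_def by blast

text \<open>A norm for the \<open>C\<^sup>r\<close>-topology that does not involve charts.\<close>

definition jet_norm :: "nat \<Rightarrow> ('a \<Rightarrow> complex) \<Rightarrow> real" where
  "jet_norm r h = (SUP (k, x) \<in> {..r} \<times> M. norm (jet r h k x))"

lemma norm_jet_le: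
  assumes "h \<in> Ar r" "k \<le> r" "x \<in> M"
  shows "norm (jet r h k x) \<le> jet_norm r h"
proof -
  have "\<forall>k\<in>{..r}. \<exists>B. \<forall>x\<in>M. norm (jet r h k x) \<le> B"
    using theta_jet_bounded[OF theta_jet_jet[OF assms(1)]] by simp
  then obtain B where B: "\<forall>k\<in>{..r}. \<forall>x\<in>M. norm (jet r h k x) \<le> B k" by (rule bchoice[elim_format]) auto
  have "norm (jet r h k x) \<le> (\<Sum>k\<le>r. \<bar>B k\<bar>)" if "k \<le> r" "x \<in> M" for k x
  proof -
    have "norm (jet r h k x) \<le> \<bar>B k\<bar>" using B that by (meson abs_ge_self atMost_iff order_trans)
    also have "\<dots> \<le> (\<Sum>k\<le>r. \<bar>B k\<bar>)" using that by (intro member_le_sum) auto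
    finally show ?thesis .
  qed
  then have "bdd_above ((\<lambda>(k, x). norm (jet r h k x)) ` ({..r} \<times> M))"
    by (intro bdd_aboveI2[of _ _ "\<Sum>k\<le>r. \<bar>B k\<bar>"]) auto
  from cSUP_upper[OF _ this, of "(k, x)"] show ?thesis
    unfolding jet_norm_def using assms by simp
qed

lemma jet_norm_leI:
  assumes "\<And>k x. k \<le> r \<Longrightarrow> x \<in> M \<Longrightarrow> norm (jet r h k x) \<le> B"
  shows "jet_norm r h \<le> B"
  unfolding jet_norm_def using assms M_nonempty by (intro cSUP_least) auto

lemma norm_le_jet_norm: "h \<in> Ar r \<Longrightarrow> x \<in> M \<Longrightarrow> norm (h x) \<le> jet_norm r h"
  using norm_jet_le[of h r 0 x] jet_0 by simp

lemma Ar_lincomb: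
  assumes "h \<in> Ar r" "h' \<in> Ar r"
  shows "(\<lambda>x. a * h x + b * h' x) \<in> Ar r"
    and "k \<le> r \<Longrightarrow> jet r (\<lambda>x. a * h x + b * h' x) k = (\<lambda>x. a * jet r h k x + b * jet r h' k x)"
proof -
  note J = theta_jet_lincomb[OF theta_jet_jet[OF assms(1)] theta_jet_jet[OF assms(2)], of a b]
  have "holomorphic_interior X \<A> M (\<lambda>x. a * h x + b * h' x)"
    unfolding holomorphic_interior_def
  proof (clarify)
    fix U \<phi> assume c: "(U, \<phi>) \<in> \<A>"
    have "(h \<circ> inv_into U \<phi>) holomorphic_on \<phi> ` (U \<inter> int_M)" "(h' \<circ> inv_into U \<phi>) holomorphic_on \<phi> ` (U \<inter> int_M)"
      using assms c unfolding Ar_space_def holomorphic_interior_def by auto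
    then have "(\<lambda>z. a * (h \<circ> inv_into U \<phi>) z + b * (h' \<circ> inv_into U \<phi>) z) holomorphic_on \<phi> ` (U \<inter> int_M)"
      by (intro holomorphic_intros)
    then show "((\<lambda>x. a * h x + b * h' x) \<circ> inv_into U \<phi>) holomorphic_on \<phi> ` (U \<inter> int_M)"
      by (simp add: o_def)
  qed
  with J show "(\<lambda>x. a * h x + b * h' x) \<in> Ar r" by (rule theta_jet_imp_Ar)
  show "k \<le> r \<Longrightarrow> jet r (\<lambda>x. a * h x + b * h' x) k = (\<lambda>x. a * jet r h k x + b * jet r h' k x)"
    using J by (rule jet_eqI)
qed

lemma Ar_diff:
  assumes "h \<in> Ar r" "h' \<in> Ar r"
  shows "h - h' \<in> Ar r"
    and "k \<le> r \<Longrightarrow> jet r (h - h') k x = jet r h k x - jet r h' k x"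
proof -
  have eq: "h - h' = (\<lambda>x. 1 * h x + (- 1) * h' x)" by (simp add: fun_eq_iff)
  show "h - h' \<in> Ar r"
    unfolding eq by (rule Ar_lincomb(1)[OF assms])
  show "k \<le> r \<Longrightarrow> jet r (h - h') k x = jet r h k x - jet r h' k x"
    unfolding eq using Ar_lincomb(2)[OF assms, of k 1 "- 1"] by simp
qed

lemma Ar_add:
  assumes "h \<in> Ar r" "h' \<in> Ar r"
  shows "h + h' \<in> Ar r"
    and "k \<le> r \<Longrightarrow> jet r (h + h') k x = jet r h k x + jet r h' k x"
proof -
  have eq: "h + h' = (\<lambda>x. 1 * h x + 1 * h' x)" by (simp add: fun_eq_iff)
  show "h + h' \<in> Ar r"
    unfolding eq by (rule Ar_lincomb(1)[OF assms])
  show "k \<le> r \<Longrightarrow> jet r (h + h') k x = jet r h k x + jet r h' k x"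
    unfolding eq using Ar_lincomb(2)[OF assms, of k 1 1] by simp
qed

lemma Ar_scale:
  assumes "h \<in> Ar r"
  shows "fun_scaleC a h \<in> Ar r"
    and "k \<le> r \<Longrightarrow> jet r (fun_scaleC a h) k x = a * jet r h k x"
proof -
  have eq: "fun_scaleC a h = (\<lambda>x. a * h x + 0 * h x)" by (simp add: fun_eq_iff fun_scaleC_def)
  show "fun_scaleC a h \<in> Ar r"
    unfolding eq by (rule Ar_lincomb(1)[OF assms assms])
  show "k \<le> r \<Longrightarrow> jet r (fun_scaleC a h) k x = a * jet r h k x"
    unfolding eq using Ar_lincomb(2)[OF assms assms, of k a 0] by simp
qed

lemma zero_in_Ar: "0 \<in> Ar r"
proof (rule theta_jet_imp_Ar)
  have "local_jet r 0 (U, \<phi>) (\<lambda>k. (\<lambda>_. 0) \<circ> inv_into U \<phi>)" if "(U, \<phi>) \<in> \<A>" for U \<phi>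
    by (rule local_jetI) (auto simp: o_def)
  then show "theta_jet r 0 (\<lambda>_ _. 0)"
    unfolding theta_jet_def by (auto simp: fun_eq_iff)
  show "holomorphic_interior X \<A> M 0"
    unfolding holomorphic_interior_def by (auto simp: o_def zero_fun_def)
qed

lemma jet_norm_nonneg: "h \<in> Ar r \<Longrightarrow> 0 \<le> jet_norm r h"
  using norm_le_jet_norm M_nonempty norm_ge_zero order_trans by (metis ex_in_conv)

lemma vector_space_fun_scaleC: "vector_space (fun_scaleC :: complex \<Rightarrow> ('a \<Rightarrow> complex) \<Rightarrow> _)"
  by unfold_locales (auto simp: fun_scaleC_def fun_eq_iff algebra_simps)

lemma vector_space_fun_scaleR: "vector_space (fun_scaleR :: real \<Rightarrow> ('a \<Rightarrow> complex) \<Rightarrow> _)"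
  by unfold_locales (auto simp: fun_scaleR_def fun_eq_iff algebra_simps)

lemma fun_scaleR_conv: "fun_scaleR a h = fun_scaleC (complex_of_real a) h"
  by (simp add: fun_scaleR_def fun_scaleC_def scaleR_conv_of_real)

lemma normed_Ar_C: "normed_on fun_scaleC (Ar r) (jet_norm r)"
proof -
  interpret vector_space "fun_scaleC :: complex \<Rightarrow> ('a \<Rightarrow> complex) \<Rightarrow> _" by (rule vector_space_fun_scaleC)
  show ?thesis
  proof
    show "subspace (Ar r)"
      unfolding subspace_def using zero_in_Ar Ar_add(1) Ar_scale(1) by blast
  next
    fix v :: "'a \<Rightarrow> complex" assume v: "v \<in> Ar r"
    then show "0 \<le> jet_norm r v" by (rule jet_norm_nonneg)
    have "v x = 0" if "jet_norm r v = 0" for x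
    proof (cases "x \<in> M")
      case True
      then show ?thesis using norm_le_jet_norm[OF v True] that by simp
    next
      case False
      then show ?thesis using v unfolding Ar_space_def Cr_space_def by simp
    qed
    moreover have "jet_norm r v = 0" if "v = 0"
    proof -
      have "jet r v k x = 0" if "k \<le> r" for k x
        using Ar_diff(2)[OF v v that, of x] \<open>v = 0\<close> by simp
      then have "jet_norm r v \<le> 0" by (intro jet_norm_leI) simp
      then show ?thesis using jet_norm_nonneg[OF v] by simp
    qed
    ultimately show "jet_norm r v = 0 \<longleftrightarrow> v = 0" by (auto simp: fun_eq_iff)
    fix w :: "'a \<Rightarrow> complex" assume w: "w \<in> Ar r"
    show "jet_norm r (v + w) \<le> jet_norm r v + jet_norm r w"
      by (rule jet_norm_leI) (auto simp: Ar_add(2)[OF v w] intro!: norm_triangle_mono norm_jet_le v w)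
  next
    fix v :: "'a \<Rightarrow> complex" and a assume v: "v \<in> Ar r"
    have le: "jet_norm r (fun_scaleC b u) \<le> norm b * jet_norm r u" if "u \<in> Ar r" for b u
      using norm_jet_le[OF that] by (intro jet_norm_leI) (auto simp: Ar_scale(2)[OF that] norm_mult intro!: mult_left_mono)
    show "jet_norm r (fun_scaleC a v) = norm a * jet_norm r v"
    proof (cases "a = 0")
      case True
      then show ?thesis using le[OF v, of 0] jet_norm_nonneg[OF Ar_scale(1)[OF v], of 0] by simp
    next
      case False
      have "v = fun_scaleC (inverse a) (fun_scaleC a v)"
        unfolding fun_scaleC_def by (rule ext) (use False in simp)
      then have "jet_norm r v \<le> norm (inverse a) * jet_norm r (fun_scaleC a v)"
        using le[OF Ar_scale(1)[OF v], of "inverse a" a] by simp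
      then have "norm a * jet_norm r v \<le> jet_norm r (fun_scaleC a v)"
        using False by (simp add: norm_divide field_simps)
      then show ?thesis using le[OF v, of a] by simp
    qed
  qed
qed

lemma normed_Ar_R: "normed_on fun_scaleR (Ar r) (jet_norm r)"
proof -
  interpret C: normed_on fun_scaleC "Ar r" "jet_norm r" by (rule normed_Ar_C)
  interpret vector_space "fun_scaleR :: real \<Rightarrow> ('a \<Rightarrow> complex) \<Rightarrow> _" by (rule vector_space_fun_scaleR)
  show ?thesis
  proof
    show "subspace (Ar r)"
      unfolding subspace_def fun_scaleR_conv using zero_in_Ar Ar_add(1) Ar_scale(1) by blast
  qed (use vector_space_fun_scaleR C.N_nonneg C.N_eq_0 C.N_triangle C.N_scale in \<open>simp_all add: fun_scaleR_conv\<close>)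
qed

text \<open>Weierstrass: a locally uniform limit of holomorphic functions is holomorphic, and the derivatives
  converge to the derivative of the limit. Continuity up to the boundary is continuity of a uniform limit.\<close>

lemma limit_in_Ar:
  fixes h :: "nat \<Rightarrow> 'a \<Rightarrow> complex"
  assumes h: "\<And>n. h n \<in> Ar r"
    and zero: "\<And>k x. x \<notin> M \<Longrightarrow> G k x = 0"
    and unif: "\<And>e. e > 0 \<Longrightarrow> \<exists>n0. \<forall>n\<ge>n0. \<forall>k\<le>r. \<forall>x\<in>M. norm (jet r (h n) k x - G k x) \<le> e"
  shows "G 0 \<in> Ar r" "theta_jet r (G 0) G"
proof -
  have UL: "uniform_limit (\<phi> ` (U \<inter> M)) (\<lambda>n. jet r (h n) k \<circ> inv_into U \<phi>) (G k \<circ> inv_into U \<phi>) sequentially"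
    if c: "(U, \<phi>) \<in> \<A>" and k: "k \<le> r" for U \<phi> k
    unfolding uniform_limit_iff
  proof (intro allI impI)
    fix e :: real assume e: "e > 0"
    then obtain n0 where n0: "\<forall>n\<ge>n0. \<forall>k\<le>r. \<forall>x\<in>M. norm (jet r (h n) k x - G k x) \<le> e / 2"
      using unif[of "e / 2"] by auto
    have "dist ((jet r (h n) k \<circ> inv_into U \<phi>) z) ((G k \<circ> inv_into U \<phi>) z) < e"
      if "n \<ge> n0" "z \<in> \<phi> ` (U \<inter> M)" for n z
    proof -
      from that obtain x where x: "z = \<phi> x" "x \<in> U" "x \<in> M" by auto
      have "norm (jet r (h n) k x - G k x) \<le> e / 2" using n0 k that(1) x by simp
      then show ?thesis using e x c by (simp add: dist_norm)
    qed
    then show "\<forall>\<^sub>F n in sequentially. \<forall>z\<in>\<phi> ` (U \<inter> M). dist ((jet r (h n) k \<circ> inv_into U \<phi>) z) ((G k \<circ> inv_into U \<phi>) z) < e"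
      unfolding eventually_sequentially by (intro exI[of _ n0]) simp
  qed
  have ball: "\<exists>d>0. cball z d \<subseteq> \<phi> ` (U \<inter> int_M) \<and>
      uniform_limit (cball z d) (\<lambda>n. jet r (h n) k \<circ> inv_into U \<phi>) (G k \<circ> inv_into U \<phi>) sequentially"
    if c: "(U, \<phi>) \<in> \<A>" and k: "k \<le> r" and z: "z \<in> \<phi> ` (U \<inter> int_M)" for U \<phi> k z
  proof -
    have "open (\<phi> ` (U \<inter> int_M))" using chart_interior[OF c] open_interior by metis
    then obtain d where d: "d > 0" "cball z d \<subseteq> \<phi> ` (U \<inter> int_M)"
      using z open_contains_cball by blast
    then have "cball z d \<subseteq> \<phi> ` (U \<inter> M)" using int_M_subset by blast
    with d show ?thesis using uniform_limit_on_subset[OF UL[OF c k]] by auto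
  qed
  have L: "local_jet r (h n) (U, \<phi>) (\<lambda>k. jet r (h n) k \<circ> inv_into U \<phi>)" if "(U, \<phi>) \<in> \<A>" for n U \<phi>
    using theta_jet_local[OF theta_jet_jet[OF h] that] .
  have "local_jet r (G 0) (U, \<phi>) (\<lambda>k. G k \<circ> inv_into U \<phi>)" if c: "(U, \<phi>) \<in> \<A>" for U \<phi>
  proof (rule local_jetI)
    fix k assume "k \<le> r"
    then show "continuous_on (\<phi> ` (U \<inter> M)) (G k \<circ> inv_into U \<phi>)"
      by (intro uniform_limit_theorem[OF _ UL[OF c]] always_eventually allI local_jetD(2)[OF L[OF c]]) auto
  next
    fix k x assume k: "k < r" and x: "x \<in> U \<inter> int_M"
    have o: "open (\<phi> ` (U \<inter> int_M))" using chart_interior[OF c] open_interior by metis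
    have "\<exists>g'. \<forall>z\<in>\<phi> ` (U \<inter> int_M). ((G k \<circ> inv_into U \<phi>) has_field_derivative g' z) (at z) \<and>
        ((\<lambda>n. \<theta> (U, \<phi>) (inv_into U \<phi> z) * jet r (h n) (Suc k) (inv_into U \<phi> z)) \<longlongrightarrow> g' z) sequentially"
    proof (rule has_complex_derivative_uniform_sequence[OF o])
      fix n z assume "z \<in> \<phi> ` (U \<inter> int_M)"
      then obtain y where y: "z = \<phi> y" "y \<in> U" "y \<in> int_M" by auto
      then show "((jet r (h n) k \<circ> inv_into U \<phi>) has_field_derivative \<theta> (U, \<phi>) (inv_into U \<phi> z) * jet r (h n) (Suc k) (inv_into U \<phi> z)) (at z)"
        using local_jetD(3)[OF L[OF c] k, of y n] c by simp
    next
      fix z assume "z \<in> \<phi> ` (U \<inter> int_M)"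
      then show "\<exists>d>0. cball z d \<subseteq> \<phi> ` (U \<inter> int_M) \<and>
        uniform_limit (cball z d) (\<lambda>n. jet r (h n) k \<circ> inv_into U \<phi>) (G k \<circ> inv_into U \<phi>) sequentially"
        using k by (intro ball[OF c]) auto
    qed
    then obtain g' where g': "\<forall>z\<in>\<phi> ` (U \<inter> int_M). ((G k \<circ> inv_into U \<phi>) has_field_derivative g' z) (at z) \<and>
        ((\<lambda>n. \<theta> (U, \<phi>) (inv_into U \<phi> z) * jet r (h n) (Suc k) (inv_into U \<phi> z)) \<longlongrightarrow> g' z) sequentially"
      by (elim exE)
    have "\<phi> x \<in> \<phi> ` (U \<inter> int_M)" using x by blast
    from bspec[OF g' this] have g'x: "((G k \<circ> inv_into U \<phi>) has_field_derivative g' (\<phi> x)) (at (\<phi> x))"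
      "(\<lambda>n. \<theta> (U, \<phi>) x * jet r (h n) (Suc k) x) \<longlonglongrightarrow> g' (\<phi> x)" using x c by auto
    have "\<phi> x \<in> \<phi> ` (U \<inter> M)" using x int_M_subset by blast
    then have "(\<lambda>n. (jet r (h n) (Suc k) \<circ> inv_into U \<phi>) (\<phi> x)) \<longlonglongrightarrow> (G (Suc k) \<circ> inv_into U \<phi>) (\<phi> x)"
      using k by (intro tendsto_uniform_limitI[OF UL[OF c]]) auto
    then have "(\<lambda>n. \<theta> (U, \<phi>) x * jet r (h n) (Suc k) x) \<longlonglongrightarrow> \<theta> (U, \<phi>) x * (G (Suc k) \<circ> inv_into U \<phi>) (\<phi> x)"
      using x c by (intro tendsto_mult_left) simp
    with g'x(2) have "g' (\<phi> x) = \<theta> (U, \<phi>) x * (G (Suc k) \<circ> inv_into U \<phi>) (\<phi> x)"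
      by (rule LIMSEQ_unique)
    with g'x(1) show "((G k \<circ> inv_into U \<phi>) has_field_derivative \<theta> (U, \<phi>) x * (G (Suc k) \<circ> inv_into U \<phi>) (\<phi> x)) (at (\<phi> x))"
      by simp
  qed (use c in simp)
  then show J: "theta_jet r (G 0) G" unfolding theta_jet_def using zero by auto
  have "(G 0 \<circ> inv_into U \<phi>) holomorphic_on \<phi> ` (U \<inter> int_M)" if c: "(U, \<phi>) \<in> \<A>" for U \<phi>
  proof (rule holomorphic_uniform_sequence)
    show "open (\<phi> ` (U \<inter> int_M))" using chart_interior[OF c] open_interior by metis
    show "(jet r (h n) 0 \<circ> inv_into U \<phi>) holomorphic_on \<phi> ` (U \<inter> int_M)" for n
      using h[of n] c unfolding jet_0[OF h] Ar_space_def holomorphic_interior_def by auto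
  qed (rule ball[OF c], auto)
  then have "holomorphic_interior X \<A> M (G 0)" unfolding holomorphic_interior_def by auto
  with J show "G 0 \<in> Ar r" by (rule theta_jet_imp_Ar)
qed

lemma mcomplete_Ar: "Metric_space.mcomplete (Ar r) (norm_dist (Ar r) (jet_norm r))"
proof -
  interpret C: normed_on fun_scaleC "Ar r" "jet_norm r" by (rule normed_Ar_C)
  show ?thesis
    unfolding C.mcomplete_iff
  proof (intro allI impI, elim conjE)
    fix h :: "nat \<Rightarrow> 'a \<Rightarrow> complex"
    assume "range h \<subseteq> Ar r"
    then have h: "h n \<in> Ar r" for n by (simp add: image_subset_iff)
    assume "\<forall>e>0. \<exists>n0. \<forall>m\<ge>n0. \<forall>n\<ge>n0. jet_norm r (h m - h n) < e"
    then have cau: "\<exists>n0. \<forall>m\<ge>n0. \<forall>n\<ge>n0. jet_norm r (h m - h n) < e" if "e > 0" for e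
      using that by simp
    have jetle: "norm (jet r (h m) k x - jet r (h n) k x) \<le> jet_norm r (h m - h n)" if "k \<le> r" "x \<in> M" for m n k x
      using norm_jet_le[OF Ar_diff(1)[OF h h] that] Ar_diff(2)[OF h h that(1)] by simp
    define G where "G k x = (if x \<in> M then lim (\<lambda>n. jet r (h n) k x) else 0)" for k x
    have lim: "(\<lambda>n. jet r (h n) k x) \<longlonglongrightarrow> G k x" if "k \<le> r" "x \<in> M" for k x
    proof -
      have "Cauchy (\<lambda>n. jet r (h n) k x)"
      proof (rule metric_CauchyI)
        fix e :: real assume "e > 0"
        from cau[OF this] obtain n0 where "\<forall>m\<ge>n0. \<forall>n\<ge>n0. jet_norm r (h m - h n) < e" by (elim exE)
        then show "\<exists>n0. \<forall>m\<ge>n0. \<forall>n\<ge>n0. dist (jet r (h m) k x) (jet r (h n) k x) < e"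
          using jetle[OF that] unfolding dist_norm by (intro exI[of _ n0]) (meson le_less_trans)
      qed
      then show ?thesis using that unfolding G_def by (simp add: Cauchy_convergent_iff convergent_LIMSEQ_iff)
    qed
    have unif: "\<exists>n0. \<forall>n\<ge>n0. \<forall>k\<le>r. \<forall>x\<in>M. norm (jet r (h n) k x - G k x) \<le> e" if "e > 0" for e
    proof -
      from cau[OF that] obtain n0 where n0: "\<forall>m\<ge>n0. \<forall>n\<ge>n0. jet_norm r (h m - h n) < e" by (elim exE)
      have "norm (jet r (h n) k x - G k x) \<le> e" if n: "n \<ge> n0" and k: "k \<le> r" "x \<in> M" for n k x
      proof (rule Lim_bounded[where M = n0])
        show "(\<lambda>m. norm (jet r (h n) k x - jet r (h m) k x)) \<longlonglongrightarrow> norm (jet r (h n) k x - G k x)"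
          by (intro tendsto_norm tendsto_diff tendsto_const lim k)
        show "\<forall>m\<ge>n0. norm (jet r (h n) k x - jet r (h m) k x) \<le> e"
          using n0 n jetle[OF k] by (meson less_imp_le order_trans)
      qed
      then show ?thesis by (intro exI[of _ n0]) simp
    qed
    have "G k x = 0" if "x \<notin> M" for k x using that by (simp add: G_def)
    note G = limit_in_Ar[OF h this unif]
    have "\<exists>n0. \<forall>n\<ge>n0. jet_norm r (h n - G 0) \<le> e" if e: "e > 0" for e
    proof -
      from unif[OF e] obtain n0 where n0: "\<forall>n\<ge>n0. \<forall>k\<le>r. \<forall>x\<in>M. norm (jet r (h n) k x - G k x) \<le> e" by (elim exE)
      have "jet_norm r (h n - G 0) \<le> e" if "n \<ge> n0" for n
        using n0 that by (intro jet_norm_leI) (simp add: Ar_diff(2)[OF h G(1)] jet_eqI[OF G(2)])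
      then show ?thesis by auto
    qed
    then have "(\<lambda>n. jet_norm r (h n - G 0)) \<longlonglongrightarrow> 0"
      using jet_norm_nonneg[OF Ar_diff(1)[OF h G(1)]]
      by (intro LIMSEQ_I) (simp, meson field_lbound_gt_zero le_less_trans less_imp_le linorder_not_le)
    with G(1) show "\<exists>v\<in>Ar r. (\<lambda>n. jet_norm r (h n - v)) \<longlonglongrightarrow> 0" by blast
  qed
qed

lemma banach_Ar_C: "banach_space_on fun_scaleC (Ar r) (jet_norm r)"
  using normed_on.banach_iff[OF normed_Ar_C] mcomplete_Ar by blast

lemma banach_Ar_R: "banach_space_on fun_scaleR (Ar r) (jet_norm r)"
  using normed_on.banach_iff[OF normed_Ar_R] mcomplete_Ar by blast

lemma chart_continuous:
  assumes "(U, \<phi>) \<in> \<A>"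
  shows "continuous_map (subtopology X U) euclidean \<phi>"
  using homeomorphic_imp_continuous_map[OF chart_homeomorphic[OF assms]]
  by (simp add: continuous_map_in_subtopology)

lemma chart_compact_image:
  assumes "(U, \<phi>) \<in> \<A>" "compactin X K" "K \<subseteq> U"
  shows "compact (\<phi> ` K)"
proof -
  have "compactin (subtopology X U) K" using assms by (simp add: compactin_subtopology)
  from image_compactin[OF this chart_continuous[OF assms(1)]] show ?thesis by simp
qed

text \<open>A linear combination with coefficients that are bounded on a compact set.\<close>

lemma coefficient_bound:
  fixes b :: "nat \<Rightarrow> nat \<Rightarrow> complex \<Rightarrow> complex"
  assumes c: "(U, \<phi>) \<in> \<A>" and K: "compactin X K" "K \<subseteq> U \<inter> M"
    and b: "\<And>k l. continuous_on (\<phi> ` (U \<inter> M)) (b k l)"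
  shows "\<exists>C>0. \<forall>k\<le>r. \<forall>e B. \<forall>x\<in>K. (\<forall>l\<le>r. norm (e l) \<le> B) \<longrightarrow>
    norm (\<Sum>l\<le>k. b k l (\<phi> x) * e l) \<le> C * (B :: real)"
proof -
  have cpt: "compact (\<phi> ` K)" using K by (intro chart_compact_image[OF c]) auto
  have "\<exists>C\<ge>0. \<forall>x\<in>K. norm (b k l (\<phi> x)) \<le> C" for k l
  proof -
    have "compact (b k l ` \<phi> ` K)"
      using K(2) by (intro compact_continuous_image[OF continuous_on_subset[OF b] cpt]) auto
    then have "bounded (b k l ` \<phi> ` K)" by (rule compact_imp_bounded)
    then obtain C where "\<forall>z\<in>b k l ` \<phi> ` K. norm z \<le> C" unfolding bounded_iff by (elim exE)
    then show ?thesis by (intro exI[of _ "\<bar>C\<bar>"]) force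
  qed
  then have "\<exists>C. \<forall>k l. C k l \<ge> 0 \<and> (\<forall>x\<in>K. norm (b k l (\<phi> x)) \<le> C k l)"
    by (intro choice allI) simp
  then obtain C where "\<forall>k l. C k l \<ge> 0 \<and> (\<forall>x\<in>K. norm (b k l (\<phi> x)) \<le> C k l)" by (elim exE)
  then have C: "\<And>k l. C k l \<ge> 0" "\<And>k l x. x \<in> K \<Longrightarrow> norm (b k l (\<phi> x)) \<le> C k l" by simp_all
  define D where "D = 1 + (\<Sum>k\<le>r. \<Sum>l\<le>r. C k l)"
  have "norm (\<Sum>l\<le>k. b k l (\<phi> x) * e l) \<le> D * B"
    if k: "k \<le> r" and x: "x \<in> K" and e: "\<forall>l\<le>r. norm (e l) \<le> B" for k e B x
  proof -
    have B: "B \<ge> 0" using order_trans[OF norm_ge_zero, of "e 0" B] e by simp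
    have "norm (\<Sum>l\<le>k. b k l (\<phi> x) * e l) \<le> (\<Sum>l\<le>k. C k l * B)"
      using k x e C B by (intro sum_norm_le) (auto simp: norm_mult intro!: mult_mono)
    also have "\<dots> \<le> (\<Sum>l\<le>r. C k l) * B"
      unfolding sum_distrib_right using k C(1) B by (intro sum_mono2) auto
    also have "\<dots> \<le> D * B"
    proof (rule mult_right_mono[OF _ B])
      have "(\<Sum>l\<le>r. C k l) \<le> (\<Sum>k\<le>r. \<Sum>l\<le>r. C k l)"
        using k C(1) by (intro member_le_sum) (auto intro!: sum_nonneg)
      then show "(\<Sum>l\<le>r. C k l) \<le> D" by (simp add: D_def)
    qed
    finally show ?thesis .
  qed
  moreover have "D > 0" unfolding D_def using C(1) by (simp add: add_pos_nonneg sum_nonneg)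
  ultimately show ?thesis by (intro exI[of _ D] conjI allI ballI impI)
qed

text \<open>With this estimate the sets \<open>Cr_nbhd\<close> are open for the norm; the next one shows that norm balls are
  neighbourhoods in the \<open>C\<^sup>r\<close>-topology.\<close>

lemma chart_jet_le_jet_norm:
  assumes c: "(U, \<phi>) \<in> \<A>" and K: "compactin X K" "K \<subseteq> U \<inter> M"
  shows "\<exists>C>0. \<forall>h\<in>Ar r. \<exists>D. Cr_jet r (\<phi> ` (U \<inter> M)) (h \<circ> inv_into U \<phi>) D \<and>
    (\<forall>i j. i + j \<le> r \<longrightarrow> (\<forall>x\<in>K. norm (D i j (\<phi> x)) \<le> C * jet_norm r h))"
proof -
  let ?b = "jet_coeff (\<theta> (U, \<phi>) \<circ> inv_into U \<phi>) (\<lambda>_. 1)"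
  have "continuous_on (\<phi> ` (U \<inter> M)) (?b k l)" for k l
    by (rule continuous_on_subset[OF holomorphic_on_imp_continuous_on[OF
          jet_coeff_holomorphic[OF coeff_domain(1)[OF c] coeff_domain(3)[OF c]]] coeff_domain(2)[OF c]]) auto
  from coefficient_bound[OF c K, of ?b, OF this, of r]
  obtain C where C: "C > 0" "\<forall>k\<le>r. \<forall>e B. \<forall>x\<in>K. (\<forall>l\<le>r. norm (e l) \<le> B) \<longrightarrow>
    norm (\<Sum>l\<le>k. ?b k l (\<phi> x) * e l) \<le> C * (B :: real)" by (elim exE conjE)
  have "\<exists>D. Cr_jet r (\<phi> ` (U \<inter> M)) (h \<circ> inv_into U \<phi>) D \<and>
    (\<forall>i j. i + j \<le> r \<longrightarrow> (\<forall>x\<in>K. norm (D i j (\<phi> x)) \<le> C * jet_norm r h))"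
    if h: "h \<in> Ar r" for h
  proof (intro exI conjI)
    show "Cr_jet r (\<phi> ` (U \<inter> M)) (h \<circ> inv_into U \<phi>)
      (\<lambda>i j z. \<i> ^ j * (\<Sum>l\<le>i + j. ?b (i + j) l z * (jet r h l \<circ> inv_into U \<phi>) z))"
      by (rule local_jet_imp_Cr_jet[OF c theta_jet_local[OF theta_jet_jet[OF h] c]])
    show "\<forall>i j. i + j \<le> r \<longrightarrow> (\<forall>x\<in>K. norm (\<i> ^ j * (\<Sum>l\<le>i + j. ?b (i + j) l (\<phi> x) * (jet r h l \<circ> inv_into U \<phi>) (\<phi> x))) \<le> C * jet_norm r h)"
    proof (intro allI impI ballI)
      fix i j x assume i: "i + j \<le> r" and x: "x \<in> K"
      from x K(2) have x': "x \<in> U" "x \<in> M" by auto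
      then have "\<forall>l\<le>r. norm ((jet r h l \<circ> inv_into U \<phi>) (\<phi> x)) \<le> jet_norm r h"
        using norm_jet_le[OF h] chart_inv[OF c] by simp
      with C(2) i x have "norm (\<Sum>l\<le>i + j. ?b (i + j) l (\<phi> x) * (jet r h l \<circ> inv_into U \<phi>) (\<phi> x)) \<le> C * jet_norm r h"
        by simp
      then show "norm (\<i> ^ j * (\<Sum>l\<le>i + j. ?b (i + j) l (\<phi> x) * (jet r h l \<circ> inv_into U \<phi>) (\<phi> x))) \<le> C * jet_norm r h"
        by (simp add: norm_mult norm_power)
    qed
  qed
  with C(1) show ?thesis by (intro exI[of _ C] conjI ballI)
qed

lemma jet_le_chart_jet:
  assumes c: "(U, \<phi>) \<in> \<A>" and K: "compactin X K" "K \<subseteq> U \<inter> M"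
  shows "\<exists>C>0. \<forall>h\<in>Ar r. \<forall>D B. Cr_jet r (\<phi> ` (U \<inter> M)) (h \<circ> inv_into U \<phi>) D \<longrightarrow>
    (\<forall>i\<le>r. \<forall>x\<in>K. norm (D i 0 (\<phi> x)) \<le> B) \<longrightarrow> (\<forall>k\<le>r. \<forall>x\<in>K. norm (jet r h k x) \<le> C * B)"
proof -
  let ?b = "jet_coeff (\<lambda>_. 1) (\<theta> (U, \<phi>) \<circ> inv_into U \<phi>)"
  have "continuous_on (\<phi> ` (U \<inter> M)) (?b k l)" for k l
    by (rule continuous_on_subset[OF holomorphic_on_imp_continuous_on[OF
          jet_coeff_holomorphic[OF coeff_domain(1)[OF c] _ coeff_domain(3,4)[OF c]]] coeff_domain(2)[OF c]]) auto
  from coefficient_bound[OF c K, of ?b, OF this, of r]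
  obtain C where C: "C > 0" "\<forall>k\<le>r. \<forall>e B. \<forall>x\<in>K. (\<forall>l\<le>r. norm (e l) \<le> B) \<longrightarrow>
    norm (\<Sum>l\<le>k. ?b k l (\<phi> x) * e l) \<le> C * (B :: real)" by (elim exE conjE)
  have "norm (jet r h k x) \<le> C * B"
    if h: "h \<in> Ar r" and D: "Cr_jet r (\<phi> ` (U \<inter> M)) (h \<circ> inv_into U \<phi>) D"
      and B: "\<forall>i\<le>r. \<forall>x\<in>K. norm (D i 0 (\<phi> x)) \<le> B" and k: "k \<le> r" and x: "x \<in> K" for h D B k x
  proof -
    have hol: "holomorphic_interior X \<A> M h" using h unfolding Ar_space_def by simp
    have x': "x \<in> U" "x \<in> M" using x K by auto
    have "(jet r h k \<circ> inv_into U \<phi>) (\<phi> x) = (\<Sum>l\<le>k. ?b k l (\<phi> x) * D l 0 (\<phi> x))"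
      by (rule local_jet_compatible[OF c c theta_jet_local[OF theta_jet_jet[OF h] c]
            Cr_jet_imp_local_jet[OF c hol D] k x'(1) x'(1) x'(2)])
    also have "norm \<dots> \<le> C * B"
      using C(2) k x B by simp
    finally show ?thesis using c x' by simp
  qed
  with C(1) show ?thesis by (intro exI[of _ C] conjI ballI allI impI)
qed

lemma compact_chart_nbhd:
  assumes "x \<in> M"
  shows "\<exists>c K P. c \<in> \<A> \<and> compactin X K \<and> K \<subseteq> fst c \<inter> M \<and> openin X P \<and> x \<in> P \<and> P \<inter> M \<subseteq> K"
proof -
  have "x \<in> topspace X" using assms M_subset by auto
  then obtain U \<phi> where c: "(U, \<phi>) \<in> \<A>" "x \<in> U" using chart_covers by metis
  obtain e where e: "e > 0" "cball (\<phi> x) e \<subseteq> \<phi> ` U"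
    using chart_open_range[OF c(1)] imageI[OF c(2), of \<phi>] unfolding open_contains_cball by metis
  have "compactin (top_of_set (\<phi> ` U)) (cball (\<phi> x) e)" using e by (simp add: compactin_subtopology)
  then have "compactin X (inv_into U \<phi> ` cball (\<phi> x) e)"
    using chart_inv_continuous[OF c(1)] by (rule image_compactin)
  then have "compactin X (inv_into U \<phi> ` cball (\<phi> x) e \<inter> M)"
    using closed_M by (rule compact_Int_closedin)
  moreover have "inv_into U \<phi> ` cball (\<phi> x) e \<subseteq> U"
    using e(2) by (meson image_subset_iff inv_into_into subsetD)
  moreover have "openin X {y\<in>U. \<phi> y \<in> ball (\<phi> x) e}" by (rule chart_open_preimage[OF c(1)]) simp
  moreover have "y \<in> inv_into U \<phi> ` cball (\<phi> x) e" if "y \<in> U" "\<phi> y \<in> ball (\<phi> x) e" for y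
    using that c(1) by (intro image_eqI[of _ _ "\<phi> y"]) auto
  ultimately show ?thesis using c e
    by (intro exI[of _ "(U, \<phi>)"] exI[of _ "inv_into U \<phi> ` cball (\<phi> x) e \<inter> M"]
        exI[of _ "{y\<in>U. \<phi> y \<in> ball (\<phi> x) e}"]) auto
qed

lemma finite_chart_cover:
  obtains F where "finite F" "\<And>c K. (c, K) \<in> F \<Longrightarrow> c \<in> \<A> \<and> compactin X K \<and> K \<subseteq> fst c \<inter> M"
    "\<And>x. x \<in> M \<Longrightarrow> \<exists>c K. (c, K) \<in> F \<and> x \<in> K"
proof -
  have "\<forall>x\<in>M. \<exists>t. fst t \<in> \<A> \<and> compactin X (fst (snd t)) \<and> fst (snd t) \<subseteq> fst (fst t) \<inter> M \<and>
      openin X (snd (snd t)) \<and> x \<in> snd (snd t) \<and> snd (snd t) \<inter> M \<subseteq> fst (snd t)"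
    using compact_chart_nbhd by simp
  then obtain t where t: "\<forall>x\<in>M. fst (t x) \<in> \<A> \<and> compactin X (fst (snd (t x))) \<and> fst (snd (t x)) \<subseteq> fst (fst (t x)) \<inter> M \<and>
      openin X (snd (snd (t x))) \<and> x \<in> snd (snd (t x)) \<and> snd (snd (t x)) \<inter> M \<subseteq> fst (snd (t x))"
    by (rule bchoice[elim_format]) (elim exE)
  have "\<exists>G. finite G \<and> G \<subseteq> (\<lambda>x. snd (snd (t x))) ` M \<and> M \<subseteq> \<Union>G"
    by (rule compactinD[OF compact_M]) (use t in auto)
  then obtain G where G: "finite G" "G \<subseteq> (\<lambda>x. snd (snd (t x))) ` M" "M \<subseteq> \<Union>G" by (elim exE conjE)
  then obtain M' where M': "M' \<subseteq> M" "finite M'" "G = (\<lambda>x. snd (snd (t x))) ` M'"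
    using finite_subset_image by metis
  show ?thesis
  proof (rule that[of "(\<lambda>x. (fst (t x), fst (snd (t x)))) ` M'"])
    show "finite ((\<lambda>x. (fst (t x), fst (snd (t x)))) ` M')" using M' by simp
    show "c \<in> \<A> \<and> compactin X K \<and> K \<subseteq> fst c \<inter> M" if "(c, K) \<in> (\<lambda>x. (fst (t x), fst (snd (t x)))) ` M'" for c K
      using that t M'(1) by auto
    fix x assume x: "x \<in> M"
    then obtain y where y: "y \<in> M'" "x \<in> snd (snd (t y))" using G(3) M'(3) by auto
    then have "x \<in> fst (snd (t y))" using t M'(1) x by blast
    with y(1) show "\<exists>c K. (c, K) \<in> (\<lambda>x. (fst (t x), fst (snd (t x)))) ` M' \<and> x \<in> K" by blast
  qed
qed

text \<open>On a compact set a strict bound by \<open>\<epsilon>\<close> leaves room for a perturbation of the jet.\<close>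

lemma Cr_jet_gap:
  assumes c: "(U, \<phi>) \<in> \<A>" and K: "compactin X K" "K \<subseteq> U \<inter> M"
    and D: "Cr_jet r (\<phi> ` (U \<inter> M)) g D" and lt: "\<forall>i j. i + j \<le> r \<longrightarrow> (\<forall>x\<in>K. norm (D i j (\<phi> x)) < \<epsilon>)"
  shows "\<exists>\<eta>>0. \<forall>i j. i + j \<le> r \<longrightarrow> (\<forall>x\<in>K. norm (D i j (\<phi> x)) + \<eta> \<le> \<epsilon>)"
proof -
  have "\<exists>\<eta>>0. \<forall>p\<in>{p. fst p + snd p \<le> r}. \<forall>x\<in>K. norm (D (fst p) (snd p) (\<phi> x)) + \<eta> \<le> \<epsilon>"
  proof (rule finite_uniform_gap)
    have "{p. fst p + snd p \<le> r} \<subseteq> {..r} \<times> {..r}" by auto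
    then show "finite {p. fst p + snd p \<le> r}" by (rule finite_subset) simp
    fix p assume p: "p \<in> {p. fst p + snd p \<le> r}"
    let ?D = "D (fst p) (snd p)"
    show "\<exists>\<eta>>0. \<forall>x\<in>K. norm (?D (\<phi> x)) + \<eta> \<le> \<epsilon>"
    proof (cases "K = {}")
      case True
      then show ?thesis by (intro exI[of _ 1]) auto
    next
      case False
      have cpt: "compact (\<phi> ` K)" using K by (intro chart_compact_image[OF c]) auto
      have "continuous_on (\<phi> ` (U \<inter> M)) ?D" using D p unfolding Cr_jet_def by auto
      then have "continuous_on (\<phi> ` K) (\<lambda>z. norm (?D z))"
        using K(2) by (intro continuous_on_norm) (auto elim!: continuous_on_subset)
      from continuous_attains_sup[OF cpt _ this] False
      obtain x0 where x0: "x0 \<in> K" "\<forall>x\<in>K. norm (?D (\<phi> x)) \<le> norm (?D (\<phi> x0))" by auto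
      have "norm (?D (\<phi> x0)) < \<epsilon>" using lt p x0(1) by auto
      then show ?thesis
        using x0(2) by (intro exI[of _ "\<epsilon> - norm (?D (\<phi> x0))"]) auto
    qed
  qed
  then show ?thesis by auto
qed

lemma Cr_nbhd_open_in_Ar:
  assumes c: "(U, \<phi>) \<in> \<A>" and K: "compactin X K" "K \<subseteq> U \<inter> M"
  shows "openin (norm_topology (Ar r) (jet_norm r)) (Cr_nbhd \<A> M r g (U, \<phi>) K \<epsilon> \<inter> Ar r)"
  unfolding normed_on.openin_norm_topology[OF normed_Ar_C]
proof (intro conjI ballI)
  fix h assume h: "h \<in> Cr_nbhd \<A> M r g (U, \<phi>) K \<epsilon> \<inter> Ar r"
  then obtain D where D: "Cr_jet r (\<phi> ` (U \<inter> M)) ((\<lambda>x. h x - g x) \<circ> inv_into U \<phi>) D"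
    "\<forall>i j. i + j \<le> r \<longrightarrow> (\<forall>x\<in>K. norm (D i j (\<phi> x)) < \<epsilon>)"
    unfolding Cr_nbhd_def by auto
  obtain \<eta> where \<eta>: "\<eta> > 0" "\<forall>i j. i + j \<le> r \<longrightarrow> (\<forall>x\<in>K. norm (D i j (\<phi> x)) + \<eta> \<le> \<epsilon>)"
    using Cr_jet_gap[OF c K D] by (elim exE conjE)
  obtain C where C: "C > 0" "\<forall>h\<in>Ar r. \<exists>D. Cr_jet r (\<phi> ` (U \<inter> M)) (h \<circ> inv_into U \<phi>) D \<and>
    (\<forall>i j. i + j \<le> r \<longrightarrow> (\<forall>x\<in>K. norm (D i j (\<phi> x)) \<le> C * jet_norm r h))"
    using chart_jet_le_jet_norm[OF c K, of r] by (elim exE conjE)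
  have hA: "h \<in> Ar r" using h by simp
  have "h' \<in> Cr_nbhd \<A> M r g (U, \<phi>) K \<epsilon> \<inter> Ar r"
    if h': "h' \<in> Ar r" "jet_norm r (h' - h) < \<eta> / C" for h'
  proof -
    from bspec[OF C(2) Ar_diff(1)[OF h'(1) hA]]
    obtain D' where D': "Cr_jet r (\<phi> ` (U \<inter> M)) ((h' - h) \<circ> inv_into U \<phi>) D'"
      "\<forall>i j. i + j \<le> r \<longrightarrow> (\<forall>x\<in>K. norm (D' i j (\<phi> x)) \<le> C * jet_norm r (h' - h))" by (elim exE conjE)
    have small: "C * jet_norm r (h' - h) < \<eta>" using h'(2) C(1) by (simp add: field_simps)
    have "Cr_jet r (\<phi> ` (U \<inter> M)) (\<lambda>z. ((\<lambda>x. h x - g x) \<circ> inv_into U \<phi>) z + ((h' - h) \<circ> inv_into U \<phi>) z)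
        (\<lambda>i j z. D i j z + D' i j z)"
      using D(1) D'(1) by (rule Cr_jet_add)
    moreover have "(\<lambda>z. ((\<lambda>x. h x - g x) \<circ> inv_into U \<phi>) z + ((h' - h) \<circ> inv_into U \<phi>) z) = (\<lambda>x. h' x - g x) \<circ> inv_into U \<phi>"
      by (auto simp: fun_eq_iff)
    ultimately have J: "Cr_jet r (\<phi> ` (U \<inter> M)) ((\<lambda>x. h' x - g x) \<circ> inv_into U \<phi>) (\<lambda>i j z. D i j z + D' i j z)" by simp
    have "norm (D i j (\<phi> x) + D' i j (\<phi> x)) < \<epsilon>" if ij: "i + j \<le> r" and x: "x \<in> K" for i j x
    proof -
      have "norm (D' i j (\<phi> x)) < \<eta>" using D'(2) ij x small by (meson le_less_trans)
      moreover have "norm (D i j (\<phi> x)) + \<eta> \<le> \<epsilon>" using \<eta>(2) ij x by simp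
      ultimately show ?thesis using norm_triangle_ineq[of "D i j (\<phi> x)" "D' i j (\<phi> x)"] by linarith
    qed
    with J have "\<exists>D. Cr_jet r (\<phi> ` (U \<inter> M)) ((\<lambda>x. h' x - g x) \<circ> inv_into U \<phi>) D \<and>
        (\<forall>i j. i + j \<le> r \<longrightarrow> (\<forall>x\<in>K. norm (D i j (\<phi> x)) < \<epsilon>))"
      by (intro exI[of _ "\<lambda>i j z. D i j z + D' i j z"]) simp
    then show ?thesis using h'(1) unfolding Cr_nbhd_def Ar_space_def by simp
  qed
  then show "\<exists>\<delta>>0. \<forall>h'\<in>Ar r. jet_norm r (h' - h) < \<delta> \<longrightarrow> h' \<in> Cr_nbhd \<A> M r g (U, \<phi>) K \<epsilon> \<inter> Ar r"
    using \<eta>(1) C(1) by (intro exI[of _ "\<eta> / C"]) simp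
qed simp

text \<open>Finitely many compact pieces of charts cover \<open>M\<close>, so finitely many of the sets \<open>Cr_nbhd\<close> control the norm.\<close>

lemma jet_ball_contains_Cr_nbhd:
  assumes h: "h \<in> Ar r" and \<epsilon>: "\<epsilon> > 0"
  shows "\<exists>P. openin (Cr_topology X \<A> M r) P \<and> h \<in> P \<and> (\<forall>h'\<in>P \<inter> Ar r. jet_norm r (h' - h) < \<epsilon>)"
proof -
  obtain F where F: "finite F" "\<And>c K. (c, K) \<in> F \<Longrightarrow> c \<in> \<A> \<and> compactin X K \<and> K \<subseteq> fst c \<inter> M"
    "\<And>x. x \<in> M \<Longrightarrow> \<exists>c K. (c, K) \<in> F \<and> x \<in> K" by (rule finite_chart_cover) (rule that)
  have "\<forall>p\<in>F. \<exists>C>0. \<forall>h\<in>Ar r. \<forall>D B.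
      Cr_jet r (snd (fst p) ` (fst (fst p) \<inter> M)) (h \<circ> inv_into (fst (fst p)) (snd (fst p))) D \<longrightarrow>
    (\<forall>i\<le>r. \<forall>x\<in>snd p. norm (D i 0 (snd (fst p) x)) \<le> B) \<longrightarrow> (\<forall>k\<le>r. \<forall>x\<in>snd p. norm (jet r h k x) \<le> C * B)"
  proof
    fix p assume p: "p \<in> F"
    obtain U \<phi> K where pe: "p = ((U, \<phi>), K)" by (metis prod.exhaust)
    then have "(U, \<phi>) \<in> \<A>" "compactin X K" "K \<subseteq> U \<inter> M" using F(2)[of "(U, \<phi>)" K] p by simp_all
    from jet_le_chart_jet[OF this, of r]
    show "\<exists>C>0. \<forall>h\<in>Ar r. \<forall>D B.
      Cr_jet r (snd (fst p) ` (fst (fst p) \<inter> M)) (h \<circ> inv_into (fst (fst p)) (snd (fst p))) D \<longrightarrow>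
    (\<forall>i\<le>r. \<forall>x\<in>snd p. norm (D i 0 (snd (fst p) x)) \<le> B) \<longrightarrow> (\<forall>k\<le>r. \<forall>x\<in>snd p. norm (jet r h k x) \<le> C * B)"
      unfolding pe fst_conv snd_conv .
  qed
  then obtain C where C: "\<forall>p\<in>F. C p > 0 \<and> (\<forall>h\<in>Ar r. \<forall>D B.
      Cr_jet r (snd (fst p) ` (fst (fst p) \<inter> M)) (h \<circ> inv_into (fst (fst p)) (snd (fst p))) D \<longrightarrow>
    (\<forall>i\<le>r. \<forall>x\<in>snd p. norm (D i 0 (snd (fst p) x)) \<le> B) \<longrightarrow> (\<forall>k\<le>r. \<forall>x\<in>snd p. norm (jet r h k x) \<le> C p * B))"
    by (rule bchoice[elim_format]) (elim exE)
  define C0 where "C0 = 1 + (\<Sum>p\<in>F. C p)"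
  have C0: "C0 > 0" "\<And>p. p \<in> F \<Longrightarrow> C p \<le> C0"
  proof -
    have nn: "\<And>p. p \<in> F \<Longrightarrow> 0 \<le> C p" using C by (auto intro: less_imp_le)
    then show "C0 > 0" unfolding C0_def by (simp add: add_pos_nonneg sum_nonneg)
    fix p assume "p \<in> F"
    then have "C p \<le> (\<Sum>p\<in>F. C p)" using F(1) nn by (intro member_le_sum) auto
    then show "C p \<le> C0" by (simp add: C0_def)
  qed
  define \<epsilon>' where "\<epsilon>' = \<epsilon> / (2 * C0)"
  have \<epsilon>': "\<epsilon>' > 0" using \<epsilon> C0(1) by (simp add: \<epsilon>'_def)
  define P where "P = (\<Inter>p\<in>F. Cr_nbhd \<A> M r h (fst p) (snd p) \<epsilon>')"
  have hC: "h \<in> Cr_space \<A> M r" using h unfolding Ar_space_def by simp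
  have "F \<noteq> {}" using M_nonempty F(3) by auto
  moreover have "openin (Cr_topology X \<A> M r) (Cr_nbhd \<A> M r h (fst p) (snd p) \<epsilon>')" if "p \<in> F" for p
    unfolding Cr_topology_def
  proof (rule topology_generated_by_Basis, rule CollectI, intro exI conjI)
    show "fst p \<in> \<A>" "compactin X (snd p)" "snd p \<subseteq> fst (fst p) \<inter> M"
      using F(2)[of "fst p" "snd p"] that by simp_all
  qed (use hC \<epsilon>' in auto)
  ultimately have "openin (Cr_topology X \<A> M r) P"
    unfolding P_def using F(1) by (intro openin_INT2) auto
  moreover have "h \<in> Cr_nbhd \<A> M r h c K \<epsilon>'" for c K
  proof -
    obtain U \<phi> where cc: "c = (U, \<phi>)" by (metis prod.exhaust)
    have "Cr_jet r (\<phi> ` (U \<inter> M)) ((\<lambda>x. h x - h x) \<circ> inv_into U \<phi>) (\<lambda>i j z. 0)"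
      unfolding Cr_jet_def by simp
    then show ?thesis unfolding Cr_nbhd_def cc using hC \<epsilon>' by (auto intro!: exI[of _ "\<lambda>i j z. 0"])
  qed
  moreover have "jet_norm r (h' - h) < \<epsilon>" if h': "h' \<in> P" "h' \<in> Ar r" for h'
  proof -
    have "jet_norm r (h' - h) \<le> \<epsilon> / 2"
    proof (rule jet_norm_leI)
      fix k x assume k: "k \<le> r" and x: "x \<in> M"
      obtain c K where "(c, K) \<in> F" "x \<in> K" using F(3)[OF x] by (elim exE conjE)
      then obtain U \<phi> where p: "((U, \<phi>), K) \<in> F" "x \<in> K" by (metis prod.exhaust)
      then have "h' \<in> Cr_nbhd \<A> M r h (U, \<phi>) K \<epsilon>'" using h'(1) unfolding P_def by force
      then have "\<exists>D. Cr_jet r (\<phi> ` (U \<inter> M)) ((\<lambda>x. h' x - h x) \<circ> inv_into U \<phi>) D \<and>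
        (\<forall>i j. i + j \<le> r \<longrightarrow> (\<forall>x\<in>K. norm (D i j (\<phi> x)) < \<epsilon>'))"
        unfolding Cr_nbhd_def by simp
      then obtain D where D: "Cr_jet r (\<phi> ` (U \<inter> M)) ((\<lambda>x. h' x - h x) \<circ> inv_into U \<phi>) D"
        "\<forall>i j. i + j \<le> r \<longrightarrow> (\<forall>x\<in>K. norm (D i j (\<phi> x)) < \<epsilon>')" by (elim exE conjE)
      have eq: "(\<lambda>x. h' x - h x) = h' - h" by (simp add: fun_eq_iff)
      have "\<forall>i\<le>r. \<forall>x\<in>K. norm (D i 0 (\<phi> x)) \<le> \<epsilon>'" using D(2) by (auto intro: less_imp_le)
      with bspec[OF C p(1)] D(1)[unfolded eq] Ar_diff(1)[OF h'(2) h] k p(2)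
      have "norm (jet r (h' - h) k x) \<le> C ((U, \<phi>), K) * \<epsilon>'" by simp
      also have "\<dots> \<le> C0 * \<epsilon>'" using C0(2)[OF p(1)] \<epsilon>' by (intro mult_right_mono) auto
      also have "\<dots> = \<epsilon> / 2" using C0(1) by (simp add: \<epsilon>'_def)
      finally show "norm (jet r (h' - h) k x) \<le> \<epsilon> / 2" .
    qed
    then show ?thesis using \<epsilon> by simp
  qed
  ultimately show ?thesis unfolding P_def by (intro exI[of _ P]) (auto simp: P_def)
qed

lemma Cr_topology_Ar:
  "subtopology (Cr_topology X \<A> M r) (Ar r) = norm_topology (Ar r) (jet_norm r)"
proof -
  let ?A = "Ar r" and ?T = "Cr_topology X \<A> M r" and ?N = "norm_topology (Ar r) (jet_norm r)"
  note top = normed_on.openin_norm_topology[OF normed_Ar_C]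
  have 1: "openin ?N (P \<inter> ?A)" if "openin ?T P" for P
    using that unfolding Cr_topology_def openin_topology_generated_by_iff
  proof (induction rule: generate_topology_on.induct)
    case (Int a b)
    from openin_Int[OF Int(3,4)] show ?case by (simp add: Int_ac)
  next
    case (UN K)
    have eq: "\<Union>K \<inter> ?A = (\<Union>k\<in>K. k \<inter> ?A)" by (rule Int_Union2)
    show ?case unfolding eq by (rule openin_Union) (use UN(2) in fast)
  next
    case (Basis s)
    then have "\<exists>g c K \<epsilon>. s = Cr_nbhd \<A> M r g c K \<epsilon> \<and> g \<in> Cr_space \<A> M r \<and> c \<in> \<A> \<and> compactin X K \<and>
        K \<subseteq> fst c \<inter> M \<and> 0 < \<epsilon>" by (rule CollectD)
    then obtain g c K \<epsilon> where s: "s = Cr_nbhd \<A> M r g c K \<epsilon>" "c \<in> \<A>" "compactin X K" "K \<subseteq> fst c \<inter> M"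
      by (elim exE conjE)
    obtain U \<phi> where c: "c = (U, \<phi>)" by (cases c)
    show ?case using s(2-4) unfolding s(1) c fst_conv by (rule Cr_nbhd_open_in_Ar)
  qed simp
  have 2: "\<exists>P. openin ?T P \<and> Q = P \<inter> ?A" if Q: "openin ?N Q" for Q
  proof (intro exI conjI)
    let ?P = "\<Union>{P. openin ?T P \<and> P \<inter> ?A \<subseteq> Q}"
    show "openin ?T ?P" by (rule openin_Union) simp
    have "h \<in> ?P \<inter> ?A" if "h \<in> Q" for h
    proof -
      have h: "h \<in> ?A" using Q that unfolding top by auto
      have "\<exists>\<epsilon>>0. \<forall>h'\<in>?A. jet_norm r (h' - h) < \<epsilon> \<longrightarrow> h' \<in> Q"
        using conjunct2[OF Q[unfolded top]] that by (rule bspec)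
      then obtain \<epsilon> where \<epsilon>: "\<epsilon> > 0" "\<forall>h'\<in>?A. jet_norm r (h' - h) < \<epsilon> \<longrightarrow> h' \<in> Q" by (elim exE conjE)
      obtain P where P: "openin ?T P" "h \<in> P" "\<forall>h'\<in>P \<inter> ?A. jet_norm r (h' - h) < \<epsilon>"
        using jet_ball_contains_Cr_nbhd[OF h \<epsilon>(1)] by (elim exE conjE)
      have "P \<inter> ?A \<subseteq> Q" using P(3) \<epsilon>(2) by auto
      with P h show ?thesis by auto
    qed
    then show "Q = ?P \<inter> ?A" by auto
  qed
  have "openin (subtopology ?T ?A) Q \<longleftrightarrow> openin ?N Q" for Q
    unfolding openin_subtopology using 1 2 by metis
  then show ?thesis by (simp add: topology_eq)
qed

lemma Ar_subset_topspace: "Ar r \<subseteq> topspace (Cr_topology X \<A> M r)"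
proof
  fix h assume "h \<in> Ar r"
  from jet_ball_contains_Cr_nbhd[OF this zero_less_one] openin_subset
  show "h \<in> topspace (Cr_topology X \<A> M r)" by auto
qed

end

section \<open>Curves in the surface\<close>

text \<open>The derivatives in question are two-sided, so agreement on the interval says nothing about them at its
  endpoints. These join the exceptional set.\<close>

lemma piecewise_C1_cong:
  fixes f g :: "real \<Rightarrow> complex"
  assumes f: "f piecewise_C1_differentiable_on {a..b}" and eq: "\<And>x. x \<in> {a..b} \<Longrightarrow> f x = g x"
  shows "g piecewise_C1_differentiable_on {a..b}"
proof -
  obtain S D where S: "finite S" "continuous_on {a..b} f" "continuous_on ({a..b} - S) D"
    "\<forall>x\<in>{a..b} - S. (f has_vector_derivative D x) (at x)"
    using f unfolding piecewise_C1_differentiable_on_def C1_differentiable_on_def by (elim conjE exE)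
  have "(g has_vector_derivative D x) (at x)" if "x \<in> {a..b} - (S \<union> {a, b})" for x
    by (rule has_vector_derivative_transform_within_open[of f _ _ "{a<..<b}"]) (use S that eq in auto)
  moreover have "continuous_on ({a..b} - (S \<union> {a, b})) D"
    using S(3) by (rule continuous_on_subset) auto
  moreover have "continuous_on {a..b} g" using S(2) eq by (rule continuous_on_eq)
  ultimately show ?thesis
    unfolding piecewise_C1_differentiable_on_def C1_differentiable_on_def
    using S(1) by (intro conjI exI[of _ "S \<union> {a, b}"] exI[of _ D]) auto
qed

text \<open>Concatenation at double speed, for curves in a space that carries its topology as a term and not by its type.\<close>

definition join_curves :: "(real \<Rightarrow> 'a) \<Rightarrow> (real \<Rightarrow> 'a) \<Rightarrow> real \<Rightarrow> 'a" where
  "join_curves \<gamma> \<nu> = (\<lambda>s. if s \<le> 1 / 2 then \<gamma> (2 * s) else \<nu> (2 * s - 1))"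

context bordered_surface
begin

text \<open>The curves of \<open>closed_curve\<close>, without the condition that they close up.\<close>

definition M_curve :: "(real \<Rightarrow> 'a) \<Rightarrow> bool" where
  "M_curve \<gamma> \<longleftrightarrow> pathin (subtopology X M) \<gamma> \<and>
     (\<forall>(U, \<phi>)\<in>\<A>. \<forall>a b. 0 \<le> a \<and> a \<le> b \<and> b \<le> 1 \<and> \<gamma> ` {a..b} \<subseteq> U \<longrightarrow>
        (\<phi> \<circ> \<gamma>) piecewise_C1_differentiable_on {a..b})"

lemma closed_curve_iff: "closed_curve X \<A> M \<gamma> \<longleftrightarrow> M_curve \<gamma> \<and> \<gamma> 0 = \<gamma> 1"
  unfolding closed_curve_def M_curve_def by blast

lemma M_curveD:
  assumes "M_curve \<gamma>"
  shows "continuous_map (top_of_set {0..1}) X \<gamma>"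
    and "t \<in> {0..1} \<Longrightarrow> \<gamma> t \<in> M"
    and "(U, \<phi>) \<in> \<A> \<Longrightarrow> 0 \<le> a \<Longrightarrow> a \<le> b \<Longrightarrow> b \<le> 1 \<Longrightarrow> \<gamma> ` {a..b} \<subseteq> U \<Longrightarrow>
      (\<phi> \<circ> \<gamma>) piecewise_C1_differentiable_on {a..b}"
proof -
  have "pathin X \<gamma>" "\<forall>x\<in>{0..1}. \<gamma> x \<in> M"
    using assms unfolding M_curve_def pathin_subtopology by simp_all
  then show "continuous_map (top_of_set {0..1}) X \<gamma>" "t \<in> {0..1} \<Longrightarrow> \<gamma> t \<in> M"
    unfolding pathin_def by simp_all
  show "(\<phi> \<circ> \<gamma>) piecewise_C1_differentiable_on {a..b}"
    if "(U, \<phi>) \<in> \<A>" "0 \<le> a" "a \<le> b" "b \<le> 1" "\<gamma> ` {a..b} \<subseteq> U"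
    using assms that unfolding M_curve_def by auto
qed

lemma M_curveI:
  assumes "continuous_map (top_of_set {0..1}) X \<gamma>" "\<And>t. t \<in> {0..1} \<Longrightarrow> \<gamma> t \<in> M"
    and "\<And>U \<phi> a b. (U, \<phi>) \<in> \<A> \<Longrightarrow> 0 \<le> a \<Longrightarrow> a \<le> b \<Longrightarrow> b \<le> 1 \<Longrightarrow> \<gamma> ` {a..b} \<subseteq> U \<Longrightarrow>
      (\<phi> \<circ> \<gamma>) piecewise_C1_differentiable_on {a..b}"
  shows "M_curve \<gamma>"
proof -
  have "pathin (subtopology X M) \<gamma>"
    unfolding pathin_subtopology using assms(1,2) by (simp add: pathin_def)
  then show ?thesis unfolding M_curve_def using assms(3) by auto
qed

text \<open>Near \<open>t\<close> the curve is continuously differentiable in some chart, hence in every chart.\<close>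

definition smooth_at :: "(real \<Rightarrow> 'a) \<Rightarrow> real \<Rightarrow> bool" where
  "smooth_at \<gamma> t \<longleftrightarrow> (\<exists>U \<phi> I D. (U, \<phi>) \<in> \<A> \<and> open I \<and> t \<in> I \<and> I \<subseteq> {0..1} \<and> \<gamma> ` I \<subseteq> U \<and>
     continuous_on I D \<and> (\<forall>s\<in>I. ((\<phi> \<circ> \<gamma>) has_vector_derivative D s) (at s)))"

text \<open>The value of \<open>form_along\<close> does not depend on the chart that its definition picks.\<close>

lemma form_along_chart:
  assumes c: "(U, \<phi>) \<in> \<A>" and I: "open I" "t \<in> I" "\<gamma> ` I \<subseteq> U" and t: "\<gamma> t \<in> M"
    and d: "((\<phi> \<circ> \<gamma>) has_vector_derivative d) (at t)"
  shows "pullback \<gamma> t = \<theta> (U, \<phi>) (\<gamma> t) * d"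
proof -
  define c' where "c' = (SOME c. c \<in> \<A> \<and> \<gamma> t \<in> fst c)"
  have tU: "\<gamma> t \<in> U" using I by auto
  have "\<exists>c. c \<in> \<A> \<and> \<gamma> t \<in> fst c" using c tU by (intro exI[of _ "(U, \<phi>)"]) simp
  then have "c' \<in> \<A> \<and> \<gamma> t \<in> fst c'" unfolding c'_def by (rule someI_ex)
  then obtain V \<psi> where V: "c' = (V, \<psi>)" "(V, \<psi>) \<in> \<A>" "\<gamma> t \<in> V" by (cases c') simp
  let ?\<tau> = "\<psi> \<circ> inv_into U \<phi>"
  have "((?\<tau> \<circ> (\<phi> \<circ> \<gamma>)) has_vector_derivative d * deriv ?\<tau> (\<phi> (\<gamma> t))) (at t)"
    by (rule field_vector_diff_chain_at[OF d]) (use transition_has_field_derivative[OF c V(2) tU V(3)] in simp)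
  then have "((\<psi> \<circ> \<gamma>) has_vector_derivative d * deriv ?\<tau> (\<phi> (\<gamma> t))) (at t)"
    by (rule has_vector_derivative_transform_within_open[OF _ I(1,2)]) (use I(3) c in auto)
  then have "vector_derivative (\<psi> \<circ> \<gamma>) (at t) = d * deriv ?\<tau> (\<phi> (\<gamma> t))" by (rule vector_derivative_at)
  then have "pullback \<gamma> t = \<theta> (V, \<psi>) (\<gamma> t) * (d * deriv ?\<tau> (\<phi> (\<gamma> t)))"
    unfolding form_along_def c'_def[symmetric] V(1) by simp
  moreover have "\<theta> (U, \<phi>) (\<gamma> t) = \<theta> (V, \<psi>) (\<gamma> t) * deriv ?\<tau> (\<phi> (\<gamma> t))"
    using M_subset_form_domain t by (intro form_transition[OF c V(2) tU V(3)]) auto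
  ultimately show ?thesis by simp
qed

text \<open>The exceptional set in the definition of a curve depends on the chart and on the parameter interval.
  Bisection of \<open>{0..1}\<close> yields a single finite set: the property is additive in the interval, and short
  intervals are mapped into one chart.\<close>

lemma smooth_at_finite_exceptions:
  assumes \<gamma>: "M_curve \<gamma>"
  shows "\<exists>S. finite S \<and> (\<forall>t\<in>{0<..<1} - S. smooth_at \<gamma> t)"
proof -
  define P where "P a b \<longleftrightarrow> (0 \<le> a \<and> b \<le> 1 \<longrightarrow> (\<exists>S. finite S \<and> (\<forall>t\<in>{a<..<b} - S. smooth_at \<gamma> t)))" for a b
  have "P 0 1"
  proof (rule Bolzano)
    fix a b c assume ab: "P a b" and bc: "P b c" and le: "a \<le> b" "b \<le> c"
    show "P a c"
      unfolding P_def
    proof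
      assume ac: "0 \<le> a \<and> c \<le> 1"
      obtain S where S: "finite S" "\<forall>t\<in>{a<..<b} - S. smooth_at \<gamma> t" using ab ac le unfolding P_def by auto
      obtain S' where S': "finite S'" "\<forall>t\<in>{b<..<c} - S'. smooth_at \<gamma> t" using bc ac le unfolding P_def by auto
      have "smooth_at \<gamma> t" if "t \<in> {a<..<c} - (S \<union> S' \<union> {b})" for t
        using that S(2) S'(2) by (cases "t < b") auto
      then show "\<exists>S. finite S \<and> (\<forall>t\<in>{a<..<c} - S. smooth_at \<gamma> t)"
        using S(1) S'(1) by (intro exI[of _ "S \<union> S' \<union> {b}"]) simp
    qed
  next
    fix x :: real assume x: "0 \<le> x" "x \<le> 1"
    have "\<gamma> x \<in> topspace X" using M_curveD(2)[OF \<gamma>, of x] x M_subset by auto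
    then obtain U \<phi> where c: "(U, \<phi>) \<in> \<A>" "\<gamma> x \<in> U" using chart_covers by metis
    have "openin (top_of_set {0..1}) {t \<in> topspace (top_of_set {0..1}). \<gamma> t \<in> U}"
      using M_curveD(1)[OF \<gamma>] chart_openin[OF c(1)] by (rule openin_continuous_map_preimage)
    then have "openin (top_of_set {0..1}) {t \<in> {0..1}. \<gamma> t \<in> U}" by simp
    then obtain T where T: "open T" "{t \<in> {0..1}. \<gamma> t \<in> U} = {0..1} \<inter> T" unfolding openin_open by (elim exE conjE)
    have "x \<in> T" using T(2) x c(2) by auto
    then obtain d where d: "d > 0" "ball x d \<subseteq> T" using T(1) open_contains_ball by metis
    have "P a b" if ab: "a \<le> x" "x \<le> b" "b - a < d" for a b
      unfolding P_def
    proof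
      assume 01: "0 \<le> a \<and> b \<le> 1"
      have "{a..b} \<subseteq> {0..1} \<inter> T"
      proof
        fix t assume t: "t \<in> {a..b}"
        then have "t \<in> ball x d" using ab by (auto simp: dist_real_def)
        then show "t \<in> {0..1} \<inter> T" using d(2) t 01 by auto
      qed
      then have "\<gamma> ` {a..b} \<subseteq> U" using T(2) by blast
      then have "(\<phi> \<circ> \<gamma>) piecewise_C1_differentiable_on {a..b}"
        using ab 01 by (intro M_curveD(3)[OF \<gamma> c(1)]) auto
      then obtain S D where S: "finite S" "continuous_on ({a..b} - S) D"
        "\<forall>t\<in>{a..b} - S. ((\<phi> \<circ> \<gamma>) has_vector_derivative D t) (at t)"
        unfolding piecewise_C1_differentiable_on_def C1_differentiable_on_def by (elim conjE exE)
      have "smooth_at \<gamma> t" if t: "t \<in> {a<..<b} - S" for t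
        unfolding smooth_at_def
      proof (intro exI conjI)
        show "(U, \<phi>) \<in> \<A>" by (rule c)
        show "open ({a<..<b} - S)" using S(1) by (simp add: finite_imp_closed open_Diff)
        show "continuous_on ({a<..<b} - S) D" using S(2) by (rule continuous_on_subset) auto
        show "\<forall>s\<in>{a<..<b} - S. ((\<phi> \<circ> \<gamma>) has_vector_derivative D s) (at s)" using S(3) by simp
        show "\<gamma> ` ({a<..<b} - S) \<subseteq> U" using \<open>\<gamma> ` {a..b} \<subseteq> U\<close> by (rule order_trans[rotated]) (intro image_mono, auto)
      qed (use t 01 in auto)
      then show "\<exists>S. finite S \<and> (\<forall>t\<in>{a<..<b} - S. smooth_at \<gamma> t)" using S(1) by (intro exI[of _ S]) simp
    qed
    then show "\<exists>d>0. \<forall>a b. a \<le> x \<and> x \<le> b \<and> b - a < d \<longrightarrow> P a b" using d(1) by (intro exI[of _ d]) simp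
  qed simp
  then show ?thesis unfolding P_def by simp
qed

lemma smooth_at_form_along:
  assumes \<gamma>: "M_curve \<gamma>" and t: "smooth_at \<gamma> t"
  shows "\<exists>I. open I \<and> t \<in> I \<and> I \<subseteq> {0..1} \<and> continuous_on I (pullback \<gamma>)"
proof -
  obtain U \<phi> I D where I: "(U, \<phi>) \<in> \<A>" "open I" "t \<in> I" "I \<subseteq> {0..1}" "\<gamma> ` I \<subseteq> U" "continuous_on I D"
    "\<forall>s\<in>I. ((\<phi> \<circ> \<gamma>) has_vector_derivative D s) (at s)"
    using t unfolding smooth_at_def by (elim exE conjE)
  have M: "\<gamma> s \<in> M" if "s \<in> I" for s using M_curveD(2)[OF \<gamma>] I(4) that by auto
  have eq: "pullback \<gamma> s = (\<theta> (U, \<phi>) \<circ> inv_into U \<phi>) ((\<phi> \<circ> \<gamma>) s) * D s" if s: "s \<in> I" for s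
    using form_along_chart[OF I(1,2) s I(5) M[OF s] bspec[OF I(7) s]] I(1,5) s by auto
  have c1: "continuous_on I (\<phi> \<circ> \<gamma>)"
    by (intro continuous_at_imp_continuous_on ballI) (rule has_vector_derivative_continuous, rule bspec[OF I(7)])
  have c2: "continuous_on (\<phi> ` (U \<inter> form_domain)) (\<theta> (U, \<phi>) \<circ> inv_into U \<phi>)"
    using form_holomorphic[OF I(1)] by (rule holomorphic_on_imp_continuous_on)
  have "continuous_on I (\<lambda>s. (\<theta> (U, \<phi>) \<circ> inv_into U \<phi>) ((\<phi> \<circ> \<gamma>) s))"
    by (rule continuous_on_compose2[OF c2 c1]) (use I(5) M M_subset_form_domain in auto)
  then have "continuous_on I (\<lambda>s. (\<theta> (U, \<phi>) \<circ> inv_into U \<phi>) ((\<phi> \<circ> \<gamma>) s) * D s)"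
    using I(6) by (rule continuous_on_mult)
  then have "continuous_on I (pullback \<gamma>)"
    by (rule continuous_on_eq) (rule eq[symmetric])
  with I(2-4) show ?thesis by (intro exI[of _ I]) simp
qed

lemma form_along_reparametrize:
  assumes \<gamma>: "M_curve \<gamma>" and sm: "smooth_at \<gamma> (m * t + b)" and J: "open J" "t \<in> J"
    and \<sigma>: "\<And>s. s \<in> J \<Longrightarrow> \<sigma> s = \<gamma> (m * s + b)"
  shows "pullback \<sigma> t = of_real m * pullback \<gamma> (m * t + b)"
proof -
  obtain U \<phi> I D where I: "(U, \<phi>) \<in> \<A>" "open I" "m * t + b \<in> I" "I \<subseteq> {0..1}" "\<gamma> ` I \<subseteq> U"
    "\<forall>s\<in>I. ((\<phi> \<circ> \<gamma>) has_vector_derivative D s) (at s)"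
    using sm unfolding smooth_at_def by (elim exE conjE)
  have tM: "\<gamma> (m * t + b) \<in> M" using M_curveD(2)[OF \<gamma>] I(3,4) by auto
  have f: "pullback \<gamma> (m * t + b) = \<theta> (U, \<phi>) (\<gamma> (m * t + b)) * D (m * t + b)"
    using I by (intro form_along_chart[OF I(1,2,3,5) tM]) auto
  let ?J = "J \<inter> (\<lambda>s. m * s + b) -` I"
  have oJ: "open ?J" using J I(2) by (intro open_Int open_vimage continuous_intros) auto
  have "((\<lambda>s. m * s + b) has_vector_derivative m) (at t)"
    by (auto intro!: derivative_eq_intros simp: has_real_derivative_iff_has_vector_derivative[symmetric])
  then have "(((\<phi> \<circ> \<gamma>) \<circ> (\<lambda>s. m * s + b)) has_vector_derivative m *\<^sub>R D (m * t + b)) (at t)"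
    by (rule vector_diff_chain_at) (use I in auto)
  then have "((\<phi> \<circ> \<sigma>) has_vector_derivative m *\<^sub>R D (m * t + b)) (at t)"
    by (rule has_vector_derivative_transform_within_open[OF _ oJ]) (use J I \<sigma> in auto)
  then have "pullback \<sigma> t = \<theta> (U, \<phi>) (\<sigma> t) * (m *\<^sub>R D (m * t + b))"
    by (rule form_along_chart[OF I(1) oJ, rotated -1]) (use J I \<sigma> tM in auto)
  then show ?thesis using f \<sigma>[OF J(2)] by (simp add: scaleR_conv_of_real)
qed

lemma M_curve_restrict:
  assumes \<gamma>: "M_curve \<gamma>" and u: "0 \<le> u" "u \<le> 1"
  shows "M_curve (\<lambda>s. \<gamma> (u * s))"
proof (rule M_curveI)
  have in01: "u * s \<in> {0..1}" if "s \<in> {0..1}" for s using that u by (auto intro: mult_le_one)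
  have "continuous_map (top_of_set {0..1}) (top_of_set {0..1}) (\<lambda>s. u * s)"
    using in01 by (auto simp: continuous_map_in_subtopology intro!: continuous_intros)
  from continuous_map_compose[OF this M_curveD(1)[OF \<gamma>]]
  show "continuous_map (top_of_set {0..1}) X (\<lambda>s. \<gamma> (u * s))" by (simp add: o_def)
  show "\<gamma> (u * t) \<in> M" if "t \<in> {0..1}" for t by (rule M_curveD(2)[OF \<gamma> in01[OF that]])
  fix U \<phi> a b assume c: "(U, \<phi>) \<in> \<A>" and ab: "0 \<le> a" "a \<le> b" "b \<le> 1" "(\<lambda>s. \<gamma> (u * s)) ` {a..b} \<subseteq> U"
  have im: "(\<lambda>x. u * x + 0) ` {a..b} = {u * a..u * b}"
    using image_affinity_atLeastAtMost[of u 0 a b] u ab(2) by (auto simp: mult_left_mono)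
  have "\<gamma> ` {u * a..u * b} \<subseteq> U" using ab(4) unfolding im[symmetric] by auto
  then have "(\<phi> \<circ> \<gamma>) piecewise_C1_differentiable_on {u * a..u * b}"
    using ab u in01[of b] in01[of a] by (intro M_curveD(3)[OF \<gamma> c]) (auto intro: mult_left_mono)
  then have "((\<phi> \<circ> \<gamma>) \<circ> (\<lambda>x. u *\<^sub>R x + 0)) piecewise_C1_differentiable_on {a..b}"
    by (intro piecewise_C1_differentiable_affine) (simp only: im)
  then show "(\<phi> \<circ> (\<lambda>s. \<gamma> (u * s))) piecewise_C1_differentiable_on {a..b}" by (simp add: o_def)
qed

lemma M_curve_join:
  assumes \<gamma>: "M_curve \<gamma>" and \<nu>: "M_curve \<nu>" and eq: "\<gamma> 1 = \<nu> 0"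
  shows "M_curve (join_curves \<gamma> \<nu>)"
proof (rule M_curveI)
  show "continuous_map (top_of_set {0..1}) X (join_curves \<gamma> \<nu>)"
    unfolding join_curves_def
  proof (rule continuous_map_cases_le)
    have "continuous_map (subtopology (top_of_set {0..1}) {x \<in> topspace (top_of_set {0..1}). x \<le> 1 / 2}) (top_of_set {0..1}) (\<lambda>s. 2 * s :: real)"
      by (auto simp: continuous_map_in_subtopology subtopology_subtopology intro!: continuous_intros)
    from continuous_map_compose[OF this M_curveD(1)[OF \<gamma>]]
    show "continuous_map (subtopology (top_of_set {0..1}) {x \<in> topspace (top_of_set {0..1}). x \<le> 1 / 2}) X (\<lambda>s. \<gamma> (2 * s))"
      by (simp add: o_def)
    have "continuous_map (subtopology (top_of_set {0..1}) {x \<in> topspace (top_of_set {0..1}). 1 / 2 \<le> x}) (top_of_set {0..1}) (\<lambda>s. 2 * s - 1 :: real)"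
      by (auto simp: continuous_map_in_subtopology subtopology_subtopology intro!: continuous_intros)
    from continuous_map_compose[OF this M_curveD(1)[OF \<nu>]]
    show "continuous_map (subtopology (top_of_set {0..1}) {x \<in> topspace (top_of_set {0..1}). 1 / 2 \<le> x}) X (\<lambda>s. \<nu> (2 * s - 1))"
      by (simp add: o_def)
    show "\<gamma> (2 * s) = \<nu> (2 * s - 1)" if "s = 1 / 2" for s unfolding that using eq by simp
  qed auto
  show "join_curves \<gamma> \<nu> t \<in> M" if "t \<in> {0..1}" for t
    using that M_curveD(2)[OF \<gamma>] M_curveD(2)[OF \<nu>] unfolding join_curves_def by auto
  fix U \<phi> a b assume c: "(U, \<phi>) \<in> \<A>" and ab: "0 \<le> a" "a \<le> b" "b \<le> 1" "join_curves \<gamma> \<nu> ` {a..b} \<subseteq> U"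
  define F where "F = (\<phi> \<circ> \<gamma>) \<circ> (\<lambda>x. 2 *\<^sub>R x + 0)"
  define G where "G = (\<phi> \<circ> \<nu>) \<circ> (\<lambda>x. 2 *\<^sub>R x + (- 1))"
  have U: "join_curves \<gamma> \<nu> s \<in> U" if "a \<le> s" "s \<le> b" for s using ab(4) that by auto
  have F: "F piecewise_C1_differentiable_on {a'..b'}" if "a \<le> a'" "a' \<le> b'" "b' \<le> b" "b' \<le> 1 / 2" for a' b'
  proof -
    have im: "(\<lambda>x. 2 * x + 0) ` {a'..b'} = {2 * a'..2 * b'}"
      using image_affinity_atLeastAtMost[of 2 0 a' b'] that(2) by auto
    have "\<gamma> ` {2 * a'..2 * b'} \<subseteq> U"
      unfolding im[symmetric]
    proof clarify
      fix s assume "s \<in> {a'..b'}"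
      then show "\<gamma> (2 * s + 0) \<in> U" using U[of s] that unfolding join_curves_def by simp
    qed
    then have "(\<phi> \<circ> \<gamma>) piecewise_C1_differentiable_on {2 * a'..2 * b'}"
      using ab that by (intro M_curveD(3)[OF \<gamma> c]) auto
    then show ?thesis unfolding F_def by (intro piecewise_C1_differentiable_affine) (simp only: im)
  qed
  have G: "G piecewise_C1_differentiable_on {a'..b'}" if "a \<le> a'" "a' \<le> b'" "b' \<le> b" "1 / 2 \<le> a'" for a' b'
  proof -
    have im: "(\<lambda>x. 2 * x + (- 1)) ` {a'..b'} = {2 * a' - 1..2 * b' - 1}"
      using image_affinity_atLeastAtMost[of 2 "- 1" a' b'] that(2) by auto
    have "\<nu> ` {2 * a' - 1..2 * b' - 1} \<subseteq> U"
      unfolding im[symmetric]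
    proof clarify
      fix s assume s: "s \<in> {a'..b'}"
      show "\<nu> (2 * s + (- 1)) \<in> U"
      proof (cases "s = 1 / 2")
        case True
        have "\<gamma> 1 \<in> U" using U[of s] s that unfolding join_curves_def True by simp
        then show ?thesis unfolding True using eq by simp
      next
        case False
        then show ?thesis using U[of s] s that unfolding join_curves_def by (auto split: if_splits)
      qed
    qed
    then have "(\<phi> \<circ> \<nu>) piecewise_C1_differentiable_on {2 * a' - 1..2 * b' - 1}"
      using ab that by (intro M_curveD(3)[OF \<nu> c]) auto
    then show ?thesis unfolding G_def by (intro piecewise_C1_differentiable_affine) (simp only: im)
  qed
  have FG: "F (1 / 2) = G (1 / 2)" unfolding F_def G_def using eq by simp
  have J: "(\<phi> \<circ> join_curves \<gamma> \<nu>) s = (if s \<le> 1 / 2 then F s else G s)" for s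
    by (simp add: F_def G_def join_curves_def)
  consider "b \<le> 1 / 2" | "1 / 2 \<le> a" | "a \<le> 1 / 2" "1 / 2 \<le> b" by linarith
  then show "(\<phi> \<circ> join_curves \<gamma> \<nu>) piecewise_C1_differentiable_on {a..b}"
  proof cases
    case 1
    then show ?thesis by (intro piecewise_C1_cong[OF F[of a b]]) (use J ab in auto)
  next
    case 2
    have "G x = (\<phi> \<circ> join_curves \<gamma> \<nu>) x" if "x \<in> {a..b}" for x
    proof (cases "x = 1 / 2")
      case True
      show ?thesis unfolding True using J[of "1 / 2"] FG by simp
    next
      case False
      then show ?thesis using J[of x] 2 that by auto
    qed
    with 2 show ?thesis by (intro piecewise_C1_cong[OF G[of a b]]) (use ab in auto)
  next
    case 3
    then have "(\<lambda>x. if x \<le> 1 / 2 then F x else G x) piecewise_C1_differentiable_on {a..b}"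
      using FG by (intro piecewise_C1_differentiable_cases F G) auto
    then show ?thesis by (rule piecewise_C1_cong) (rule J[symmetric])
  qed
qed

text \<open>The bound \<open>C\<close> is a bound for the speed, measured by the form, of a curve parametrized by \<open>{0..1}\<close>.\<close>

definition joined :: "real \<Rightarrow> 'a \<Rightarrow> 'a \<Rightarrow> bool" where
  "joined C x y \<longleftrightarrow> (\<exists>\<nu>. M_curve \<nu> \<and> \<nu> 0 = x \<and> \<nu> 1 = y \<and>
     (\<exists>S. finite S \<and> (\<forall>t\<in>{0<..<1} - S. norm (pullback \<nu> t) \<le> C)))"

lemma form_along_join:
  assumes \<gamma>: "M_curve \<gamma>" and \<nu>: "M_curve \<nu>"
  shows "0 < t \<Longrightarrow> t < 1 / 2 \<Longrightarrow> smooth_at \<gamma> (2 * t) \<Longrightarrow>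
      pullback (join_curves \<gamma> \<nu>) t = 2 * pullback \<gamma> (2 * t)"
    and "1 / 2 < t \<Longrightarrow> t < 1 \<Longrightarrow> smooth_at \<nu> (2 * t - 1) \<Longrightarrow>
      pullback (join_curves \<gamma> \<nu>) t = 2 * pullback \<nu> (2 * t - 1)"
proof -
  show "pullback (join_curves \<gamma> \<nu>) t = 2 * pullback \<gamma> (2 * t)"
    if "0 < t" "t < 1 / 2" "smooth_at \<gamma> (2 * t)"
    using form_along_reparametrize[OF \<gamma>, of 2 t 0 "{0<..<1/2}" "join_curves \<gamma> \<nu>"] that
    by (auto simp: join_curves_def)
  show "pullback (join_curves \<gamma> \<nu>) t = 2 * pullback \<nu> (2 * t - 1)"
    if "1 / 2 < t" "t < 1" "smooth_at \<nu> (2 * t - 1)"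
    using form_along_reparametrize[OF \<nu>, of 2 t "- 1" "{1/2<..<1}" "join_curves \<gamma> \<nu>"] that
    by (auto simp: join_curves_def)
qed

lemma joined_mono: "joined C x y \<Longrightarrow> C \<le> C' \<Longrightarrow> joined C' x y"
proof -
  assume C: "C \<le> C'" and "joined C x y"
  then obtain \<nu> S where \<nu>: "M_curve \<nu>" "\<nu> 0 = x" "\<nu> 1 = y" "finite S"
    "\<forall>t\<in>{0<..<1} - S. norm (pullback \<nu> t) \<le> C"
    unfolding joined_def by (elim exE conjE)
  then have "\<forall>t\<in>{0<..<1} - S. norm (pullback \<nu> t) \<le> C'" using C by force
  with \<nu>(1-4) show ?thesis
    unfolding joined_def by (intro exI[of _ \<nu>] conjI exI[of _ S])
qed

text \<open>The factor 2 is the double speed at which both curves are traversed.\<close>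

lemma joined_trans:
  assumes "joined C x y" "joined C' y z"
  shows "joined (2 * max C C') x z"
proof -
  obtain \<gamma> S where \<gamma>: "M_curve \<gamma>" "\<gamma> 0 = x" "\<gamma> 1 = y" "finite S" "\<forall>t\<in>{0<..<1} - S. norm (pullback \<gamma> t) \<le> C"
    using assms(1) unfolding joined_def by (elim exE conjE)
  obtain \<nu> S' where \<nu>: "M_curve \<nu>" "\<nu> 0 = y" "\<nu> 1 = z" "finite S'" "\<forall>t\<in>{0<..<1} - S'. norm (pullback \<nu> t) \<le> C'"
    using assms(2) unfolding joined_def by (elim exE conjE)
  obtain T where T: "finite T" "\<forall>t\<in>{0<..<1} - T. smooth_at \<gamma> t"
    using smooth_at_finite_exceptions[OF \<gamma>(1)] by (elim exE conjE)
  obtain T' where T': "finite T'" "\<forall>t\<in>{0<..<1} - T'. smooth_at \<nu> t"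
    using smooth_at_finite_exceptions[OF \<nu>(1)] by (elim exE conjE)
  let ?j = "join_curves \<gamma> \<nu>"
  let ?E = "(\<lambda>t. t / 2) ` (S \<union> T) \<union> (\<lambda>t. (t + 1) / 2) ` (S' \<union> T') \<union> {1/2}"
  have bd: "norm (pullback ?j t) \<le> 2 * max C C'" if t: "t \<in> {0<..<1} - ?E" for t
  proof -
    have t': "t \<noteq> 1 / 2" "2 * t \<notin> S" "2 * t \<notin> T" "2 * t - 1 \<notin> S'" "2 * t - 1 \<notin> T'"
    proof -
      have n: "t \<notin> (\<lambda>t. t / 2) ` (S \<union> T)" "t \<notin> (\<lambda>t. (t + 1) / 2) ` (S' \<union> T')" "t \<noteq> 1 / 2"
        using t by (simp_all only: Diff_iff Un_iff insert_iff de_Morgan_disj not_False_eq_True)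
      have "2 * t \<notin> S \<union> T"
      proof
        assume "2 * t \<in> S \<union> T"
        then have "t \<in> (\<lambda>t. t / 2) ` (S \<union> T)" by (intro image_eqI[of _ _ "2 * t"]) simp
        with n(1) show False by (rule notE)
      qed
      moreover have "2 * t - 1 \<notin> S' \<union> T'"
      proof
        assume "2 * t - 1 \<in> S' \<union> T'"
        then have "t \<in> (\<lambda>t. (t + 1) / 2) ` (S' \<union> T')" by (intro image_eqI[of _ _ "2 * t - 1"]) simp
        with n(2) show False by (rule notE)
      qed
      ultimately show "t \<noteq> 1 / 2" "2 * t \<notin> S" "2 * t \<notin> T" "2 * t - 1 \<notin> S'" "2 * t - 1 \<notin> T'"
        using n(3) by simp_all
    qed
    show ?thesis
    proof (cases "t < 1 / 2")
      case True
      then have "pullback ?j t = 2 * pullback \<gamma> (2 * t)"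
        using t t' T(2) by (intro form_along_join(1)[OF \<gamma>(1) \<nu>(1)]) auto
      moreover have "norm (pullback \<gamma> (2 * t)) \<le> C" using \<gamma>(5) True t t' by auto
      ultimately show ?thesis by (simp add: norm_mult)
    next
      case False
      then have "pullback ?j t = 2 * pullback \<nu> (2 * t - 1)"
        using t t' T'(2) by (intro form_along_join(2)[OF \<gamma>(1) \<nu>(1)]) auto
      moreover have "norm (pullback \<nu> (2 * t - 1)) \<le> C'" using \<nu>(5) False t t' by auto
      ultimately show ?thesis by (simp add: norm_mult)
    qed
  qed
  have "finite ?E" using \<gamma>(4) \<nu>(4) T(1) T'(1) by simp
  moreover have "?j 0 = x" "?j 1 = z" using \<gamma>(2) \<nu>(3) by (simp_all add: join_curves_def)
  moreover have "M_curve ?j" using \<gamma>(1,3) \<nu>(1,2) by (intro M_curve_join) simp_all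
  ultimately show ?thesis
    unfolding joined_def using bd by (intro exI[of _ ?j] conjI exI[of _ ?E] ballI)
qed

text \<open>In the given chart the speed of a segment is constant; in any other chart the segment is composed with
  a holomorphic transition map and remains continuously differentiable.\<close>

lemma joined_segment:
  assumes c: "(U, \<phi>) \<in> \<A>" and pq: "closed_segment p q \<subseteq> \<phi> ` (U \<inter> M)"
    and B: "\<And>z. z \<in> closed_segment p q \<Longrightarrow> norm (\<theta> (U, \<phi>) (inv_into U \<phi> z)) \<le> B"
  shows "joined (B * norm (q - p)) (inv_into U \<phi> p) (inv_into U \<phi> q)"
proof -
  define \<nu> where "\<nu> s = inv_into U \<phi> (linepath p q s)" for s
  have seg: "linepath p q s \<in> closed_segment p q" if "s \<in> {0..1}" for s
    using linepath_in_path that by simp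
  have inU: "\<nu> s \<in> U" "\<nu> s \<in> M" "\<phi> (\<nu> s) = linepath p q s" if s: "s \<in> {0..1}" for s
  proof -
    have "linepath p q s \<in> \<phi> ` (U \<inter> M)" using seg[OF s] pq by blast
    then obtain x where "linepath p q s = \<phi> x" "x \<in> U" "x \<in> M" by blast
    then show "\<nu> s \<in> U" "\<nu> s \<in> M" "\<phi> (\<nu> s) = linepath p q s" unfolding \<nu>_def using c by auto
  qed
  have "M_curve \<nu>"
  proof (rule M_curveI)
    have "continuous_map (top_of_set {0..1}) (top_of_set (\<phi> ` U)) (linepath p q)"
      using seg pq by (fastforce simp: continuous_map_in_subtopology)
    from continuous_map_compose[OF this chart_inv_continuous[OF c]]
    show "continuous_map (top_of_set {0..1}) X \<nu>" by (simp add: o_def \<nu>_def[abs_def])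
  next
    fix V \<psi> a b assume V: "(V, \<psi>) \<in> \<A>" and ab: "0 \<le> a" "a \<le> b" "b \<le> 1" "\<nu> ` {a..b} \<subseteq> V"
    let ?\<tau> = "\<psi> \<circ> inv_into U \<phi>"
    have UV: "linepath p q s \<in> \<phi> ` (U \<inter> V)" if "s \<in> {a..b}" for s
    proof -
      have "s \<in> {0..1}" "\<nu> s \<in> V" using that ab by auto
      then show ?thesis using inU[of s] by (intro image_eqI[of _ _ "\<nu> s"]) auto
    qed
    have o: "open (\<phi> ` (U \<inter> V))"
      using chart_openin[OF c] chart_openin[OF V] by (intro chart_open_image[OF c]) auto
    have "((?\<tau> \<circ> linepath p q) has_vector_derivative (q - p) * deriv ?\<tau> (linepath p q s)) (at s)"
      if "s \<in> {a..b}" for s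
      by (rule field_vector_diff_chain_at[OF has_vector_derivative_linepath_within])
        (rule holomorphic_derivI[OF transition_holomorphic[OF c V] o UV[OF that]])
    moreover have "continuous_on {a..b} (\<lambda>s. (q - p) * deriv ?\<tau> (linepath p q s))"
    proof (intro continuous_on_mult continuous_on_const)
      have "continuous_on (\<phi> ` (U \<inter> V)) (deriv ?\<tau>)"
        using holomorphic_deriv[OF transition_holomorphic[OF c V] o] by (rule holomorphic_on_imp_continuous_on)
      then show "continuous_on {a..b} (\<lambda>s. deriv ?\<tau> (linepath p q s))"
        by (rule continuous_on_compose2) (use UV in \<open>auto intro: continuous_intros\<close>)
    qed
    ultimately have "(?\<tau> \<circ> linepath p q) C1_differentiable_on {a..b}"
      unfolding C1_differentiable_on_def by (intro exI conjI ballI)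
    then have "(?\<tau> \<circ> linepath p q) piecewise_C1_differentiable_on {a..b}"
      by (rule C1_differentiable_imp_piecewise)
    moreover have "?\<tau> \<circ> linepath p q = \<psi> \<circ> \<nu>" by (simp add: fun_eq_iff \<nu>_def)
    ultimately show "(\<psi> \<circ> \<nu>) piecewise_C1_differentiable_on {a..b}" by simp
  qed (rule inU)
  moreover have "norm (pullback \<nu> t) \<le> B * norm (q - p)" if t: "t \<in> {0<..<1} - {}" for t
  proof -
    have d: "((\<phi> \<circ> \<nu>) has_vector_derivative (q - p)) (at t)"
      by (rule has_vector_derivative_transform_within_open[OF has_vector_derivative_linepath_within
            open_greaterThanLessThan[of 0 1]])
        (use t inU(3) in auto)
    have "pullback \<nu> t = \<theta> (U, \<phi>) (\<nu> t) * (q - p)"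
      by (rule form_along_chart[OF c _ _ _ _ d, where I = "{0<..<1}"]) (use t inU in auto)
    then show ?thesis using B[OF seg[of t]] t by (auto simp: norm_mult \<nu>_def intro!: mult_right_mono)
  qed
  ultimately show ?thesis
    unfolding joined_def by (intro exI[of _ \<nu>] conjI exI[of _ "{}"] ballI) (simp_all add: \<nu>_def linepath_def)
qed

end

section \<open>Joining points by curves of bounded speed\<close>

text \<open>The derivative stays within \<open>1/2\<close> of \<open>1\<close>. By the mean value inequality the curve advances in the real
  direction by at least half the increment of the parameter and moves in the imaginary direction by at most
  half of it. Hence it is a graph over the real axis, with Lipschitz constant 1.\<close>

lemma curve_is_graph:
  fixes \<sigma> :: "real \<Rightarrow> complex"
  assumes \<eta>: "\<eta> > 0" and \<sigma>0: "\<sigma> t0 = 0"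
    and d: "\<And>t. t \<in> {t0 - \<eta>..t0 + \<eta>} \<Longrightarrow> (\<sigma> has_vector_derivative \<delta> t) (at t)"
    and \<delta>: "\<And>t. t \<in> {t0 - \<eta>..t0 + \<eta>} \<Longrightarrow> norm (\<delta> t - 1) \<le> 1 / 2"
  shows "\<exists>g. continuous_on {-(\<eta>/2)<..<\<eta>/2} g \<and> (\<forall>s. \<bar>s\<bar> < \<eta>/2 \<longrightarrow> \<bar>g s\<bar> \<le> \<bar>s\<bar>) \<and>
    (\<forall>s. \<bar>s\<bar> < \<eta>/2 \<longrightarrow> (\<exists>t\<in>{t0 - \<eta><..<t0 + \<eta>}. \<sigma> t = Complex s (g s))) \<and>
    (\<forall>t\<in>{t0 - \<eta><..<t0 + \<eta>}. \<bar>Re (\<sigma> t)\<bar> < \<eta>/2 \<longrightarrow> Im (\<sigma> t) = g (Re (\<sigma> t)))"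
proof -
  let ?I = "{t0 - \<eta>..t0 + \<eta>}"
  have bd: "norm (\<sigma> t - \<sigma> s - of_real (t - s)) \<le> \<bar>t - s\<bar> / 2" if "s \<in> ?I" "t \<in> ?I" for s t
  proof -
    have dd: "((\<lambda>t. \<sigma> t - of_real t) has_derivative (\<lambda>h. h *\<^sub>R (\<delta> u - 1))) (at u within ?I)" if "u \<in> ?I" for u
    proof -
      have "((\<lambda>t. \<sigma> t - of_real t) has_vector_derivative (\<delta> u - 1)) (at u)"
        using d[OF that] by (intro has_vector_derivative_diff) (auto intro!: derivative_eq_intros)
      then show ?thesis unfolding has_vector_derivative_def by (rule has_derivative_at_withinI)
    qed
    have "onorm (\<lambda>h. h *\<^sub>R (\<delta> u - 1)) \<le> 1 / 2" if "u \<in> ?I" for u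
    proof (rule onorm_bound)
      fix h :: real
      show "norm (h *\<^sub>R (\<delta> u - 1)) \<le> 1 / 2 * norm h"
        using mult_left_mono[OF \<delta>[OF that], of "\<bar>h\<bar>"] by simp
    qed simp
    from differentiable_bound[OF _ dd this that(1,2)]
    have "norm ((\<sigma> t - of_real t) - (\<sigma> s - of_real s)) \<le> 1 / 2 * norm (t - s)" by (simp add: norm_minus_commute)
    then show ?thesis by (simp add: algebra_simps)
  qed
  have re: "Re (\<sigma> t) - Re (\<sigma> s) \<ge> (t - s) / 2" if "s \<in> ?I" "t \<in> ?I" "s \<le> t" for s t
    using abs_Re_le_cmod[of "\<sigma> t - \<sigma> s - of_real (t - s)"] bd[OF that(1,2)] that(3) by (simp add: abs_le_iff)
  have im: "\<bar>Im (\<sigma> t) - Im (\<sigma> s)\<bar> \<le> \<bar>t - s\<bar> / 2" if "s \<in> ?I" "t \<in> ?I" for s t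
    using abs_Im_le_cmod[of "\<sigma> t - \<sigma> s - of_real (t - s)"] bd[OF that] by simp
  have re': "\<bar>Re (\<sigma> t) - Re (\<sigma> s)\<bar> \<ge> \<bar>t - s\<bar> / 2" if "s \<in> ?I" "t \<in> ?I" for s t
    using re[OF that] re[OF that(2,1)] by (cases "s \<le> t") auto
  have t0: "t0 \<in> ?I" using \<eta> by simp
  have cont: "continuous_on ?I (\<lambda>t. Re (\<sigma> t))"
    using d by (intro continuous_on_Re continuous_at_imp_continuous_on ballI) (rule has_vector_derivative_continuous)
  have ex: "\<exists>t\<in>{t0 - \<eta><..<t0 + \<eta>}. Re (\<sigma> t) = s" if s: "\<bar>s\<bar> < \<eta>/2" for s
  proof -
    have 1: "Re (\<sigma> (t0 - \<eta>)) \<le> - (\<eta>/2)" using re[of "t0 - \<eta>" t0] \<sigma>0 \<eta> by simp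
    have 2: "\<eta>/2 \<le> Re (\<sigma> (t0 + \<eta>))" using re[of t0 "t0 + \<eta>"] \<sigma>0 \<eta> by simp
    have "\<exists>t\<ge>t0 - \<eta>. t \<le> t0 + \<eta> \<and> Re (\<sigma> t) = s"
      using 1 2 s \<eta> cont by (intro IVT') auto
    then obtain t where t: "t0 - \<eta> \<le> t" "t \<le> t0 + \<eta>" "Re (\<sigma> t) = s" by (elim exE conjE)
    moreover have "t \<noteq> t0 - \<eta>" "t \<noteq> t0 + \<eta>" using 1 2 s t(3) by auto
    ultimately show ?thesis by (intro bexI[of _ t]) auto
  qed
  then have "\<forall>s\<in>{s. \<bar>s\<bar> < \<eta>/2}. \<exists>t. t \<in> {t0 - \<eta><..<t0 + \<eta>} \<and> Re (\<sigma> t) = s" by blast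
  then obtain \<tau> where \<tau>: "\<forall>s\<in>{s. \<bar>s\<bar> < \<eta>/2}. \<tau> s \<in> {t0 - \<eta><..<t0 + \<eta>} \<and> Re (\<sigma> (\<tau> s)) = s"
    by (rule bchoice[elim_format]) (elim exE)
  define g where "g s = Im (\<sigma> (\<tau> s))" for s
  have \<tau>I: "\<tau> s \<in> ?I" "Re (\<sigma> (\<tau> s)) = s" "\<tau> s \<in> {t0 - \<eta><..<t0 + \<eta>}" if "\<bar>s\<bar> < \<eta>/2" for s using \<tau> that by auto
  have lip: "\<bar>g s - g s'\<bar> \<le> \<bar>s - s'\<bar>" if "\<bar>s\<bar> < \<eta>/2" "\<bar>s'\<bar> < \<eta>/2" for s s'
    using im[OF \<tau>I(1)[OF that(2)] \<tau>I(1)[OF that(1)]] re'[OF \<tau>I(1)[OF that(2)] \<tau>I(1)[OF that(1)]]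
      \<tau>I(2)[OF that(1)] \<tau>I(2)[OF that(2)] unfolding g_def by simp
  have "continuous_on {-(\<eta>/2)<..<\<eta>/2} g"
    unfolding continuous_on_iff
  proof (intro ballI allI impI)
    fix s e :: real assume "s \<in> {-(\<eta>/2)<..<\<eta>/2}" "0 < e"
    then have s: "\<bar>s\<bar> < \<eta>/2" by (auto simp: abs_less_iff)
    have "dist (g s') (g s) < e" if "s' \<in> {-(\<eta>/2)<..<\<eta>/2}" "dist s' s < e" for s'
    proof -
      have "\<bar>s'\<bar> < \<eta>/2" using that(1) by (auto simp: abs_less_iff)
      from lip[OF this s] that(2) show ?thesis by (simp add: dist_real_def)
    qed
    then show "\<exists>d>0. \<forall>s'\<in>{-(\<eta>/2)<..<\<eta>/2}. dist s' s < d \<longrightarrow> dist (g s') (g s) < e"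
      using \<open>0 < e\<close> by (intro exI[of _ e]) simp
  qed
  moreover have "\<bar>g s\<bar> \<le> \<bar>s\<bar>" if "\<bar>s\<bar> < \<eta>/2" for s
    using im[OF t0 \<tau>I(1)[OF that]] re'[OF t0 \<tau>I(1)[OF that]] \<tau>I(2)[OF that] \<sigma>0 unfolding g_def by simp
  moreover have "\<exists>t\<in>{t0 - \<eta><..<t0 + \<eta>}. \<sigma> t = Complex s (g s)" if "\<bar>s\<bar> < \<eta>/2" for s
    using \<tau>I(2,3)[OF that] by (intro bexI[of _ "\<tau> s"]) (auto simp: g_def complex_eq_iff)
  moreover have "Im (\<sigma> t) = g (Re (\<sigma> t))" if t: "t \<in> {t0 - \<eta><..<t0 + \<eta>}" "\<bar>Re (\<sigma> t)\<bar> < \<eta>/2" for t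
  proof -
    have "\<bar>t - \<tau> (Re (\<sigma> t))\<bar> / 2 \<le> 0"
      using re'[of "\<tau> (Re (\<sigma> t))" t] \<tau>I[OF t(2)] t(1) by auto
    then have "t = \<tau> (Re (\<sigma> t))" by simp
    then show ?thesis unfolding g_def by metis
  qed
  ultimately show ?thesis by (intro exI[of _ g] conjI allI impI ballI)
qed

definition rectangle :: "real \<Rightarrow> complex set" where
  "rectangle a = {w. \<bar>Re w\<bar> < a \<and> \<bar>Im w\<bar> < 2 * a}"

lemma convex_rectangle: "convex (rectangle a)"
proof -
  have "rectangle a = {w. Re w < a} \<inter> {w. Re w > - a} \<inter> {w. Im w < 2 * a} \<inter> {w. Im w > - (2 * a)}"
    by (auto simp: rectangle_def)
  then show ?thesis
    by (simp add: convex_Int convex_halfspace_Re_lt convex_halfspace_Re_gt convex_halfspace_Im_lt convex_halfspace_Im_gt)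
qed

lemma open_rectangle: "open (rectangle a)"
proof -
  have "rectangle a = {w. Re w < a} \<inter> {w. Re w > - a} \<inter> {w. Im w < 2 * a} \<inter> {w. Im w > - (2 * a)}"
    by (auto simp: rectangle_def)
  then show ?thesis
    by (simp add: open_Int open_halfspace_Re_lt open_halfspace_Re_gt open_halfspace_Im_lt open_halfspace_Im_gt)
qed

lemma norm_rectangle: "w \<in> rectangle a \<Longrightarrow> norm w \<le> 3 * a"
  using cmod_le[of w] by (auto simp: rectangle_def)

text \<open>The side is parametrized by a product of intervals: the second parameter divides the vertical distance
  from the graph to the edge of the rectangle.\<close>

lemma connected_side_of_graph:
  assumes a: "a > 0" and g: "continuous_on {-a<..<a} g" "\<And>s. \<bar>s\<bar> < a \<Longrightarrow> \<bar>g s\<bar> \<le> a" and \<sigma>: "\<sigma> = 1 \<or> \<sigma> = -1"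
  shows "connected {w \<in> rectangle a. \<sigma> * (Im w - g (Re w)) > 0}"
proof -
  define F where "F p = Complex (fst p) ((1 - snd p) * g (fst p) + snd p * (2 * a * \<sigma>))" for p :: "real \<times> real"
  have "continuous_on ({-a<..<a} \<times> {0<..<1}) (\<lambda>p. g (fst p))"
    by (rule continuous_on_compose2[OF g(1)]) (auto intro: continuous_intros)
  then have "continuous_on ({-a<..<a} \<times> {0<..<1}) F"
    unfolding F_def by (intro continuous_intros)
  moreover have "connected ({-a<..<a} \<times> {0<..<1::real})"
    by (intro connected_Times connected_Ioo)
  ultimately have "connected (F ` ({-a<..<a} \<times> {0<..<1}))" by (rule connected_continuous_image)
  moreover have "F ` ({-a<..<a} \<times> {0<..<1}) = {w \<in> rectangle a. \<sigma> * (Im w - g (Re w)) > 0}"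
  proof (intro equalityI subsetI)
    fix w assume "w \<in> F ` ({-a<..<a} \<times> {0<..<1})"
    then obtain s u where su: "-a < s" "s < a" "0 < u" "u < 1" "w = F (s, u)" by auto
    have gs: "\<bar>g s\<bar> \<le> a" using g(2)[of s] su by simp
    have Re: "Re w = s" and Im: "Im w = (1 - u) * g s + u * (2 * a * \<sigma>)" using su(5) by (simp_all add: F_def)
    have "\<bar>Im w\<bar> \<le> (1 - u) * \<bar>g s\<bar> + u * (2 * a)"
      unfolding Im using \<sigma> su a by (intro order_trans[OF abs_triangle_ineq]) (auto simp: abs_mult)
    also have "\<dots> \<le> (1 - u) * a + u * (2 * a)" using gs su by (intro add_mono mult_left_mono) auto
    also have "\<dots> = a + u * a" by (simp add: algebra_simps)
    also have "\<dots> < 2 * a" using su a by simp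
    finally have "\<bar>Im w\<bar> < 2 * a" .
    moreover have "\<sigma> * (Im w - g (Re w)) = u * (2 * a - \<sigma> * g s)"
      unfolding Re Im using \<sigma> by (auto simp: algebra_simps)
    moreover have "2 * a - \<sigma> * g s > 0" using gs \<sigma> a by auto
    ultimately show "w \<in> {w \<in> rectangle a. \<sigma> * (Im w - g (Re w)) > 0}"
      using su Re by (simp add: rectangle_def abs_less_iff)
  next
    fix w assume w: "w \<in> {w \<in> rectangle a. \<sigma> * (Im w - g (Re w)) > 0}"
    then have Re: "\<bar>Re w\<bar> < a" and Im: "\<bar>Im w\<bar> < 2 * a" and pos: "\<sigma> * (Im w - g (Re w)) > 0"
      by (auto simp: rectangle_def)
    have gs: "\<bar>g (Re w)\<bar> \<le> a" using g(2) Re by simp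
    define q where "q = 2 * a * \<sigma> - g (Re w)"
    have q: "\<sigma> * q > 0" using gs \<sigma> a by (auto simp: q_def)
    define u where "u = (Im w - g (Re w)) / q"
    have qn: "q \<noteq> 0" using q by auto
    have u: "0 < u" "u < 1"
      using \<sigma> pos q Im by (auto simp: u_def q_def field_simps)
    have uq: "u * q = Im w - g (Re w)" using qn by (simp add: u_def)
    have "(1 - u) * g (Re w) + u * (2 * a * \<sigma>) = g (Re w) + u * q" by (simp add: q_def algebra_simps)
    then have "F (Re w, u) = w" using uq by (simp add: F_def complex_eq_iff)
    moreover have "(Re w, u) \<in> {-a<..<a} \<times> {0<..<1}" using Re u by auto
    ultimately show "w \<in> F ` ({-a<..<a} \<times> {0<..<1})" by (metis imageI)
  qed
  ultimately show ?thesis by simp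
qed

text \<open>Away from the graph to the level \<open>3/2 * a\<close>, along this level, and back. The level lies between the
  graph, where \<open>\<bar>g\<bar> \<le> a\<close>, and the edge of the rectangle, at height \<open>2 * a\<close>; the sign \<open>\<sigma>\<close> selects the side.\<close>

lemma segments_in_side_of_graph:
  assumes a: "a > 0" and g: "\<And>s. \<bar>s\<bar> < a \<Longrightarrow> \<bar>g s\<bar> \<le> a" and \<sigma>: "\<sigma> = 1 \<or> \<sigma> = -1"
    and Q: "Q = {w \<in> rectangle a. \<sigma> * (Im w - g (Re w)) \<ge> 0}" and b: "b \<in> Q" "b' \<in> Q"
  shows "\<exists>w w'. closed_segment b w \<subseteq> Q \<and> closed_segment w w' \<subseteq> Q \<and> closed_segment w' b' \<subseteq> Q"
proof -
  define top where "top b = Complex (Re b) (\<sigma> * (3 / 2 * a))" for b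
  have top: "closed_segment b (top b) \<subseteq> Q" "top b \<in> rectangle a" if "b \<in> Q" for b
  proof -
    have bR: "b \<in> rectangle a" and pos: "\<sigma> * (Im b - g (Re b)) \<ge> 0" using that Q by auto
    then show tR: "top b \<in> rectangle a" using a \<sigma> by (auto simp: rectangle_def top_def)
    have gb: "\<bar>g (Re b)\<bar> \<le> a" using bR g by (simp add: rectangle_def)
    show "closed_segment b (top b) \<subseteq> Q"
    proof
      fix z assume z: "z \<in> closed_segment b (top b)"
      have zR: "z \<in> rectangle a"
        using closed_segment_subset[OF bR tR convex_rectangle] z by blast
      obtain u where u: "0 \<le> u" "u \<le> 1" "z = (1 - u) *\<^sub>R b + u *\<^sub>R top b"
        using z unfolding closed_segment_def by auto
      have "Re z = (1 - u) * Re b + u * Re b" using u(3) by (simp add: top_def)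
      then have Re: "Re z = Re b" by (simp add: algebra_simps)
      have Im: "Im z = (1 - u) * Im b + u * (\<sigma> * (3 / 2 * a))" using u(3) by (simp add: top_def)
      have "\<sigma> * (Im z - g (Re z)) = (1 - u) * (\<sigma> * (Im b - g (Re b))) + u * (3 / 2 * a - \<sigma> * g (Re b))"
        unfolding Re Im using \<sigma> by (auto simp: algebra_simps)
      also have "\<dots> \<ge> 0"
      proof -
        have "3 / 2 * a - \<sigma> * g (Re b) \<ge> 0" using gb \<sigma> a by auto
        then show ?thesis
          using u by (intro add_nonneg_nonneg[OF mult_nonneg_nonneg[OF _ pos] mult_nonneg_nonneg]) simp_all
      qed
      finally show "z \<in> Q" using zR Q by simp
    qed
  qed
  have mid: "closed_segment (top b) (top b') \<subseteq> Q"
  proof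
    fix z assume z: "z \<in> closed_segment (top b) (top b')"
    have zR: "z \<in> rectangle a"
      using closed_segment_subset[OF top(2)[OF b(1)] top(2)[OF b(2)] convex_rectangle] z by blast
    obtain u where u: "0 \<le> u" "u \<le> 1" "z = (1 - u) *\<^sub>R top b + u *\<^sub>R top b'"
      using z unfolding closed_segment_def by auto
    have id: "(1 - u) * y + u * y = y" for y :: real by (simp add: algebra_simps)
    have "Im z = (1 - u) * (\<sigma> * (3 / 2 * a)) + u * (\<sigma> * (3 / 2 * a))" using u(3) by (simp add: top_def)
    then have Im: "Im z = \<sigma> * (3 / 2 * a)" unfolding id .
    have "\<bar>g (Re z)\<bar> \<le> a" using zR g by (simp add: rectangle_def)
    then have "\<sigma> * (Im z - g (Re z)) \<ge> 0" unfolding Im using \<sigma> a by auto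
    then show "z \<in> Q" using zR Q by simp
  qed
  show ?thesis
    using top(1)[OF b(1)] mid top(1)[OF b(2)] closed_segment_commute by metis
qed

lemma int_shift_periodic:
  assumes "\<And>t. c (t + 1) = (c t :: 'b)"
  shows "c (t + of_int n) = c (t :: real)"
proof -
  have nat: "c (t + real k) = c t" for t k
  proof (induction k)
    case (Suc k)
    then show ?case using assms[of "t + real k"] by (simp add: add_ac)
  qed simp
  show ?thesis
  proof (cases "n \<ge> 0")
    case True
    then show ?thesis using nat[of t "nat n"] by simp
  next
    case False
    then show ?thesis using nat[of "t + of_int n" "nat (- n)"] by simp
  qed
qed

lemma closed_segment_affine:
  fixes z0 e :: complex
  shows "closed_segment (z0 + e * b) (z0 + e * b') = (\<lambda>w. z0 + e * w) ` closed_segment b b'"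
proof -
  have "linear ((*) e)" by (simp add: linear_times)
  from closed_segment_linear_image[OF this, of b b']
  have "closed_segment (e * b) (e * b') = (*) e ` closed_segment b b'" .
  moreover have "closed_segment (z0 + e * b) (z0 + e * b') = (+) z0 ` closed_segment (e * b) (e * b')"
    by (rule closed_segment_translation)
  ultimately show ?thesis by (simp add: image_image)
qed

context bordered_surface
begin

text \<open>The other boundary curves, and the part of the same curve that is not close to the parameter of \<open>x\<close>,
  form a closed set that does not contain \<open>x\<close>. So near \<open>x\<close> the boundary is a short arc.\<close>

lemma frontier_arc:
  assumes x: "x \<in> frontier_M"
  obtains c t0 where "c t0 = x" "continuous_map euclideanreal X c" "range c \<subseteq> frontier_M"
    "\<And>U \<phi>. (U, \<phi>) \<in> \<A> \<Longrightarrow> \<exists>D :: nat \<Rightarrow> real \<Rightarrow> complex. \<forall>t. c t \<in> U \<longrightarrow>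
            D 0 t = \<phi> (c t) \<and> D 1 t \<noteq> 0 \<and> (\<forall>k. (D k has_vector_derivative D (Suc k) t) (at t))"
    "\<And>\<eta>. 0 < \<eta> \<Longrightarrow> \<eta> < 1 / 2 \<Longrightarrow>
       \<exists>P. openin X P \<and> x \<in> P \<and> P \<inter> frontier_M \<subseteq> c ` {t0 - \<eta><..<t0 + \<eta>}"
proof -
  have "\<exists>\<J>. finite \<J> \<and> disjoint \<J> \<and> (\<forall>J\<in>\<J>. smooth_jordan_curve X \<A> J) \<and> \<Union>\<J> = frontier_M"
    using surface unfolding compact_bordered_riemann_surface_def by (elim conjE)
  then obtain \<J> where J: "finite \<J>" "disjoint \<J>" "\<forall>J\<in>\<J>. smooth_jordan_curve X \<A> J" "\<Union>\<J> = frontier_M"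
    by (elim exE conjE)
  have cpt: "closedin X J" if sJ: "smooth_jordan_curve X \<A> J" for J
  proof -
    obtain c :: "real \<Rightarrow> 'a" where c: "continuous_map euclideanreal X c" "\<forall>t. c (t + 1) = c t" "range c = J"
      using sJ unfolding smooth_jordan_curve_def by (elim exE conjE)
    have "c t \<in> c ` {0..1}" for t
      using int_shift_periodic[of c t "- \<lfloor>t\<rfloor>"] c(2) by (intro image_eqI[of _ _ "frac t"]) (auto simp: frac_def less_imp_le[OF frac_lt_1[unfolded frac_def]])
    then have "J = c ` {0..1}" using c(3) by auto
    moreover have "compactin X (c ` {0..1})" using c(1) by (intro image_compactin) auto
    ultimately show ?thesis using compactin_imp_closedin[OF Hausdorff] by simp
  qed
  obtain J0 where J0: "J0 \<in> \<J>" "x \<in> J0" using x J(4) by auto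
  have "smooth_jordan_curve X \<A> J0" using J(3) J0(1) by (rule bspec)
  then obtain c :: "real \<Rightarrow> 'a" where c: "continuous_map euclideanreal X c" "\<forall>t. c (t + 1) = c t"
    "inj_on c {0..<1}" "range c = J0"
    "\<forall>(U, \<phi>)\<in>\<A>. \<exists>D :: nat \<Rightarrow> real \<Rightarrow> complex. \<forall>t. c t \<in> U \<longrightarrow>
            D 0 t = \<phi> (c t) \<and> D 1 t \<noteq> 0 \<and> (\<forall>k. (D k has_vector_derivative D (Suc k) t) (at t))"
    unfolding smooth_jordan_curve_def by (elim exE conjE)
  have per: "c (t + of_int n) = c t" for t n using int_shift_periodic[of c] c(2) by simp
  obtain t0 where t0: "c t0 = x" using J0(2) c(4) by auto
  have inj: "s - t \<in> \<int>" if "c s = c t" for s t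
  proof -
    have "c (frac s) = c (frac t)" using that per[of s "- \<lfloor>s\<rfloor>"] per[of t "- \<lfloor>t\<rfloor>"] by (simp add: frac_def)
    then have "frac s = frac t" using inj_onD[OF c(3), of "frac s" "frac t"] by (simp add: frac_lt_1)
    then have "s - t = of_int (\<lfloor>s\<rfloor> - \<lfloor>t\<rfloor>)" by (simp add: frac_def)
    then show ?thesis by (simp only: Ints_of_int)
  qed
  show ?thesis
  proof (rule that[of c t0])
    show "c t0 = x" "continuous_map euclideanreal X c" by fact+
    show "range c \<subseteq> frontier_M" using c(4) J0(1) J(4) by auto
    show "\<exists>D :: nat \<Rightarrow> real \<Rightarrow> complex. \<forall>t. c t \<in> U \<longrightarrow>
            D 0 t = \<phi> (c t) \<and> D 1 t \<noteq> 0 \<and> (\<forall>k. (D k has_vector_derivative D (Suc k) t) (at t))"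
      if "(U, \<phi>) \<in> \<A>" for U \<phi>
      using bspec[OF c(5) that] by simp
    fix \<eta> :: real assume \<eta>: "0 < \<eta>" "\<eta> < 1 / 2"
    define Z where "Z = \<Union>(\<J> - {J0}) \<union> c ` {t0 + \<eta>..t0 + 1 - \<eta>}"
    have "closedin X (\<Union>(\<J> - {J0}))"
      using J(1) J(3) cpt by (intro closedin_Union) auto
    moreover have "closedin X (c ` {t0 + \<eta>..t0 + 1 - \<eta>})"
      using c(1) by (intro compactin_imp_closedin[OF Hausdorff] image_compactin) auto
    ultimately have Z: "closedin X Z" unfolding Z_def by (rule closedin_Un)
    have xJ: "x \<notin> J" if "J \<in> \<J> - {J0}" for J
      using that J(2) J0 by (auto simp: disjoint_def)
    have xc: "x \<notin> c ` {t0 + \<eta>..t0 + 1 - \<eta>}"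
    proof
      assume "x \<in> c ` {t0 + \<eta>..t0 + 1 - \<eta>}"
      then obtain s where s: "s \<in> {t0 + \<eta>..t0 + 1 - \<eta>}" "c s = c t0" using t0 by auto
      from inj[OF s(2)] obtain n where n: "s - t0 = of_int n" by (rule Ints_cases)
      have "0 < s - t0" "s - t0 < 1" using s(1) \<eta> by auto
      then show False unfolding n by simp
    qed
    have "x \<in> topspace X" using t0 c(1) by (auto simp: continuous_map_def)
    then have xP: "x \<in> topspace X - Z" using xJ xc unfolding Z_def by auto
    have "y \<in> c ` {t0 - \<eta><..<t0 + \<eta>}" if y: "y \<in> topspace X - Z" "y \<in> frontier_M" for y
    proof -
      obtain J where "J \<in> \<J>" "y \<in> J" using y(2) J(4) by auto
      then have "y \<in> J0" using y(1) unfolding Z_def by auto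
      then obtain t where t: "y = c t" using c(4) by auto
      define n where "n = \<lfloor>t - (t0 - \<eta>)\<rfloor>"
      define s where "s = t + of_int (- n)"
      have s: "t0 - \<eta> \<le> s" "s < t0 - \<eta> + 1" unfolding s_def n_def by linarith+
      have cs: "c s = y" unfolding s_def t by (rule per)
      have "s \<notin> {t0 + \<eta>..t0 + 1 - \<eta>}" using cs y(1) unfolding Z_def by auto
      moreover have "s \<noteq> t0 - \<eta>"
      proof
        assume "s = t0 - \<eta>"
        then have "t0 + 1 - \<eta> = s + of_int 1" by simp
        then have "c (t0 + 1 - \<eta>) = y" by (simp only: per cs)
        moreover have "t0 + 1 - \<eta> \<in> {t0 + \<eta>..t0 + 1 - \<eta>}" using \<eta> by auto
        ultimately show False using y(1) unfolding Z_def by blast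
      qed
      ultimately have "s \<in> {t0 - \<eta><..<t0 + \<eta>}" using s by auto
      then show ?thesis using cs by blast
    qed
    then show "\<exists>P. openin X P \<and> x \<in> P \<and> P \<inter> frontier_M \<subseteq> c ` {t0 - \<eta><..<t0 + \<eta>}"
      using Z xP by (intro exI[of _ "topspace X - Z"]) auto
  qed
qed

text \<open>The coordinate is normalized so that \<open>x\<close> becomes the origin and the tangent of the boundary curve at \<open>x\<close>
  becomes the real direction; \<open>e\<close> is the derivative of the curve at \<open>x\<close>.\<close>

lemma frontier_is_graph:
  assumes x: "x \<in> frontier_M" and c: "(U, \<phi>) \<in> \<A>" "x \<in> U" and \<rho>: "\<rho> > 0"
  obtains e a g where "e \<noteq> 0" "a > 0" "continuous_on {-a<..<a} g" "\<And>s. \<bar>s\<bar> < a \<Longrightarrow> \<bar>g s\<bar> \<le> \<bar>s\<bar>"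
    "\<And>w. w \<in> rectangle a \<Longrightarrow> \<phi> x + e * w \<in> \<phi> ` U \<inter> ball (\<phi> x) \<rho>"
    "\<And>w. w \<in> rectangle a \<Longrightarrow> inv_into U \<phi> (\<phi> x + e * w) \<in> frontier_M \<longleftrightarrow> Im w = g (Re w)"
proof -
  obtain \<gamma> t0 where \<gamma>: "\<gamma> t0 = x" "continuous_map euclideanreal X \<gamma>" "range \<gamma> \<subseteq> frontier_M"
    "\<exists>D :: nat \<Rightarrow> real \<Rightarrow> complex. \<forall>t. \<gamma> t \<in> U \<longrightarrow>
            D 0 t = \<phi> (\<gamma> t) \<and> D 1 t \<noteq> 0 \<and> (\<forall>k. (D k has_vector_derivative D (Suc k) t) (at t))"
    "\<And>\<eta>. 0 < \<eta> \<Longrightarrow> \<eta> < 1 / 2 \<Longrightarrow>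
       \<exists>P. openin X P \<and> x \<in> P \<and> P \<inter> frontier_M \<subseteq> \<gamma> ` {t0 - \<eta><..<t0 + \<eta>}"
    using frontier_arc[OF x] c(1) by metis
  obtain D :: "nat \<Rightarrow> real \<Rightarrow> complex" where D: "\<And>t. \<gamma> t \<in> U \<Longrightarrow> D 0 t = \<phi> (\<gamma> t)"
    "\<And>t. \<gamma> t \<in> U \<Longrightarrow> D 1 t \<noteq> 0" "\<And>t k. \<gamma> t \<in> U \<Longrightarrow> (D k has_vector_derivative D (Suc k) t) (at t)"
    using \<gamma>(4) by auto
  define e where "e = D 1 t0"
  have t0U: "\<gamma> t0 \<in> U" using \<gamma>(1) c(2) by simp
  have e: "e \<noteq> 0" unfolding e_def using D(2) t0U by simp
  define \<sigma> where "\<sigma> t = (D 0 t - \<phi> x) / e" for t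
  have "openin euclideanreal {t \<in> topspace euclideanreal. \<gamma> t \<in> U}"
    using \<gamma>(2) chart_openin[OF c(1)] by (rule openin_continuous_map_preimage)
  then have oT: "open {t. \<gamma> t \<in> U}" by simp
  have "isCont (\<lambda>t. D 1 t / e) t0"
    using has_vector_derivative_continuous[OF D(3)[OF t0U, of 1]] e by (intro isCont_divide) auto
  then obtain d1 where d1: "d1 > 0" "\<And>t. dist t t0 < d1 \<Longrightarrow> dist (D 1 t / e) (D 1 t0 / e) < 1 / 2"
    unfolding continuous_at_eps_delta[of t0] by (meson half_gt_zero_iff zero_less_one)
  obtain d2 where d2: "d2 > 0" "ball t0 d2 \<subseteq> {t. \<gamma> t \<in> U}" using oT t0U open_contains_ball by blast
  \<comment> \<open>The bound \<open>1/3\<close> keeps the arc shorter than a period; the others keep it in the chart and nearly straight.\<close>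
  define \<eta> where "\<eta> = min (1 / 3) (min (d1 / 2) (d2 / 2))"
  have \<eta>: "\<eta> > 0" "\<eta> < 1 / 2" "\<eta> < d1" "\<eta> < d2" using d1(1) d2(1) by (auto simp: \<eta>_def min_def)
  have IU: "\<gamma> t \<in> U" if "t \<in> {t0 - \<eta>..t0 + \<eta>}" for t
    using that \<eta>(4) d2(2) by (auto simp: dist_real_def subset_iff)
  have "\<exists>g. continuous_on {-(\<eta>/2)<..<\<eta>/2} g \<and> (\<forall>s. \<bar>s\<bar> < \<eta>/2 \<longrightarrow> \<bar>g s\<bar> \<le> \<bar>s\<bar>) \<and>
    (\<forall>s. \<bar>s\<bar> < \<eta>/2 \<longrightarrow> (\<exists>t\<in>{t0 - \<eta><..<t0 + \<eta>}. \<sigma> t = Complex s (g s))) \<and>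
    (\<forall>t\<in>{t0 - \<eta><..<t0 + \<eta>}. \<bar>Re (\<sigma> t)\<bar> < \<eta>/2 \<longrightarrow> Im (\<sigma> t) = g (Re (\<sigma> t)))"
  proof (rule curve_is_graph[OF \<eta>(1)])
    show "\<sigma> t0 = 0" unfolding \<sigma>_def using D(1)[OF t0U] \<gamma>(1) by simp
    show "(\<sigma> has_vector_derivative D 1 t / e) (at t)" if "t \<in> {t0 - \<eta>..t0 + \<eta>}" for t
    proof -
      have "((\<lambda>t. D 0 t - \<phi> x) has_vector_derivative D 1 t) (at t)"
        using D(3)[OF IU[OF that], of 0] by (auto intro!: derivative_eq_intros)
      from has_vector_derivative_divide[OF this, of e] show ?thesis unfolding \<sigma>_def[abs_def] .
    qed
    show "norm (D 1 t / e - 1) \<le> 1 / 2" if "t \<in> {t0 - \<eta>..t0 + \<eta>}" for t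
    proof -
      have "dist t t0 < d1" using that \<eta>(3) by (auto simp: dist_real_def)
      moreover have one: "D 1 t0 / e = 1" using e unfolding e_def by simp
      ultimately show ?thesis using d1(2)[of t] unfolding one dist_norm by simp
    qed
  qed
  then obtain g where g: "continuous_on {-(\<eta>/2)<..<\<eta>/2} g" "\<forall>s. \<bar>s\<bar> < \<eta>/2 \<longrightarrow> \<bar>g s\<bar> \<le> \<bar>s\<bar>"
    "\<forall>s. \<bar>s\<bar> < \<eta>/2 \<longrightarrow> (\<exists>t\<in>{t0 - \<eta><..<t0 + \<eta>}. \<sigma> t = Complex s (g s))"
    "\<forall>t\<in>{t0 - \<eta><..<t0 + \<eta>}. \<bar>Re (\<sigma> t)\<bar> < \<eta>/2 \<longrightarrow> Im (\<sigma> t) = g (Re (\<sigma> t))"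
    by (elim exE conjE)
  obtain P where P: "openin X P" "x \<in> P" "P \<inter> frontier_M \<subseteq> \<gamma> ` {t0 - \<eta><..<t0 + \<eta>}"
    using \<gamma>(5)[OF \<eta>(1,2)] by (elim exE conjE)
  have "open (\<phi> ` (U \<inter> P))" using P(1) chart_openin[OF c(1)] by (intro chart_open_image[OF c(1)]) auto
  moreover have "\<phi> x \<in> \<phi> ` (U \<inter> P)" using c(2) P(2) by blast
  ultimately obtain \<rho>' where \<rho>': "\<rho>' > 0" "ball (\<phi> x) \<rho>' \<subseteq> \<phi> ` (U \<inter> P)" using open_contains_ball by metis
  define a where "a = min (\<eta> / 2) (min \<rho> \<rho>' / (4 * norm e))"
  have a: "a > 0" "a \<le> \<eta> / 2" "a \<le> min \<rho> \<rho>' / (4 * norm e)" using \<eta>(1) \<rho> \<rho>'(1) e by (auto simp: a_def)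
  have ball: "\<phi> x + e * w \<in> ball (\<phi> x) (min \<rho> \<rho>')" if "w \<in> rectangle a" for w
  proof -
    have "norm e * norm w \<le> norm e * (3 * a)" using norm_rectangle[OF that] by (intro mult_left_mono) auto
    also have "\<dots> < norm e * (4 * a)" using a(1) e by simp
    also have "\<dots> \<le> min \<rho> \<rho>'" using a(3) e by (simp add: field_simps)
    finally show ?thesis by (simp add: dist_norm norm_mult)
  qed
  show ?thesis
  proof (rule that[of e a g])
    show "e \<noteq> 0" "a > 0" by fact+
    show "continuous_on {-a<..<a} g" using g(1) by (rule continuous_on_subset) (use a(2) in auto)
    show "\<bar>g s\<bar> \<le> \<bar>s\<bar>" if "\<bar>s\<bar> < a" for s using g(2) that a(2) by simp
    fix w assume w: "w \<in> rectangle a"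
    have wP: "\<phi> x + e * w \<in> \<phi> ` (U \<inter> P)" using ball[OF w] \<rho>'(2) by auto
    then show "\<phi> x + e * w \<in> \<phi> ` U \<inter> ball (\<phi> x) \<rho>" using ball[OF w] by auto
    obtain y where y: "\<phi> x + e * w = \<phi> y" "y \<in> U" "y \<in> P" using wP by blast
    have inv: "inv_into U \<phi> (\<phi> x + e * w) = y" unfolding y(1) using c(1) y(2) by simp
    have Rew: "\<bar>Re w\<bar> < \<eta> / 2" using w a(2) by (simp add: rectangle_def)
    have \<sigma>: "\<sigma> t = (\<phi> (\<gamma> t) - \<phi> x) / e" if "t \<in> {t0 - \<eta><..<t0 + \<eta>}" for t
      unfolding \<sigma>_def using D(1)[OF IU[of t]] that by simp
    have w_eq: "w = (\<phi> y - \<phi> x) / e" using y(1) e by (simp add: field_simps)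
    show "inv_into U \<phi> (\<phi> x + e * w) \<in> frontier_M \<longleftrightarrow> Im w = g (Re w)"
      unfolding inv
    proof
      assume "y \<in> frontier_M"
      then obtain t where t: "t \<in> {t0 - \<eta><..<t0 + \<eta>}" "y = \<gamma> t" using P(3) y(3) by blast
      then have "\<sigma> t = w" using \<sigma>[OF t(1)] w_eq by simp
      then show "Im w = g (Re w)" using g(4) t(1) Rew by auto
    next
      assume "Im w = g (Re w)"
      then have "w = Complex (Re w) (g (Re w))" by (simp add: complex_eq_iff)
      moreover obtain t where t: "t \<in> {t0 - \<eta><..<t0 + \<eta>}" "\<sigma> t = Complex (Re w) (g (Re w))"
        using g(3) Rew by blast
      ultimately have "\<sigma> t = w" by simp
      then have "\<phi> (\<gamma> t) = \<phi> y" using \<sigma>[OF t(1)] w_eq e by (simp add: field_simps)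
      moreover have "\<gamma> t \<in> U" using IU[of t] t(1) by simp
      ultimately have "\<gamma> t = y" using chart_inj[OF c(1)] y(2) by (simp add: inj_on_def)
      then show "y \<in> frontier_M" using \<gamma>(3) by auto
    qed
  qed
qed

lemma locally_joined_in_chart:
  assumes c: "(U, \<phi>) \<in> \<A>" and R: "open R" "R \<subseteq> \<phi> ` U" "R \<subseteq> ball z \<rho>"
    and B: "B \<ge> 0" "\<And>w. w \<in> R \<Longrightarrow> norm (\<theta> (U, \<phi>) (inv_into U \<phi> w)) \<le> B"
    and seg: "\<And>b b'. b \<in> R \<Longrightarrow> b \<in> \<phi> ` (U \<inter> M) \<Longrightarrow> b' \<in> R \<Longrightarrow> b' \<in> \<phi> ` (U \<inter> M) \<Longrightarrow>
      \<exists>w w'. closed_segment b w \<subseteq> R \<inter> \<phi> ` (U \<inter> M) \<and> closed_segment w w' \<subseteq> R \<inter> \<phi> ` (U \<inter> M) \<and>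
        closed_segment w' b' \<subseteq> R \<inter> \<phi> ` (U \<inter> M)"
    and x: "x \<in> U" "\<phi> x \<in> R"
  shows "\<exists>C P. openin X P \<and> x \<in> P \<and> (\<forall>y\<in>P \<inter> M. \<forall>y'\<in>P \<inter> M. joined C y y')"
proof -
  define C where "C = B * (2 * \<rho>)"
  have one: "joined C (inv_into U \<phi> p) (inv_into U \<phi> q)" if pq: "closed_segment p q \<subseteq> R \<inter> \<phi> ` (U \<inter> M)" for p q
  proof -
    have "p \<in> R" "q \<in> R" using pq by auto
    then have "p \<in> ball z \<rho>" "q \<in> ball z \<rho>" using R(3) by auto
    then have "norm (q - p) \<le> 2 * \<rho>"
      using dist_triangle2[of q p z] by (simp add: dist_norm norm_minus_commute)
    then have "B * norm (q - p) \<le> C" unfolding C_def using B(1) by (rule mult_left_mono)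
    moreover have "joined (B * norm (q - p)) (inv_into U \<phi> p) (inv_into U \<phi> q)"
      using pq by (intro joined_segment[OF c] B(2)) auto
    ultimately show ?thesis by (rule joined_mono[rotated])
  qed
  have "joined (2 * max (2 * max C C) C) y y'" if y: "y \<in> U" "\<phi> y \<in> R" "y \<in> M" "y' \<in> U" "\<phi> y' \<in> R" "y' \<in> M" for y y'
  proof -
    obtain w w' where w: "closed_segment (\<phi> y) w \<subseteq> R \<inter> \<phi> ` (U \<inter> M)" "closed_segment w w' \<subseteq> R \<inter> \<phi> ` (U \<inter> M)"
        "closed_segment w' (\<phi> y') \<subseteq> R \<inter> \<phi> ` (U \<inter> M)"
      using seg[of "\<phi> y" "\<phi> y'"] y by auto
    show ?thesis
      using joined_trans[OF joined_trans[OF one[OF w(1)] one[OF w(2)]] one[OF w(3)]] c y by simp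
  qed
  then show ?thesis
    using chart_open_preimage[OF c R(1)] x
    by (intro exI[of _ "2 * max (2 * max C C) C"] exI[of _ "{y\<in>U. \<phi> y \<in> R}"]) auto
qed

lemma form_locally_bounded:
  assumes c: "(U, \<phi>) \<in> \<A>" and x: "x \<in> U" "x \<in> M"
  obtains \<rho> B where "\<rho> > 0" "B \<ge> 0" "ball (\<phi> x) \<rho> \<subseteq> \<phi> ` U"
    "\<And>w. w \<in> ball (\<phi> x) \<rho> \<Longrightarrow> norm (\<theta> (U, \<phi>) (inv_into U \<phi> w)) \<le> B"
proof -
  have "open (\<phi> ` (U \<inter> form_domain))"
    using chart_openin[OF c] form_domain_openin by (intro chart_open_image[OF c]) auto
  moreover have "\<phi> x \<in> \<phi> ` (U \<inter> form_domain)" using x M_subset_form_domain by blast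
  ultimately obtain \<rho> where \<rho>: "\<rho> > 0" "cball (\<phi> x) \<rho> \<subseteq> \<phi> ` (U \<inter> form_domain)"
    using open_contains_cball by metis
  have "continuous_on (cball (\<phi> x) \<rho>) (\<theta> (U, \<phi>) \<circ> inv_into U \<phi>)"
    using holomorphic_on_imp_continuous_on[OF form_holomorphic[OF c]] \<rho>(2) by (rule continuous_on_subset)
  then have "compact ((\<theta> (U, \<phi>) \<circ> inv_into U \<phi>) ` cball (\<phi> x) \<rho>)"
    by (rule compact_continuous_image) simp
  then have "bounded ((\<theta> (U, \<phi>) \<circ> inv_into U \<phi>) ` cball (\<phi> x) \<rho>)" by (rule compact_imp_bounded)
  then obtain B where B: "\<forall>v\<in>(\<theta> (U, \<phi>) \<circ> inv_into U \<phi>) ` cball (\<phi> x) \<rho>. norm v \<le> B"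
    unfolding bounded_iff by (elim exE)
  show ?thesis
  proof (rule that[of \<rho> "\<bar>B\<bar>"])
    show "ball (\<phi> x) \<rho> \<subseteq> \<phi> ` U" using \<rho>(2) ball_subset_cball by blast
    show "norm (\<theta> (U, \<phi>) (inv_into U \<phi> w)) \<le> \<bar>B\<bar>" if "w \<in> ball (\<phi> x) \<rho>" for w
    proof -
      have "w \<in> cball (\<phi> x) \<rho>" using that by simp
      from bspec[OF B imageI[OF this]] show ?thesis by (simp add: abs_le_iff abs_if)
    qed
  qed (use \<rho> in auto)
qed

text \<open>A connected set that meets \<open>M\<close> and its complement meets the frontier.\<close>

lemma connected_avoiding_frontier:
  assumes c: "(U, \<phi>) \<in> \<A>" and Q: "connected Q" "Q \<subseteq> \<phi> ` U"
    and fr: "\<And>z. z \<in> Q \<Longrightarrow> inv_into U \<phi> z \<notin> frontier_M"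
    and q: "q \<in> Q" "inv_into U \<phi> q \<in> M" and z: "z \<in> Q"
  shows "inv_into U \<phi> z \<in> M"
proof (rule ccontr)
  assume "inv_into U \<phi> z \<notin> M"
  moreover have "connectedin X (inv_into U \<phi> ` Q)"
    using Q by (intro connectedin_continuous_map_image[OF chart_inv_continuous[OF c]]) (simp add: connectedin_subtopology)
  ultimately have "inv_into U \<phi> ` Q \<inter> frontier_M \<noteq> {}"
    using q z by (intro connectedin_Int_frontier_of) auto
  then show False using fr by auto
qed

lemma locally_joined_interior:
  assumes x: "x \<in> int_M"
  shows "\<exists>C P. openin X P \<and> x \<in> P \<and> (\<forall>y\<in>P \<inter> M. \<forall>y'\<in>P \<inter> M. joined C y y')"
proof -
  have xM: "x \<in> M" using x int_M_subset by auto
  then have "x \<in> topspace X" using M_subset by auto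
  then obtain U \<phi> where c: "(U, \<phi>) \<in> \<A>" "x \<in> U" using chart_covers by metis
  obtain \<rho> B where \<rho>: "\<rho> > 0" "B \<ge> 0" "ball (\<phi> x) \<rho> \<subseteq> \<phi> ` U"
    "\<And>w. w \<in> ball (\<phi> x) \<rho> \<Longrightarrow> norm (\<theta> (U, \<phi>) (inv_into U \<phi> w)) \<le> B"
    using form_locally_bounded[OF c xM] by metis
  have "open (\<phi> ` (U \<inter> int_M))" using chart_interior[OF c(1)] open_interior by metis
  moreover have "\<phi> x \<in> \<phi> ` (U \<inter> int_M)" using c x by blast
  ultimately obtain \<rho>' where \<rho>': "\<rho>' > 0" "ball (\<phi> x) \<rho>' \<subseteq> \<phi> ` (U \<inter> int_M)"
    using open_contains_ball by metis
  let ?R = "ball (\<phi> x) (min \<rho> \<rho>')"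
  have RM: "?R \<subseteq> \<phi> ` (U \<inter> M)" using \<rho>'(2) int_M_subset by (fastforce simp: subset_iff)
  show ?thesis
  proof (rule locally_joined_in_chart[OF c(1), of ?R "\<phi> x" \<rho> B])
    fix b b' assume "b \<in> ?R" "b' \<in> ?R"
    then have "closed_segment b b' \<subseteq> ?R" by (intro closed_segment_subset) auto
    moreover have "closed_segment b b \<subseteq> ?R" "closed_segment b' b' \<subseteq> ?R" using \<open>b \<in> ?R\<close> \<open>b' \<in> ?R\<close> by simp_all
    ultimately show "\<exists>w w'. closed_segment b w \<subseteq> ?R \<inter> \<phi> ` (U \<inter> M) \<and> closed_segment w w' \<subseteq> ?R \<inter> \<phi> ` (U \<inter> M) \<and>
        closed_segment w' b' \<subseteq> ?R \<inter> \<phi> ` (U \<inter> M)"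
      using RM by (intro exI[of _ b] exI[of _ b'] conjI Int_greatest) (auto simp only: intro: order_trans)
  qed (use \<rho> \<rho>' c in auto)
qed

text \<open>Each open side of the graph is connected and avoids the frontier, so it lies in \<open>M\<close> or outside \<open>M\<close>. The
  rectangle contains interior points of \<open>M\<close>, because \<open>M\<close> is the closure of its interior; so at least
  one side lies in \<open>M\<close>. If both do, the rectangle does, and then it is convexity that provides segments.\<close>

lemma M_in_rectangle_is_side:
  assumes c: "(U, \<phi>) \<in> \<A>" "x \<in> U" and x: "x \<in> frontier_M"
    and a: "e \<noteq> 0" "a > 0" and g: "continuous_on {-a<..<a} g" "\<And>s. \<bar>s\<bar> < a \<Longrightarrow> \<bar>g s\<bar> \<le> a" "g 0 = 0"
    and in_U: "\<And>w. w \<in> rectangle a \<Longrightarrow> \<phi> x + e * w \<in> \<phi> ` U"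
    and fr: "\<And>w. w \<in> rectangle a \<Longrightarrow> inv_into U \<phi> (\<phi> x + e * w) \<in> frontier_M \<longleftrightarrow> Im w = g (Re w)"
  defines "Q \<equiv> {w \<in> rectangle a. inv_into U \<phi> (\<phi> x + e * w) \<in> M}"
  obtains "Q = rectangle a" | \<sigma> where "\<sigma> = 1 \<or> \<sigma> = (-1::real)" "Q = {w \<in> rectangle a. \<sigma> * (Im w - g (Re w)) \<ge> 0}"
proof -
  define m where "m w = inv_into U \<phi> (\<phi> x + e * w)" for w
  define side where "side \<sigma> = {w \<in> rectangle a. \<sigma> * (Im w - g (Re w)) > 0}" for \<sigma> :: real
  have frM: "frontier_M \<subseteq> M" using closed_M by (simp add: frontier_of_subset_closedin)
  have all: "m w' \<in> M" if \<sigma>: "\<sigma> = 1 \<or> \<sigma> = -1" and w: "w \<in> side \<sigma>" "m w \<in> M" "w' \<in> side \<sigma>" for \<sigma> w w'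
  proof -
    let ?f = "\<lambda>w. \<phi> x + e * w"
    have C1: "connected (?f ` side \<sigma>)"
      using connected_side_of_graph[OF a(2) g(1,2) \<sigma>] unfolding side_def
      by (intro connected_continuous_image continuous_intros) auto
    have C2: "?f ` side \<sigma> \<subseteq> \<phi> ` U" using in_U by (auto simp: side_def)
    have C3: "inv_into U \<phi> z \<notin> frontier_M" if "z \<in> ?f ` side \<sigma>" for z
      using that fr by (auto simp: side_def)
    show ?thesis
      unfolding m_def
      by (rule connected_avoiding_frontier[OF c(1) C1 C2 C3 imageI[OF w(1)] w(2)[unfolded m_def] imageI[OF w(3)]])
  qed
  have cases3: "w \<in> side 1 \<or> w \<in> side (-1) \<or> m w \<in> frontier_M" if "w \<in> rectangle a" for w
    using that fr[OF that] unfolding m_def side_def by auto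
  have xM: "x \<in> M" using x frM by auto
  have ex: "\<exists>w\<in>side 1 \<union> side (-1). m w \<in> M"
  proof -
    have "open ((\<lambda>w. (w - \<phi> x) / e) -` rectangle a)"
      using a(1) by (intro open_vimage open_rectangle continuous_intros) auto
    then have oP: "openin X {y\<in>U. \<phi> y \<in> (\<lambda>w. (w - \<phi> x) / e) -` rectangle a}" (is "openin X ?P")
      by (rule chart_open_preimage[OF c(1)])
    have xP: "x \<in> ?P" using c(2) a(2) by (simp add: rectangle_def)
    have "x \<in> X closure_of (int_M)" using closure_int_M xM by simp
    from this[unfolded in_closure_of, THEN conjunct2, rule_format, OF conjI[OF xP oP]]
    obtain y where y: "y \<in> int_M" "y \<in> ?P" by (elim exE conjE)
    define w where "w = (\<phi> y - \<phi> x) / e"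
    have wR: "w \<in> rectangle a" using y(2) unfolding w_def by simp
    have "\<phi> x + e * w = \<phi> y" using a(1) by (simp add: w_def)
    then have my: "m w = y" unfolding m_def using c(1) y(2) by simp
    have "y \<notin> frontier_M" using y(1) by (simp add: frontier_of_def)
    then show ?thesis using cases3[OF wR] my y(1) int_M_subset by auto
  qed
  have Qm: "w \<in> Q \<longleftrightarrow> w \<in> rectangle a \<and> m w \<in> M" for w by (simp add: Q_def m_def)
  have graph: "m w \<in> M" if "w \<in> rectangle a" "Im w = g (Re w)" for w
    using fr[OF that(1)] that(2) frM unfolding m_def by auto
  consider "\<exists>w\<in>side 1. m w \<in> M" "\<exists>w\<in>side (-1). m w \<in> M"
    | \<sigma> where "\<sigma> = 1 \<or> \<sigma> = -1" "\<exists>w\<in>side \<sigma>. m w \<in> M" "\<not> (\<exists>w\<in>side (- \<sigma>). m w \<in> M)"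
  proof (cases "\<exists>w\<in>side 1. m w \<in> M")
    case True
    then show ?thesis using that by (cases "\<exists>w\<in>side (-1). m w \<in> M") auto
  next
    case False
    then have "\<exists>w\<in>side (-1). m w \<in> M" using ex by auto
    then show ?thesis using False that(2)[of "-1"] by simp
  qed
  then show ?thesis
  proof cases
    case 1
    have "m w \<in> M" if w: "w \<in> rectangle a" for w
      using cases3[OF w] 1 all[of 1] all[of "-1"] frM by auto
    then have "Q = rectangle a" using Qm by auto
    then show ?thesis by (rule that(1))
  next
    case 2
    have "w \<in> Q \<longleftrightarrow> w \<in> {w \<in> rectangle a. \<sigma> * (Im w - g (Re w)) \<ge> 0}" for w
    proof (cases "w \<in> rectangle a")
      case wR: True
      consider "Im w = g (Re w)" | "w \<in> side \<sigma>" | "w \<in> side (- \<sigma>)"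
        using wR 2(1) unfolding side_def by auto linarith+
      then show ?thesis
      proof cases
        case 1
        then show ?thesis using graph[OF wR] Qm wR by simp
      next
        case w: 2
        obtain w0 where "w0 \<in> side \<sigma>" "m w0 \<in> M" using 2(2) by (elim bexE)
        then have "m w \<in> M" using w by (rule all[OF 2(1)])
        then show ?thesis using Qm wR w unfolding side_def by simp
      next
        case w: 3
        have "m w \<notin> M"
        proof
          assume "m w \<in> M"
          then have "\<exists>w\<in>side (- \<sigma>). m w \<in> M" using w by (rule bexI)
          with 2(3) show False by (rule notE)
        qed
        then have "w \<notin> Q" unfolding Qm by simp
        moreover have "\<sigma> * (Im w - g (Re w)) < 0" using w unfolding side_def by simp
        ultimately show ?thesis by simp
      qed
    qed (use Qm in auto)
    then have "Q = {w \<in> rectangle a. \<sigma> * (Im w - g (Re w)) \<ge> 0}" by blast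
    with 2(1) show ?thesis by (rule that(2))
  qed
qed

lemma locally_joined_frontier:
  assumes x: "x \<in> frontier_M"
  shows "\<exists>C P. openin X P \<and> x \<in> P \<and> (\<forall>y\<in>P \<inter> M. \<forall>y'\<in>P \<inter> M. joined C y y')"
proof -
  have xM: "x \<in> M" using x closed_M frontier_of_subset_closedin by auto
  then have "x \<in> topspace X" using M_subset by auto
  then obtain U \<phi> where c: "(U, \<phi>) \<in> \<A>" "x \<in> U" using chart_covers by metis
  obtain \<rho> B where \<rho>: "\<rho> > 0" "B \<ge> 0" "ball (\<phi> x) \<rho> \<subseteq> \<phi> ` U"
    "\<And>w. w \<in> ball (\<phi> x) \<rho> \<Longrightarrow> norm (\<theta> (U, \<phi>) (inv_into U \<phi> w)) \<le> B"
    using form_locally_bounded[OF c xM] by metis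
  obtain e a g where e: "e \<noteq> 0" "a > 0" and g: "continuous_on {-a<..<a} g" "\<And>s. \<bar>s\<bar> < a \<Longrightarrow> \<bar>g s\<bar> \<le> \<bar>s\<bar>"
    and inU: "\<And>w. w \<in> rectangle a \<Longrightarrow> \<phi> x + e * w \<in> \<phi> ` U \<inter> ball (\<phi> x) \<rho>"
    and fr: "\<And>w. w \<in> rectangle a \<Longrightarrow> inv_into U \<phi> (\<phi> x + e * w) \<in> frontier_M \<longleftrightarrow> Im w = g (Re w)"
    using frontier_is_graph[OF x c \<rho>(1)] by metis
  have ga: "\<bar>g s\<bar> \<le> a" if "\<bar>s\<bar> < a" for s using g(2)[OF that] that by simp
  have g0: "g 0 = 0" using g(2)[of 0] e(2) by simp
  let ?f = "\<lambda>w. \<phi> x + e * w"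
  define Q where "Q = {w \<in> rectangle a. inv_into U \<phi> (?f w) \<in> M}"
  have segQ: "\<exists>w w'. closed_segment b w \<subseteq> Q \<and> closed_segment w w' \<subseteq> Q \<and> closed_segment w' b' \<subseteq> Q"
    if b: "b \<in> Q" "b' \<in> Q" for b b'
  proof (rule M_in_rectangle_is_side[OF c x e g(1) ga g0 _ fr])
    show "?f w \<in> \<phi> ` U" if "w \<in> rectangle a" for w using inU[OF that] by simp
  next
    assume "{w \<in> rectangle a. inv_into U \<phi> (?f w) \<in> M} = rectangle a"
    then have QR: "Q = rectangle a" unfolding Q_def .
    have "closed_segment b b' \<subseteq> Q" using b unfolding QR by (intro closed_segment_subset convex_rectangle)
    then show ?thesis using b by (intro exI[of _ b] exI[of _ b']) simp
  next
    fix \<sigma> :: real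
    assume \<sigma>: "\<sigma> = 1 \<or> \<sigma> = -1" "{w \<in> rectangle a. inv_into U \<phi> (?f w) \<in> M} = {w \<in> rectangle a. \<sigma> * (Im w - g (Re w)) \<ge> 0}"
    show ?thesis
      by (rule segments_in_side_of_graph[OF e(2) ga \<sigma>(1) trans[OF Q_def \<sigma>(2)] b])
  qed
  define R where "R = ?f ` rectangle a"
  have Rinv: "z \<in> R \<longleftrightarrow> (z - \<phi> x) / e \<in> rectangle a" for z
  proof
    assume "z \<in> R" then show "(z - \<phi> x) / e \<in> rectangle a" using e(1) unfolding R_def by auto
  next
    assume "(z - \<phi> x) / e \<in> rectangle a"
    then show "z \<in> R" unfolding R_def using e(1) by (intro image_eqI[of _ _ "(z - \<phi> x) / e"]) auto
  qed
  have RM: "?f ` Q = R \<inter> \<phi> ` (U \<inter> M)"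
  proof (intro equalityI subsetI)
    fix z assume "z \<in> ?f ` Q"
    then obtain w where w: "w \<in> rectangle a" "inv_into U \<phi> (?f w) \<in> M" "z = ?f w" unfolding Q_def by auto
    have "?f w \<in> \<phi> ` U" using inU[OF w(1)] by simp
    then have "inv_into U \<phi> (?f w) \<in> U" "\<phi> (inv_into U \<phi> (?f w)) = ?f w"
      by (simp_all add: inv_into_into f_inv_into_f)
    then have "z \<in> \<phi> ` (U \<inter> M)" using w by (intro image_eqI[of _ _ "inv_into U \<phi> (?f w)"]) auto
    then show "z \<in> R \<inter> \<phi> ` (U \<inter> M)" using w unfolding R_def by auto
  next
    fix z assume z: "z \<in> R \<inter> \<phi> ` (U \<inter> M)"
    then obtain w y where w: "w \<in> rectangle a" "z = ?f w" and y: "z = \<phi> y" "y \<in> U" "y \<in> M" unfolding R_def by auto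
    have "?f w = \<phi> y" using w(2) y(1) by simp
    then have "inv_into U \<phi> (?f w) = y" using chart_inv[OF c(1) y(2)] by (simp only:)
    then have "w \<in> Q" using w y unfolding Q_def by simp
    then show "z \<in> ?f ` Q" using w(2) by blast
  qed
  show ?thesis
  proof (rule locally_joined_in_chart[OF c(1), of R "\<phi> x" \<rho> B])
    have "R = (\<lambda>z. (z - \<phi> x) / e) -` rectangle a" using Rinv by auto
    then show "open R" using e(1) by (simp only:) (intro open_vimage open_rectangle continuous_intros, auto)
    show "R \<subseteq> \<phi> ` U" "R \<subseteq> ball (\<phi> x) \<rho>" using inU unfolding R_def by auto
    then show "norm (\<theta> (U, \<phi>) (inv_into U \<phi> w)) \<le> B" if "w \<in> R" for w using \<rho>(4) that by blast
    show "\<phi> x \<in> R" unfolding Rinv using e by (simp add: rectangle_def)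
    fix b b' assume "b \<in> R" "b \<in> \<phi> ` (U \<inter> M)" "b' \<in> R" "b' \<in> \<phi> ` (U \<inter> M)"
    then have "b \<in> ?f ` Q" "b' \<in> ?f ` Q" unfolding RM by simp_all
    then obtain v v' where v: "b = ?f v" "v \<in> Q" "b' = ?f v'" "v' \<in> Q" by (elim imageE)
    obtain w w' where w: "closed_segment v w \<subseteq> Q" "closed_segment w w' \<subseteq> Q" "closed_segment w' v' \<subseteq> Q"
      using segQ[OF v(2,4)] by (elim exE conjE)
    have seg: "closed_segment (?f p) (?f q) \<subseteq> R \<inter> \<phi> ` (U \<inter> M)" if "closed_segment p q \<subseteq> Q" for p q
      unfolding RM[symmetric] closed_segment_affine using that by (rule image_mono)
    show "\<exists>w w'. closed_segment b w \<subseteq> R \<inter> \<phi> ` (U \<inter> M) \<and> closed_segment w w' \<subseteq> R \<inter> \<phi> ` (U \<inter> M) \<and>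
        closed_segment w' b' \<subseteq> R \<inter> \<phi> ` (U \<inter> M)"
      unfolding v(1,3) by (intro exI[of _ "?f w"] exI[of _ "?f w'"] conjI seg w)
  qed (use \<rho> c in auto)
qed

lemma locally_joined:
  assumes x: "x \<in> M"
  shows "\<exists>C P. openin X P \<and> x \<in> P \<and> (\<forall>y\<in>P \<inter> M. \<forall>y'\<in>P \<inter> M. joined C y y')"
proof (cases "x \<in> int_M")
  case True
  then show ?thesis by (rule locally_joined_interior)
next
  case False
  have "x \<in> X closure_of M" using x closed_M by (simp add: closure_of_closedin)
  with False have "x \<in> frontier_M" by (simp add: frontier_of_def)
  then show ?thesis by (rule locally_joined_frontier)
qed

text \<open>The points that can be joined to a base point, in both directions, form a set that is open and closed in
  \<open>M\<close>, with a locally bounded constant; compactness makes the constant global.\<close>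

lemma uniformly_joined: "\<exists>C. \<forall>x\<in>M. \<forall>y\<in>M. joined C x y"
proof -
  have "\<forall>x\<in>M. \<exists>t. openin X (snd t) \<and> x \<in> snd t \<and> (\<forall>y\<in>snd t \<inter> M. \<forall>y'\<in>snd t \<inter> M. joined (fst t) y y')"
    using locally_joined by simp
  then obtain t where t: "\<forall>x\<in>M. openin X (snd (t x)) \<and> x \<in> snd (t x) \<and>
      (\<forall>y\<in>snd (t x) \<inter> M. \<forall>y'\<in>snd (t x) \<inter> M. joined (fst (t x)) y y')"
    by (rule bchoice[elim_format]) (elim exE)
  define C P where "C x = fst (t x)" and "P x = snd (t x)" for x
  have P: "openin X (P x)" "x \<in> P x" "\<And>y y'. y \<in> P x \<Longrightarrow> y \<in> M \<Longrightarrow> y' \<in> P x \<Longrightarrow> y' \<in> M \<Longrightarrow> joined (C x) y y'"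
    if "x \<in> M" for x using t that unfolding C_def P_def by auto
  obtain p where p: "p \<in> M" using M_nonempty by auto
  define A where "A = {x\<in>M. \<exists>K. joined K p x \<and> joined K x p}"
  have step: "y \<in> A" if h: "x \<in> M" "y \<in> P x" "y \<in> M" "z \<in> P x" "z \<in> A" for x y z
  proof -
    obtain K where "z \<in> M" "joined K p z" "joined K z p" using h(5) unfolding A_def by auto
    then have "joined (2 * max K (C x)) p y" "joined (2 * max (C x) K) y p"
      using P(3)[OF h(1)] h by (auto intro: joined_trans)
    then show ?thesis unfolding A_def using h(3) by (auto simp: max.commute)
  qed
  have op: "openin (subtopology X M) S" if "S \<subseteq> M" "\<And>x y. x \<in> S \<Longrightarrow> y \<in> P x \<Longrightarrow> y \<in> M \<Longrightarrow> y \<in> S" for S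
  proof (subst openin_subopen, intro ballI)
    fix x assume "x \<in> S"
    then show "\<exists>T. openin (subtopology X M) T \<and> x \<in> T \<and> T \<subseteq> S"
      using that P[of x] by (intro exI[of _ "P x \<inter> M"]) (auto intro: openin_subtopology_Int)
  qed
  have A_sub: "A \<subseteq> M" by (auto simp: A_def)
  have oA: "openin (subtopology X M) A"
  proof (rule op[OF A_sub])
    fix x y assume h: "x \<in> A" "y \<in> P x" "y \<in> M"
    then have xM: "x \<in> M" using A_sub by auto
    show "y \<in> A" by (rule step[OF xM h(2,3) P(2)[OF xM] h(1)])
  qed
  have "openin (subtopology X M) (M - A)"
  proof (rule op)
    fix x y assume h: "x \<in> M - A" "y \<in> P x" "y \<in> M"
    then have xM: "x \<in> M" by simp
    have "y \<notin> A" using step[OF xM P(2)[OF xM] xM h(2)] h(1) by auto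
    then show "y \<in> M - A" using h(3) by simp
  qed auto
  then have cA: "closedin (subtopology X M) A"
    using M_subset A_sub unfolding closedin_def by (simp add: Int_absorb1)
  have conn: "connected_space (subtopology X M)" using connected_M by (simp add: connectedin_def)
  have "p \<in> A" unfolding A_def using p P(2,3)[OF p] by auto
  moreover from iffD1[OF connected_space_clopen_in conn, rule_format, OF conjI[OF oA cA]]
  have "A = {} \<or> A = topspace (subtopology X M)" .
  ultimately have "A = topspace (subtopology X M)" by auto
  then have AM: "A = M" using M_subset by auto
  then have "\<forall>x\<in>M. \<exists>K. joined K p x \<and> joined K x p" unfolding A_def by auto
  then obtain K where K: "\<forall>x\<in>M. joined (K x) p x \<and> joined (K x) x p" by (rule bchoice[elim_format]) (elim exE)
  have "\<exists>G. finite G \<and> G \<subseteq> P ` M \<and> M \<subseteq> \<Union>G"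
    by (rule compactinD[OF compact_M]) (use P in auto)
  then obtain G where G: "finite G" "G \<subseteq> P ` M" "M \<subseteq> \<Union>G" by (elim exE conjE)
  then obtain M' where M': "M' \<subseteq> M" "finite M'" "G = P ` M'" using finite_subset_image by metis
  define L where "L = (\<Sum>x\<in>M'. \<bar>2 * max (K x) (C x)\<bar>)"
  have L: "joined L p y \<and> joined L y p" if y: "y \<in> M" for y
  proof -
    obtain x where x: "x \<in> M'" "y \<in> P x" using G(3) M'(3) y by auto
    have xM: "x \<in> M" using x(1) M'(1) by auto
    have "2 * max (K x) (C x) \<le> \<bar>2 * max (K x) (C x)\<bar>" by simp
    also have "\<dots> \<le> L" unfolding L_def using M'(2) x(1) by (intro member_le_sum) auto
    finally have le: "2 * max (K x) (C x) \<le> L" "2 * max (C x) (K x) \<le> L" by (simp_all add: max.commute)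
    have "joined (2 * max (K x) (C x)) p y" "joined (2 * max (C x) (K x)) y p"
      using K xM P[OF xM] x(2) y by (auto intro: joined_trans)
    then show ?thesis using le joined_mono by blast
  qed
  have "joined (2 * max L L) x y" if "x \<in> M" "y \<in> M" for x y
    using joined_trans[of L x p L y] L that by simp
  then show ?thesis by blast
qed

end

section \<open>Periods\<close>

lemma norm_vector_smult: "norm (c *s v) = norm c * norm (v :: complex ^ 'n)"
  by (simp add: norm_vec_def norm_mult L2_set_right_distrib)

lemma bounded_linear_vector_smult: "bounded_linear (\<lambda>v :: complex ^ 'n. c *s v)"
proof (rule bounded_linear_intro[where K = "norm c"])
  show "c *s (v + w) = c *s v + c *s w" for v w :: "complex ^ 'n"
    by (simp add: vector_add_ldistrib)
  show "c *s (a *\<^sub>R v) = a *\<^sub>R (c *s v)" for a and v :: "complex ^ 'n"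
    by (simp add: vec_eq_iff)
  show "norm (c *s v) \<le> norm v * norm c" for v :: "complex ^ 'n"
    by (simp add: norm_vector_smult mult.commute)
qed

lemma bounded_linear_Re_vec: "bounded_linear (Re_vec :: complex ^ 'n \<Rightarrow> real ^ 'n)"
proof (rule bounded_linear_intro[where K = 1])
  show "Re_vec (v + w) = Re_vec v + Re_vec w" for v w :: "complex ^ 'n"
    by (simp add: Re_vec_def vec_eq_iff)
  show "Re_vec (a *\<^sub>R v) = a *\<^sub>R Re_vec v" for a and v :: "complex ^ 'n"
    by (simp add: Re_vec_def vec_eq_iff)
  show "norm (Re_vec v) \<le> norm v * 1" for v :: "complex ^ 'n"
    by (auto simp: Re_vec_def norm_vec_def abs_Re_le_cmod intro!: L2_set_mono)
qed

text \<open>The map \<open>T\<close> is the identity for complex periods and the real part for real periods.\<close>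

locale period_problem = bordered_surface X \<A> M \<theta>
  for X :: "'a topology" and \<A> :: "'a chart set" and M :: "'a set" and \<theta> :: "'a form" +
  fixes f :: "'a \<Rightarrow> complex ^ 'n" and T :: "complex ^ 'n \<Rightarrow> 'b::euclidean_space"
  assumes f_continuous: "continuous_map (subtopology X M) euclidean f"
    and T_linear: "bounded_linear T"
begin

definition integrand :: "('a \<Rightarrow> complex) \<Rightarrow> (real \<Rightarrow> 'a) \<Rightarrow> real \<Rightarrow> 'b" where
  "integrand h \<gamma> t = T (pullback \<gamma> t *s (h (\<gamma> t) *s f (\<gamma> t)))"

definition zero_periods :: "('a \<Rightarrow> complex) \<Rightarrow> bool" where
  "zero_periods h \<longleftrightarrow> (\<forall>\<gamma>. closed_curve X \<A> M \<gamma> \<longrightarrow> (integrand h \<gamma> has_integral 0) {0..1})"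

lemma T_linear_rules: "T (v + w) = T v + T w" "T (v - w) = T v - T w" "T (a *\<^sub>R v) = a *\<^sub>R T v" "T 0 = 0"
  using T_linear by (simp_all add: linear_simps bounded_linear.linear linear_add linear_diff linear_scale linear_0)

lemma integrand_add: "integrand (\<lambda>x. h x + h' x) \<gamma> = (\<lambda>t. integrand h \<gamma> t + integrand h' \<gamma> t)"
  by (simp add: integrand_def T_linear_rules[symmetric] vector_add_ldistrib vector_sadd_rdistrib fun_eq_iff)

lemma integrand_diff: "integrand (\<lambda>x. h x - h' x) \<gamma> = (\<lambda>t. integrand h \<gamma> t - integrand h' \<gamma> t)"
  by (simp add: integrand_def T_linear_rules[symmetric] vector_sub_rdistrib vector_ssub_ldistrib fun_eq_iff)

lemma integrand_bound:
  "\<exists>K\<ge>0. \<forall>h \<gamma> t. \<gamma> t \<in> M \<longrightarrow> norm (integrand h \<gamma> t) \<le> K * norm (pullback \<gamma> t) * norm (h (\<gamma> t))"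
proof -
  have "compactin (subtopology X M) M" using compact_M by (simp add: compactin_subtopology)
  then have "compactin euclidean (f ` M)" using f_continuous by (rule image_compactin)
  then have "bounded (f ` M)" by (simp add: compact_imp_bounded)
  then obtain F where F: "\<forall>v\<in>f ` M. norm v \<le> F" unfolding bounded_iff by (elim exE)
  obtain K where K: "K \<ge> 0" "\<And>v. norm (T v) \<le> norm v * K"
    using bounded_linear.nonneg_bounded[OF T_linear] by auto
  have "norm (integrand h \<gamma> t) \<le> (\<bar>F\<bar> * K) * norm (pullback \<gamma> t) * norm (h (\<gamma> t))" if "\<gamma> t \<in> M" for h \<gamma> t
  proof -
    have "norm (f (\<gamma> t)) \<le> F" using F that by auto
    then have fF: "norm (f (\<gamma> t)) \<le> \<bar>F\<bar>" by linarith
    have "norm (integrand h \<gamma> t) \<le> norm (pullback \<gamma> t) * (norm (h (\<gamma> t)) * norm (f (\<gamma> t))) * K"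
      unfolding integrand_def using K(2) by (metis norm_vector_smult)
    also have "\<dots> \<le> norm (pullback \<gamma> t) * (norm (h (\<gamma> t)) * \<bar>F\<bar>) * K"
      using fF K(1) by (intro mult_right_mono mult_left_mono) auto
    finally show ?thesis by (simp add: mult_ac)
  qed
  then show ?thesis using K(1) by (intro exI[of _ "\<bar>F\<bar> * K"]) simp
qed

text \<open>The piece of \<open>\<gamma>\<close> up to the parameter \<open>u\<close> is closed up by a curve \<open>\<nu>\<close> of bounded speed. The period over the
  closed curve vanishes, so the integral over the piece is minus the integral over \<open>\<nu>\<close>, where the integrand
  is bounded. The constant is the same for all \<open>\<gamma>\<close> and \<open>u\<close>.\<close>

lemma partial_integral_bound:
  "\<exists>B\<ge>0. \<forall>h \<gamma> u H. zero_periods h \<longrightarrow> closed_curve X \<A> M \<gamma> \<longrightarrow> (\<forall>x\<in>M. norm (h x) \<le> H) \<longrightarrow>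
     u \<in> {0..1} \<longrightarrow> norm (integral {0..u} (integrand h \<gamma>)) \<le> B * H"
proof -
  obtain K where K: "K \<ge> 0" "\<And>h \<gamma> t. \<gamma> t \<in> M \<Longrightarrow> norm (integrand h \<gamma> t) \<le> K * norm (pullback \<gamma> t) * norm (h (\<gamma> t))"
    using integrand_bound by auto
  obtain C where C: "\<forall>x\<in>M. \<forall>y\<in>M. joined C x y" using uniformly_joined by (elim exE)
  have "norm (integral {0..u} (integrand h \<gamma>)) \<le> (K * \<bar>C\<bar>) * H"
    if h: "zero_periods h" and cl: "closed_curve X \<A> M \<gamma>" and H: "\<forall>x\<in>M. norm (h x) \<le> H" and u01: "u \<in> {0..1}" for h \<gamma> u H
  proof (cases "u = 0")
    case True
    obtain p where "p \<in> M" using M_nonempty by auto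
    then have "0 \<le> H" using H order_trans[OF norm_ge_zero] by blast
    then show ?thesis using K(1) by (simp add: True)
  next
    case False
    then have u: "0 < u" "u \<le> 1" using u01 by auto
    have \<gamma>: "M_curve \<gamma>" "\<gamma> 0 = \<gamma> 1" using cl unfolding closed_curve_iff by auto
    obtain S where S: "finite S" "\<forall>t\<in>{0<..<1} - S. smooth_at \<gamma> t"
      using smooth_at_finite_exceptions[OF \<gamma>(1)] by (elim exE conjE)
    have M0: "0 \<le> H" using H M_curveD(2)[OF \<gamma>(1), of 0] order_trans[OF norm_ge_zero, of "h (\<gamma> 0)" H] by simp
    have "joined C (\<gamma> u) (\<gamma> 0)" using C M_curveD(2)[OF \<gamma>(1)] u by simp
    then obtain \<nu> S1 where \<nu>: "M_curve \<nu>" "\<nu> 0 = \<gamma> u" "\<nu> 1 = \<gamma> 0" "finite S1"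
      "\<forall>t\<in>{0<..<1} - S1. norm (pullback \<nu> t) \<le> C"
      unfolding joined_def by (elim exE conjE)
    obtain S2 where S2: "finite S2" "\<forall>t\<in>{0<..<1} - S2. smooth_at \<nu> t"
      using smooth_at_finite_exceptions[OF \<nu>(1)] by (elim exE conjE)
    define \<gamma>' where "\<gamma>' s = \<gamma> (u * s)" for s
    have \<gamma>': "M_curve \<gamma>'" unfolding \<gamma>'_def[abs_def] using u by (intro M_curve_restrict[OF \<gamma>(1)]) auto
    let ?\<sigma> = "join_curves \<gamma>' \<nu>"
    have \<sigma>: "M_curve ?\<sigma>" using \<nu>(2) by (intro M_curve_join[OF \<gamma>' \<nu>(1)]) (simp add: \<gamma>'_def)
    have "closed_curve X \<A> M ?\<sigma>"
      unfolding closed_curve_iff using \<sigma> \<nu>(3) by (simp add: join_curves_def \<gamma>'_def)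
    then have I0: "(integrand h ?\<sigma> has_integral 0) {0..1}" using h unfolding zero_periods_def by simp
    \<comment> \<open>On the first half of the parameter interval the integrand is the one of \<open>\<gamma>\<close> at speed \<open>2 * u\<close>.\<close>
    have "integrand h \<gamma> integrable_on {0..1}"
      using h cl unfolding zero_periods_def by (blast intro: has_integral_integrable)
    then have "integrand h \<gamma> integrable_on {0..u}"
      by (rule integrable_subinterval_real) (use u in auto)
    then have J: "(integrand h \<gamma> has_integral integral {0..u} (integrand h \<gamma>)) {0..u}" (is "(_ has_integral ?J) _")
      by (rule integrable_integral)
    have im: "(\<lambda>x. x / (2 * u)) ` {0..u} = {0..1/2}"
    proof (intro equalityI subsetI)
      fix y assume "y \<in> {0..1/2::real}"
      then show "y \<in> (\<lambda>x. x / (2 * u)) ` {0..u}"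
        using u by (intro image_eqI[of _ _ "2 * u * y"]) (auto simp: field_simps)
    qed (use u in \<open>auto simp: field_simps\<close>)
    have "((\<lambda>s. integrand h \<gamma> (2 * u * s)) has_integral (1 / \<bar>2 * u\<bar>) *\<^sub>R ?J) {0..1/2}"
      using has_integral_stretch_real[OF J, of "2 * u"] u unfolding im by simp
    then have "((\<lambda>s. (2 * u) *\<^sub>R integrand h \<gamma> (2 * u * s)) has_integral (2 * u) *\<^sub>R ((1 / \<bar>2 * u\<bar>) *\<^sub>R ?J)) {0..1/2}"
      by (rule has_integral_cmul)
    then have J': "((\<lambda>s. (2 * u) *\<^sub>R integrand h \<gamma> (2 * u * s)) has_integral ?J) {0..1/2}" using u by simp
    have I1: "(integrand h ?\<sigma> has_integral ?J) {0..1/2}"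
    proof (rule has_integral_spike_finite[OF _ _ J'])
      show "finite ((\<lambda>t. t / (2 * u)) ` S \<union> {0, 1/2})" using S(1) by simp
      fix s assume s: "s \<in> {0..1/2} - ((\<lambda>t. t / (2 * u)) ` S \<union> {0, 1/2})"
      then have s01: "0 < s" "s < 1/2" by auto
      have nS: "2 * u * s \<notin> S"
      proof
        assume "2 * u * s \<in> S"
        then have "s \<in> (\<lambda>t. t / (2 * u)) ` S" using u by (intro image_eqI[of _ _ "2 * u * s"]) auto
        then show False using s by simp
      qed
      have "2 * u * s < 1" using mult_less_le_imp_less[of "2 * s" 1 u 1] s01 u by (simp add: mult_ac)
      then have sm: "smooth_at \<gamma> (2 * u * s + 0)" using S(2) nS s01 u by simp
      have \<sigma>s: "?\<sigma> s' = \<gamma> (2 * u * s' + 0)" if "s' \<in> {0<..<1/2}" for s'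
        using that by (simp add: join_curves_def \<gamma>'_def mult_ac)
      have e1: "pullback ?\<sigma> s = of_real (2 * u) * pullback \<gamma> (2 * u * s + 0)"
        by (rule form_along_reparametrize[OF \<gamma>(1) sm open_greaterThanLessThan[of 0 "1/2"] _ \<sigma>s]) (use s01 in auto)
      have e2: "?\<sigma> s = \<gamma> (2 * u * s)" using \<sigma>s[of s] s01 by simp
      have e3: "(of_real (2 * u) * c) *s v = (2 * u) *\<^sub>R (c *s v)" for c :: complex and v :: "complex ^ 'n"
      proof -
        have "complex_of_real (2 * u) * c * w = (2 * u) *\<^sub>R (c * w)" for w
          by (simp only: scaleR_conv_of_real mult.assoc)
        then show ?thesis by (simp add: vec_eq_iff del: of_real_mult)
      qed
      show "integrand h ?\<sigma> s = (2 * u) *\<^sub>R integrand h \<gamma> (2 * u * s)"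
        unfolding integrand_def by (simp only: e1 e2 e3 add_0_right T_linear_rules)
    qed
    \<comment> \<open>On the second half the curve is \<open>\<nu>\<close> at double speed, and the integrand is bounded.\<close>
    have "integrand h ?\<sigma> integrable_on {0..1}" using I0 by (rule has_integral_integrable)
    then have "integrand h ?\<sigma> integrable_on {1/2..1}" by (rule integrable_subinterval_real) auto
    then have I2: "(integrand h ?\<sigma> has_integral integral {1/2..1} (integrand h ?\<sigma>)) {1/2..1}" (is "(_ has_integral ?I2) _")
      by (rule integrable_integral)
    have "norm ?I2 \<le> (2 * (K * \<bar>C\<bar> * H)) * measure lborel (cbox (1/2) (1::real))"
    proof (rule has_integral_bound_spike_finite)
      show "0 \<le> 2 * (K * \<bar>C\<bar> * H)" using K(1) M0 by simp
      show "finite ((\<lambda>t. (t + 1) / 2) ` (S1 \<union> S2) \<union> {1/2, 1})" using \<nu>(4) S2(1) by simp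
      show "(integrand h ?\<sigma> has_integral ?I2) (cbox (1/2) 1)" using I2 by (simp add: cbox_interval)
      fix s assume s: "s \<in> cbox (1/2) 1 - ((\<lambda>t. (t + 1) / 2) ` (S1 \<union> S2) \<union> {1/2, 1})"
      then have s01: "1/2 < s" "s < 1" by (auto simp: cbox_interval)
      have nS: "2 * s - 1 \<notin> S1 \<union> S2"
      proof
        assume "2 * s - 1 \<in> S1 \<union> S2"
        then have "s \<in> (\<lambda>t. (t + 1) / 2) ` (S1 \<union> S2)" by (intro image_eqI[of _ _ "2 * s - 1"]) auto
        then show False using s by simp
      qed
      have "pullback ?\<sigma> s = 2 * pullback \<nu> (2 * s - 1)"
        using s01 nS S2(2) by (intro form_along_join(2)[OF \<gamma>' \<nu>(1)]) auto
      moreover have "norm (pullback \<nu> (2 * s - 1)) \<le> C" using \<nu>(5) s01 nS by auto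
      ultimately have fs: "norm (pullback ?\<sigma> s) \<le> 2 * \<bar>C\<bar>" by (simp add: norm_mult)
      have sM: "?\<sigma> s \<in> M" using M_curveD(2)[OF \<sigma>] s01 by simp
      have "norm (integrand h ?\<sigma> s) \<le> K * norm (pullback ?\<sigma> s) * norm (h (?\<sigma> s))"
        by (rule K(2)[where \<gamma> = ?\<sigma> and t = s, OF sM])
      also have "\<dots> \<le> K * (2 * \<bar>C\<bar>) * H"
        using fs H sM K(1) by (intro mult_mono) auto
      finally show "norm (integrand h ?\<sigma> s) \<le> 2 * (K * \<bar>C\<bar> * H)" by simp
    qed
    then have b: "norm ?I2 \<le> K * \<bar>C\<bar> * H" by simp
    have "(integrand h ?\<sigma> has_integral ?J + ?I2) {0..1}"
      by (rule has_integral_combine[OF _ _ I1 I2]) auto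
    then have "?J + ?I2 = 0" using I0 by (rule has_integral_unique)
    then have "norm ?J = norm ?I2" by (metis add_eq_0_iff norm_minus_cancel)
    then show ?thesis using b by simp
  qed
  then show ?thesis using K(1) by (intro exI[of _ "K * \<bar>C\<bar>"]) auto
qed

lemma continuous_along_curve:
  fixes u :: "'a \<Rightarrow> 'c::topological_space"
  assumes "M_curve \<gamma>" "continuous_map (subtopology X M) euclidean u"
  shows "continuous_on {0..1} (\<lambda>t. u (\<gamma> t))"
proof -
  have "continuous_map (top_of_set {0..1}) (subtopology X M) \<gamma>"
    using assms(1) unfolding M_curve_def pathin_def by simp
  from continuous_map_compose[OF this assms(2)] show ?thesis by (simp add: o_def)
qed

lemma continuous_on_integrand:
  assumes \<gamma>: "M_curve \<gamma>" and h: "continuous_map (subtopology X M) euclidean h"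
    and I: "I \<subseteq> {0..1}" "continuous_on I (pullback \<gamma>)"
  shows "continuous_on I (integrand h \<gamma>)"
proof -
  have hc: "continuous_on I (\<lambda>t. h (\<gamma> t))" and fc: "continuous_on I (\<lambda>t. f (\<gamma> t))"
    using continuous_on_subset[OF continuous_along_curve[OF \<gamma>] I(1)] h f_continuous by blast+
  have "continuous_on I (\<lambda>t. pullback \<gamma> t *s (h (\<gamma> t) *s f (\<gamma> t)))"
    unfolding vector_scalar_mult_def using hc fc I(2)
    by (intro continuous_intros) auto
  then show ?thesis
    unfolding integrand_def[abs_def] by (rule bounded_linear.continuous_on[OF T_linear])
qed

text \<open>The partial integrals \<open>G n\<close> are uniformly Cauchy by the preceding bound, applied to differences. On a
  short interval around a smooth parameter the form is bounded along the curve, so there the integrands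
  converge uniformly and the limit of \<open>G n\<close> is a primitive of the limit integrand.\<close>

lemma zero_periods_limit:
  fixes h :: "nat \<Rightarrow> 'a \<Rightarrow> complex"
  assumes hc: "\<And>n. continuous_map (subtopology X M) euclidean (h n)" and kc: "continuous_map (subtopology X M) euclidean k"
    and zero: "\<And>n. zero_periods (h n)"
    and unif: "\<And>e. e > 0 \<Longrightarrow> \<exists>n0. \<forall>n\<ge>n0. \<forall>x\<in>M. norm (h n x - k x) \<le> e"
  shows "zero_periods k"
  unfolding zero_periods_def
proof (intro allI impI)
  fix \<gamma> assume cl: "closed_curve X \<A> M \<gamma>"
  then have \<gamma>: "M_curve \<gamma>" "\<gamma> 0 = \<gamma> 1" unfolding closed_curve_iff by auto
  obtain S where S: "finite S" "\<forall>t\<in>{0<..<1} - S. smooth_at \<gamma> t"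
    using smooth_at_finite_exceptions[OF \<gamma>(1)] by (elim exE conjE)
  obtain B where B: "B \<ge> 0" "\<And>h \<gamma> u H. zero_periods h \<Longrightarrow> closed_curve X \<A> M \<gamma> \<Longrightarrow> (\<forall>x\<in>M. norm (h x) \<le> H) \<Longrightarrow>
     u \<in> {0..1} \<Longrightarrow> norm (integral {0..u} (integrand h \<gamma>)) \<le> B * H"
    using partial_integral_bound by auto
  obtain K where K: "K \<ge> 0" "\<And>h \<gamma> t. \<gamma> t \<in> M \<Longrightarrow> norm (integrand h \<gamma> t) \<le> K * norm (pullback \<gamma> t) * norm (h (\<gamma> t))"
    using integrand_bound by auto
  have int0: "(integrand (h n) \<gamma> has_integral 0) {0..1}" for n using zero cl unfolding zero_periods_def by simp
  then have intb: "integrand (h n) \<gamma> integrable_on {0..1}" for n by (rule has_integral_integrable)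
  have intu: "integrand (h n) \<gamma> integrable_on {a..b}" if "0 \<le> a" "b \<le> 1" for n a b
    using intb by (rule integrable_subinterval_real) (use that in auto)
  define G where "G n t = integral {0..t} (integrand (h n) \<gamma>)" for n t
  have zd: "zero_periods (\<lambda>x. h m x - h n x)" for m n
    unfolding zero_periods_def integrand_diff
  proof (intro allI impI)
    fix \<gamma> assume "closed_curve X \<A> M \<gamma>"
    then have "(integrand (h n) \<gamma> has_integral 0) {0..1}" for n using zero unfolding zero_periods_def by simp
    from has_integral_diff[OF this[of m] this[of n]]
    show "((\<lambda>t. integrand (h m) \<gamma> t - integrand (h n) \<gamma> t) has_integral 0) {0..1}" by simp
  qed
  have Gd: "norm (G m t - G n t) \<le> B * e" if t: "t \<in> {0..1}" and e: "\<forall>x\<in>M. norm (h m x - h n x) \<le> e" for m n t e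
  proof -
    have "G m t - G n t = integral {0..t} (integrand (\<lambda>x. h m x - h n x) \<gamma>)"
      unfolding G_def integrand_diff using intu t by (intro integral_diff[symmetric]) auto
    then show ?thesis using B(2)[OF zd cl e t] by simp
  qed
  have "uniformly_Cauchy_on {0..1} G"
  proof (rule uniformly_Cauchy_onI)
    fix e :: real assume e: "e > 0"
    define d where "d = e / (4 * (B + 1))"
    have d: "d > 0" using e B(1) by (simp add: d_def)
    obtain n0 where n0: "\<forall>n\<ge>n0. \<forall>x\<in>M. norm (h n x - k x) \<le> d" using unif[OF d] by (elim exE)
    have "dist (G m t) (G n t) < e" if t: "t \<in> {0..1}" and mn: "m \<ge> n0" "n \<ge> n0" for t m n
    proof -
      have "\<forall>x\<in>M. norm (h m x - h n x) \<le> 2 * d"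
      proof
        fix x assume "x \<in> M"
        then have "norm (h m x - k x) \<le> d" "norm (h n x - k x) \<le> d" using n0 mn by auto
        then show "norm (h m x - h n x) \<le> 2 * d"
          using norm_triangle_ineq4[of "h m x - k x" "h n x - k x"] by simp
      qed
      from Gd[OF t this] have "norm (G m t - G n t) \<le> B * (2 * d)" .
      also have "\<dots> \<le> (B + 1) * (2 * d)" using d by (intro mult_right_mono) auto
      also have "\<dots> = e / 2" using B(1) by (simp add: d_def field_simps)
      finally show ?thesis using e by (simp add: dist_norm)
    qed
    then show "\<exists>N. \<forall>x\<in>{0..1}. \<forall>m\<ge>N. \<forall>n\<ge>N. dist (G m x) (G n x) < e" by blast
  qed
  then have "uniformly_convergent_on {0..1} G" by (rule Cauchy_uniformly_convergent)
  then obtain G' where G': "uniform_limit {0..1} G G' sequentially" unfolding uniformly_convergent_on_def by (elim exE)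
  have Glim: "(\<lambda>n. G n t) \<longlonglongrightarrow> G' t" if "t \<in> {0..1}" for t using G' that by (rule tendsto_uniform_limitI)
  have cont: "continuous_on {0..1} G'"
  proof (rule uniform_limit_theorem[OF _ G'])
    show "\<forall>\<^sub>F n in sequentially. continuous_on {0..1} (G n)"
      unfolding G_def[abs_def] by (intro always_eventually allI indefinite_integral_continuous_1 intb)
  qed simp
  have deriv: "(G' has_vector_derivative integrand k \<gamma> t) (at t)" if t: "t \<in> {0<..<1} - S" for t
  proof -
    obtain I where I: "open I" "t \<in> I" "I \<subseteq> {0..1}" "continuous_on I (pullback \<gamma>)"
      using smooth_at_form_along[OF \<gamma>(1) bspec[OF S(2) t]] by (elim exE conjE)
    obtain d where d: "d > 0" "cball t d \<subseteq> I" using I(1,2) open_contains_cball by metis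
    define p q where "p = t - d" and "q = t + d"
    have pqI: "{p..q} \<subseteq> I" using d(2) by (auto simp: p_def q_def cball_eq_atLeastAtMost)
    have "p \<in> {p..q}" "q \<in> {p..q}" using d(1) by (simp_all add: p_def q_def)
    then have "p \<in> {0..1}" "q \<in> {0..1}" using pqI I(3) by blast+
    then have pq: "p < t" "t < q" "0 \<le> p" "q \<le> 1" using d(1) by (simp_all add: p_def q_def)
    have pq01: "{p..q} \<subseteq> {0..1}" using pq by auto
    have fc: "continuous_on {p..q} (pullback \<gamma>)" using I(4) pqI by (rule continuous_on_subset)
    have gc: "continuous_on {p..q} (integrand (h n) \<gamma>)" for n
      by (rule continuous_on_integrand[OF \<gamma>(1) hc pq01 fc])
    have kcc: "continuous_on {p..q} (integrand k \<gamma>)"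
      by (rule continuous_on_integrand[OF \<gamma>(1) kc pq01 fc])
    have "bounded (pullback \<gamma> ` {p..q})" using compact_continuous_image[OF fc compact_Icc] by (rule compact_imp_bounded)
    then obtain L where L: "\<forall>v\<in>pullback \<gamma> ` {p..q}. norm v \<le> L" unfolding bounded_iff by (elim exE)
    have ul: "uniform_limit {p..q} (\<lambda>n. integrand (h n) \<gamma>) (integrand k \<gamma>) sequentially"
      unfolding uniform_limit_iff
    proof (intro allI impI)
      fix e :: real assume e: "e > 0"
      define c where "c = e / (2 * (K * \<bar>L\<bar> + 1))"
      have KL: "K * \<bar>L\<bar> + 1 > 0" using K(1) by (simp add: add_nonneg_pos)
      have c: "c > 0" using e KL by (simp add: c_def)
      obtain n0 where n0: "\<forall>n\<ge>n0. \<forall>x\<in>M. norm (h n x - k x) \<le> c" using unif[OF c] by (elim exE)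
      have "dist (integrand (h n) \<gamma> s) (integrand k \<gamma> s) < e" if n: "n \<ge> n0" and s: "s \<in> {p..q}" for n s
      proof -
        have sM: "\<gamma> s \<in> M" using M_curveD(2)[OF \<gamma>(1)] s pq01 by auto
        have fl: "norm (pullback \<gamma> s) \<le> \<bar>L\<bar>" using bspec[OF L imageI[OF s]] by linarith
        have "dist (integrand (h n) \<gamma> s) (integrand k \<gamma> s) = norm (integrand (\<lambda>x. h n x - k x) \<gamma> s)"
          unfolding integrand_diff dist_norm ..
        also have "\<dots> \<le> K * norm (pullback \<gamma> s) * norm (h n (\<gamma> s) - k (\<gamma> s))"
          by (rule K(2)[where \<gamma> = \<gamma> and t = s, OF sM])
        also have "\<dots> \<le> K * \<bar>L\<bar> * c"
          using fl K(1) n0 n sM by (intro mult_mono) auto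
        also have "\<dots> \<le> (K * \<bar>L\<bar> + 1) * c" using c by (intro mult_right_mono) auto
        also have "\<dots> = e / 2"
        proof -
          have "y * (e / (2 * y)) = e / 2" if "y > 0" for y :: real using that by simp
          from this[OF KL] show ?thesis unfolding c_def .
        qed
        finally show ?thesis using e by simp
      qed
      then show "\<forall>\<^sub>F n in sequentially. \<forall>s\<in>{p..q}. dist (integrand (h n) \<gamma> s) (integrand k \<gamma> s) < e"
        unfolding eventually_sequentially by (intro exI[of _ n0]) simp
    qed
    have eq: "G' s = G' p + integral {p..s} (integrand k \<gamma>)" if s: "s \<in> {p..q}" for s
    proof -
      have sub: "{p..s} \<subseteq> {p..q}" using s by auto
      obtain I J where IJ: "\<And>n. (integrand (h n) \<gamma> has_integral I n) {p..s}" "(integrand k \<gamma> has_integral J) {p..s}" "I \<longlonglongrightarrow> J"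
        using uniform_limit_integral[OF uniform_limit_on_subset[OF ul sub] continuous_on_subset[OF gc sub] sequentially_bot]
        by metis
      have "G n s - G n p = I n" for n
      proof -
        have "G n p + integral {p..s} (integrand (h n) \<gamma>) = G n s"
          unfolding G_def using s pq by (intro Henstock_Kurzweil_Integration.integral_combine intu) auto
        then show ?thesis using integral_unique[OF IJ(1)[of n]] by (simp add: algebra_simps)
      qed
      then have "(\<lambda>n. G n s - G n p) \<longlonglongrightarrow> J" using IJ(3) by simp
      moreover have "(\<lambda>n. G n s - G n p) \<longlonglongrightarrow> G' s - G' p"
        using s pq by (intro tendsto_diff Glim) auto
      ultimately have "G' s - G' p = J" by (rule LIMSEQ_unique[rotated])
      then show ?thesis using integral_unique[OF IJ(2)] by (simp add: algebra_simps)
    qed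
    have "((\<lambda>s. integral {p..s} (integrand k \<gamma>)) has_vector_derivative integrand k \<gamma> t) (at t within {p..q})"
      using kcc pq by (intro integral_has_vector_derivative) auto
    then have "((\<lambda>s. integral {p..s} (integrand k \<gamma>)) has_vector_derivative integrand k \<gamma> t) (at t)"
      using pq by (simp add: at_within_Icc_at)
    then have "((\<lambda>s. G' p + integral {p..s} (integrand k \<gamma>)) has_vector_derivative integrand k \<gamma> t) (at t)"
      by (auto intro!: derivative_eq_intros)
    then show ?thesis
      by (rule has_vector_derivative_transform_within_open[OF _ open_greaterThanLessThan[of p q]])
        (use pq in simp, rule eq[symmetric], simp)
  qed
  have "(integrand k \<gamma> has_integral G' 1 - G' 0) {0..1}"
    by (rule fundamental_theorem_of_calculus_interior_strong[OF S(1) _ deriv cont]) auto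
  moreover have "G' 0 = 0"
  proof -
    have "G n 0 = 0" for n by (simp add: G_def)
    with Glim[of 0] show ?thesis by (simp add: LIMSEQ_const_iff)
  qed
  moreover have "G' 1 = 0"
  proof -
    have "G n 1 = 0" for n unfolding G_def using int0 by (rule integral_unique)
    with Glim[of 1] show ?thesis by (simp add: LIMSEQ_const_iff)
  qed
  ultimately show "(integrand k \<gamma> has_integral 0) {0..1}" by simp
qed

lemma Ar_continuous: "h \<in> Ar r \<Longrightarrow> continuous_map (subtopology X M) euclidean h"
  using theta_jet_continuous[OF theta_jet_jet, of h r 0] jet_0[of h r] by simp

lemma zero_periods_closed:
  fixes h :: "nat \<Rightarrow> 'a \<Rightarrow> complex"
  assumes h: "\<And>n. h n \<in> Ar r" "\<And>n. zero_periods (h n)" and k: "k \<in> Ar r"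
    and lim: "(\<lambda>n. jet_norm r (h n - k)) \<longlonglongrightarrow> 0"
  shows "zero_periods k"
proof (rule zero_periods_limit[of h k])
  fix e :: real assume "e > 0"
  from LIMSEQ_D[OF lim this] obtain n0 where n0: "\<forall>n\<ge>n0. norm (jet_norm r (h n - k) - 0) < e" by (elim exE)
  have "norm (h n x - k x) \<le> e" if "n \<ge> n0" "x \<in> M" for n x
  proof -
    have "norm ((h n - k) x) \<le> jet_norm r (h n - k)"
      by (rule norm_le_jet_norm[OF Ar_diff(1)[OF h(1) k] that(2)])
    moreover have "jet_norm r (h n - k) \<le> e" using n0 that(1) by (force simp: abs_less_iff)
    ultimately show ?thesis by simp
  qed
  then show "\<exists>n0. \<forall>n\<ge>n0. \<forall>x\<in>M. norm (h n x - k x) \<le> e" by (intro exI[of _ n0]) simp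
qed (use h k Ar_continuous in auto)

text \<open>The minimum of \<open>\<bar>h\<bar>\<close> on the compact set \<open>M\<close> is positive.\<close>

lemma nonzero_open:
  "openin (norm_topology (Ar r) (jet_norm r)) (Ar_space_nonzero X \<A> M r)"
  unfolding normed_on.openin_norm_topology[OF normed_Ar_C]
proof (intro conjI ballI)
  show "Ar_space_nonzero X \<A> M r \<subseteq> Ar r" by (auto simp: Ar_space_nonzero_def)
  fix h assume "h \<in> Ar_space_nonzero X \<A> M r"
  then have h: "h \<in> Ar r" "\<And>x. x \<in> M \<Longrightarrow> h x \<noteq> 0" by (auto simp: Ar_space_nonzero_def)
  have "compactin (subtopology X M) M" using compact_M by (simp add: compactin_subtopology)
  then have "compactin euclidean (h ` M)" using Ar_continuous[OF h(1)] by (rule image_compactin)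
  then have "compact (norm ` h ` M)" by (intro compact_continuous_image continuous_intros) simp
  from compact_attains_inf[OF this] M_nonempty
  obtain x0 where x0: "x0 \<in> M" "\<And>x. x \<in> M \<Longrightarrow> norm (h x0) \<le> norm (h x)" by auto
  have "h' \<in> Ar_space_nonzero X \<A> M r" if h': "h' \<in> Ar r" "jet_norm r (h' - h) < norm (h x0)" for h'
  proof -
    have "h' x \<noteq> 0" if x: "x \<in> M" for x
    proof
      assume "h' x = 0"
      moreover have "norm ((h' - h) x) < norm (h x0)"
        using norm_le_jet_norm[OF Ar_diff(1)[OF h'(1) h(1)] x] h'(2) by linarith
      ultimately show False using x0(2)[OF x] by simp
    qed
    then show ?thesis using h'(1) by (simp add: Ar_space_nonzero_def)
  qed
  then show "\<exists>\<epsilon>>0. \<forall>h'\<in>Ar r. jet_norm r (h' - h) < \<epsilon> \<longrightarrow> h' \<in> Ar_space_nonzero X \<A> M r"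
    using h(2)[OF x0(1)] by (intro exI[of _ "norm (h x0)"]) simp
qed

text \<open>The prescribed periods \<open>p\<close> are arbitrary. They drop out of the difference of two solutions, whose periods
  all vanish.\<close>

lemma solutions_banach_atlas:
  fixes smul :: "'k::real_normed_field \<Rightarrow> ('a \<Rightarrow> complex) \<Rightarrow> ('a \<Rightarrow> complex)"
    and p :: "(real \<Rightarrow> 'a) \<Rightarrow> 'b"
  assumes banach: "banach_space_on smul (Ar r) (jet_norm r)"
    and scale: "\<And>a h. zero_periods h \<Longrightarrow> zero_periods (smul a h)"
    and reg: "\<And>W \<Omega> g. banach_space_on smul W (jet_norm r) \<Longrightarrow> openin (norm_topology W (jet_norm r)) \<Omega> \<Longrightarrow>
      \<forall>x\<in>\<Omega>. g x = x \<Longrightarrow> regular W (jet_norm r) W (jet_norm r) \<Omega> g"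
  defines "Y \<equiv> {h \<in> Ar_space_nonzero X \<A> M r. \<forall>\<gamma>. closed_curve X \<A> M \<gamma> \<longrightarrow> (integrand h \<gamma> has_integral p \<gamma>) {0..1}}"
  shows "Hausdorff_space (subtopology (Cr_topology X \<A> M r) Y) \<and>
    (\<exists>\<B>. banach_atlas smul regular (subtopology (Cr_topology X \<A> M r) Y) \<B>)"
proof (cases "Y = {}")
  case True
  have "Hausdorff_space (subtopology (Cr_topology X \<A> M r) Y)"
    unfolding True by (simp add: Hausdorff_space_def)
  moreover have "banach_atlas smul regular (subtopology (Cr_topology X \<A> M r) Y) {}"
    unfolding banach_atlas_def True by simp
  ultimately show ?thesis by blast
next
  case False
  then obtain h0 where h0: "h0 \<in> Y" by auto
  then have h0A: "h0 \<in> Ar r" unfolding Y_def Ar_space_nonzero_def by simp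
  interpret N: normed_on smul "Ar r" "jet_norm r" using banach by (rule normed_on_if_banach)
  interpret VS: vector_space smul by (rule N.vs)
  define W where "W = {h \<in> Ar r. zero_periods h}"
  have WA: "W \<subseteq> Ar r" unfolding W_def by auto
  have "zero_periods 0"
    unfolding zero_periods_def integrand_def[abs_def] by (simp add: T_linear_rules)
  moreover have "zero_periods (h + h')" if "zero_periods h" "zero_periods h'" for h h'
    unfolding zero_periods_def
  proof (intro allI impI)
    fix \<gamma> assume "closed_curve X \<A> M \<gamma>"
    then have "(integrand h \<gamma> has_integral 0) {0..1}" "(integrand h' \<gamma> has_integral 0) {0..1}"
      using that unfolding zero_periods_def by simp_all
    from has_integral_add[OF this] have "(integrand (\<lambda>x. h x + h' x) \<gamma> has_integral 0) {0..1}"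
      unfolding integrand_add by simp
    moreover have "(\<lambda>x. h x + h' x) = h + h'" by (simp add: fun_eq_iff)
    ultimately show "(integrand (h + h') \<gamma> has_integral 0) {0..1}" by simp
  qed
  ultimately have sub: "VS.subspace W"
    unfolding VS.subspace_def W_def using scale by simp
  have W: "banach_space_on smul W (jet_norm r)"
  proof (rule N.banach_closed_subspace[OF banach sub WA])
    fix h :: "nat \<Rightarrow> 'a \<Rightarrow> complex" and v
    assume "range h \<subseteq> W" and v: "v \<in> Ar r" "(\<lambda>n. jet_norm r (h n - v)) \<longlonglongrightarrow> 0"
    then have "h n \<in> Ar r" "zero_periods (h n)" for n unfolding W_def by auto
    from zero_periods_closed[OF this v] show "v \<in> W" unfolding W_def using v(1) by simp
  qed
  have Y: "Y = {h \<in> Ar_space_nonzero X \<A> M r. h - h0 \<in> W}"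
  proof -
    have "(\<forall>\<gamma>. closed_curve X \<A> M \<gamma> \<longrightarrow> (integrand h \<gamma> has_integral p \<gamma>) {0..1}) \<longleftrightarrow> h - h0 \<in> W"
      if h: "h \<in> Ar_space_nonzero X \<A> M r" for h
    proof -
      have hA: "h \<in> Ar r" using h by (simp add: Ar_space_nonzero_def)
      have d: "h - h0 = (\<lambda>x. h x - h0 x)" by (simp add: fun_eq_iff)
      have "(integrand h \<gamma> has_integral p \<gamma>) {0..1} \<longleftrightarrow> (integrand (h - h0) \<gamma> has_integral 0) {0..1}"
        if "closed_curve X \<A> M \<gamma>" for \<gamma>
      proof -
        have i0: "(integrand h0 \<gamma> has_integral p \<gamma>) {0..1}" using h0 that unfolding Y_def by simp
        show ?thesis
          unfolding d integrand_diff
        proof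
          assume "(integrand h \<gamma> has_integral p \<gamma>) {0..1}"
          from has_integral_diff[OF this i0]
          show "((\<lambda>t. integrand h \<gamma> t - integrand h0 \<gamma> t) has_integral 0) {0..1}" by simp
        next
          assume "((\<lambda>t. integrand h \<gamma> t - integrand h0 \<gamma> t) has_integral 0) {0..1}"
          from has_integral_add[OF this i0] show "(integrand h \<gamma> has_integral p \<gamma>) {0..1}" by simp
        qed
      qed
      then show ?thesis unfolding W_def zero_periods_def using Ar_diff(1)[OF hA h0A] by simp
    qed
    then show ?thesis unfolding Y_def by auto
  qed
  note atlas = N.affine_banach_atlas[where regular = regular and T = "Cr_topology X \<A> M r",
      OF Cr_topology_Ar W WA nonzero_open h0A Y Ar_subset_topspace reg[OF W]]
  show ?thesis by (intro conjI exI) (rule atlas(1), assumption+, rule atlas(2), assumption+)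
qed

end

theorem theorem6p1:
  fixes X :: "'a topology" and \<A> :: "'a chart set" and M :: "'a set"
    and \<theta> :: "'a form" and f :: "'a \<Rightarrow> complex ^ 'n"
  assumes "compact_bordered_riemann_surface X \<A> M"
    and "holomorphic_form_on X \<A> M \<theta>"
    and "nowhere_vanishing_form_on \<A> M \<theta>"
    and "class_A X \<A> M f"
    and "\<forall>x\<in>M. f x \<noteq> 0"
  shows "(\<forall>r. \<forall>\<qq> \<in> hom (homology_group 1 (subtopology X M)) (additive_group (vec.span (f ` M))).
            complex_banach_manifold (fun_scaleC :: complex \<Rightarrow> ('a \<Rightarrow> complex) \<Rightarrow> _)
              (subtopology (Cr_topology X \<A> M r)
                {h \<in> Ar_space_nonzero X \<A> M r. \<forall>\<gamma>. closed_curve X \<A> M \<gamma> \<longrightarrow>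
                   has_period \<A> \<theta> (\<lambda>x. h x *s f x) \<gamma> (\<qq> (curve_class X M \<gamma>))}))
       \<and> (\<forall>r. \<forall>\<qq> \<in> hom (homology_group 1 (subtopology X M)) (additive_group (vec.span (f ` M))).
            real_analytic_banach_manifold (fun_scaleR :: real \<Rightarrow> ('a \<Rightarrow> complex) \<Rightarrow> _)
              (subtopology (Cr_topology X \<A> M r)
                {h \<in> Ar_space_nonzero X \<A> M r. \<forall>\<gamma>. closed_curve X \<A> M \<gamma> \<longrightarrow>
                   has_real_period \<A> \<theta> (\<lambda>x. h x *s f x) \<gamma> (Re_vec (\<qq> (curve_class X M \<gamma>)))}))"
proof -
  interpret bordered_surface X \<A> M \<theta> using assms(1-3) by (rule bordered_surface.intro)
  have f: "continuous_map (subtopology X M) euclidean f"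
    using assms(4) unfolding class_A_def by blast
  interpret C: period_problem X \<A> M \<theta> f "\<lambda>v. v"
    by (intro period_problem.intro period_problem_axioms.intro bordered_surface_axioms f bounded_linear_ident)
  interpret R: period_problem X \<A> M \<theta> f Re_vec
    by (intro period_problem.intro period_problem_axioms.intro bordered_surface_axioms f bounded_linear_Re_vec)
  have C_scale: "C.zero_periods (fun_scaleC a h)" if h: "C.zero_periods h" for a h
    unfolding C.zero_periods_def
  proof (intro allI impI)
    fix \<gamma> assume "closed_curve X \<A> M \<gamma>"
    then have "(C.integrand h \<gamma> has_integral 0) {0..1}" using h unfolding C.zero_periods_def by simp
    from has_integral_linear[OF this bounded_linear_vector_smult, of a]
    have "((\<lambda>t. a *s C.integrand h \<gamma> t) has_integral 0) {0..1}" by (simp add: o_def)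
    moreover have "C.integrand (fun_scaleC a h) \<gamma> = (\<lambda>t. a *s C.integrand h \<gamma> t)"
      unfolding C.integrand_def fun_scaleC_def by (simp add: fun_eq_iff vector_smult_assoc mult_ac)
    ultimately show "(C.integrand (fun_scaleC a h) \<gamma> has_integral 0) {0..1}" by simp
  qed
  have R_scale: "R.zero_periods (fun_scaleR a h)" if h: "R.zero_periods h" for a h
    unfolding R.zero_periods_def
  proof (intro allI impI)
    fix \<gamma> assume "closed_curve X \<A> M \<gamma>"
    then have "(R.integrand h \<gamma> has_integral 0) {0..1}" using h unfolding R.zero_periods_def by simp
    from has_integral_cmul[OF this, of a]
    have "((\<lambda>t. a *\<^sub>R R.integrand h \<gamma> t) has_integral 0) {0..1}" by simp
    moreover have "R.integrand (fun_scaleR a h) \<gamma> = (\<lambda>t. a *\<^sub>R R.integrand h \<gamma> t)"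
    proof
      fix t
      have "c *s ((a *\<^sub>R b) *s v) = a *\<^sub>R (c *s (b *s v))" for b c :: complex and v :: "complex ^ 'n"
        by (simp add: vec_eq_iff)
      then show "R.integrand (fun_scaleR a h) \<gamma> t = a *\<^sub>R R.integrand h \<gamma> t"
        unfolding R.integrand_def fun_scaleR_def by (simp only: R.T_linear_rules)
    qed
    ultimately show "(R.integrand (fun_scaleR a h) \<gamma> has_integral 0) {0..1}" by simp
  qed
  have C_eq: "has_period \<A> \<theta> (\<lambda>x. h x *s f x) \<gamma> q \<longleftrightarrow> (C.integrand h \<gamma> has_integral q) {0..1}" for h \<gamma> q
    unfolding has_period_def C.integrand_def[abs_def] ..
  have R_eq: "has_real_period \<A> \<theta> (\<lambda>x. h x *s f x) \<gamma> q \<longleftrightarrow> (R.integrand h \<gamma> has_integral q) {0..1}" for h \<gamma> q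
    unfolding has_real_period_def R.integrand_def[abs_def] ..
  show ?thesis
    unfolding complex_banach_manifold_def real_analytic_banach_manifold_def C_eq R_eq
  proof (intro conjI[of "All P" "All Q" for P Q] allI ballI)
    fix r \<qq>
    show "Hausdorff_space (subtopology (Cr_topology X \<A> M r)
        {h \<in> Ar_space_nonzero X \<A> M r. \<forall>\<gamma>. closed_curve X \<A> M \<gamma> \<longrightarrow>
          (C.integrand h \<gamma> has_integral \<qq> (curve_class X M \<gamma>)) {0..1}}) \<and>
      (\<exists>\<B>. banach_atlas (fun_scaleC :: complex \<Rightarrow> ('a \<Rightarrow> complex) \<Rightarrow> _) (holomorphic_between fun_scaleC) (subtopology (Cr_topology X \<A> M r)
        {h \<in> Ar_space_nonzero X \<A> M r. \<forall>\<gamma>. closed_curve X \<A> M \<gamma> \<longrightarrow>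
          (C.integrand h \<gamma> has_integral \<qq> (curve_class X M \<gamma>)) {0..1}}) \<B>)"
      by (rule C.solutions_banach_atlas[where regular = "holomorphic_between fun_scaleC"
            and p = "\<lambda>\<gamma>. \<qq> (curve_class X M \<gamma>)", OF banach_Ar_C])
        (rule C_scale holomorphic_between_ident; assumption)+
    show "Hausdorff_space (subtopology (Cr_topology X \<A> M r)
        {h \<in> Ar_space_nonzero X \<A> M r. \<forall>\<gamma>. closed_curve X \<A> M \<gamma> \<longrightarrow>
          (R.integrand h \<gamma> has_integral Re_vec (\<qq> (curve_class X M \<gamma>))) {0..1}}) \<and>
      (\<exists>\<B>. banach_atlas (fun_scaleR :: real \<Rightarrow> ('a \<Rightarrow> complex) \<Rightarrow> _) (real_analytic_between fun_scaleR) (subtopology (Cr_topology X \<A> M r)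
        {h \<in> Ar_space_nonzero X \<A> M r. \<forall>\<gamma>. closed_curve X \<A> M \<gamma> \<longrightarrow>
          (R.integrand h \<gamma> has_integral Re_vec (\<qq> (curve_class X M \<gamma>))) {0..1}}) \<B>)"
      by (rule R.solutions_banach_atlas[where regular = "real_analytic_between fun_scaleR"
            and p = "\<lambda>\<gamma>. Re_vec (\<qq> (curve_class X M \<gamma>))", OF banach_Ar_R])
        (rule R_scale real_analytic_between_ident; assumption)+
  qed
qed

end
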